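(* Let $(\mathcal{A},\phi)$ be a non-degenerated $W^*$-probability space and let $(x_i)_{i\in\mathbb{Z}}$ be a bilateral infinite sequence of selfadjoint random variables in $\mathcal{A}$ which generate $\mathcal{A}$ as a von Neumann algebra, the unit of $\mathcal{A}$ being contained in the WOT-closure of the non-unital algebra generated by $(x_i)_{i\in\mathbb{Z}}$. For $k\in\mathbb{Z}$ let $\mathcal{A}^+_k$ be the WOT closure of the non-unital algebra generated by $\{x_i : i\geq k\}$, and let $\mathcal{A}^+_{tail}=\bigcap_{k>0}\mathcal{A}^+_k$. Then the following are equivalent: (a) The joint distribution of $(x_i)_{i\in\mathbb{Z}}$ is monotonically spreadable. (b) For all $k\in\mathbb{Z}$ there exists a $\phi$-preserving conditional expectation $E_k:\mathcal{A}^+_k\rightarrow\mathcal{A}^+_{tail}$ such that the sequence $(x_i)_{i\geq k}$ is identically distributed and monotonically independent with respect to $E_k$; moreover, $E_k|_{\mathcal{A}^+_{k'}}=E_{k'}$ whenever $k\leq k'$.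
   Context: **Non-degenerated $W^*$-probability space.** A pair $(\mathcal{A},\phi)$ with $\mathcal{A}$ a von Neumann algebra and $\phi$ a normal state such that $x=0$ whenever $\phi(axb)=0$ for all $a,b\in\mathcal{A}$ ($\phi$ is not assumed faithful). The GNS representation of $\phi$ is then faithful; $\mathcal{A}$ is identified with its image, and WOT refers to it. **Monotone spreadability.** $\mathbb{C}\langle X_1,\dots,X_n\rangle$ is the algebra of noncommutative polynomials. The joint distribution of $x_1,\dots,x_n\in\mathcal{A}$ is $\mu_{x_1,\dots,x_n}(p)=\phi(p(x_1,\dots,x_n))$. For $k<n$ in $\mathbb{N}$, $M_i(n,k)$ is the universal unital $C^*$-algebra generated by elements $u_{i,j}$ ($1\le i\le n$, $1\le j\le k$) such that: (1) each $u_{i,j}$ is an orthogonal projection; (2) with $P_j=\sum_{i=1}^n u_{i,j}$, $P_ju_{i',j'}=u_{i',j'}$ if $j'\le j$; (3) $P_jP_1=P_1$ for all $1\le j\le k$; (4) $u_{i,j}u_{i',j'}=0$ if $j<j'$ and $i\ge i'$. Put $\mathbf{P}=P_1$. Let $\alpha^{(m)}_{n,k}:\mathbb{C}\langle X_1,\dots,X_k\rangle\to\mathbb{C}\langle X_1,\dots,X_n\rangle\otimes M_i(n,k)$ be the unital homomorphism with $X_j\mapsto\sum_{i=1}^nX_i\otimes u_{i,j}$. The sequence $(x_1,\dots,x_n)$ is $M_i(n,k)$-invariant if $\mu_{x_1,\dots,x_k}(p)\mathbf{P}=\mathbf{P}\,\big[(\mu_{x_1,\dots,x_n}\otimes id)(\alpha^{(m)}_{n,k}(p))\big]\,\mathbf{P}$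 for all $p\in\mathbb{C}\langle X_1,\dots,X_k\rangle$; it is monotonically spreadable if this holds for all $k=1,\dots,n-1$. A sequence indexed by an ordered infinite set is monotonically spreadable if all its finite subsequences $(x_{i_1},\dots,x_{i_l})$, $i_1<\dots<i_l$, are. **Conditional expectations and independence.** Algebras need not be unital. For a subalgebra $\mathcal{B}$ of an algebra $\mathcal{C}$, a conditional expectation $E:\mathcal{C}\to\mathcal{B}$ is a surjective linear map with $E[b_1ab_2]=b_1E[a]b_2$ and $E[b]=b$ for $a\in\mathcal{C}$, $b,b_1,b_2\in\mathcal{B}$; $\phi$-preserving means $\phi\circ E=\phi$ on $\mathcal{C}$. $\mathcal{B}\langle X\rangle_0$ is the linear span of monomials $b_0Xb_1X\cdots Xb_n$, $n\ge1$, where each $b_j$ is in $\mathcal{B}$ or a scalar. A family $(x_i)_{i\in I}$ in $\mathcal{C}$ is identically distributed w.r.t. $E$ if $E[p(x_i)]=E[p(x_j)]$ for all $i,j\in I$, $p\in\mathcal{B}\langle X\rangle_0$. It is monotonically independent w.r.t. $E$ if $$E[p_1(x_{i_1})\cdots p_k(x_{i_k})\cdots p_n(x_{i_n})]=E[p_1(x_{i_1})\cdots p_{k-1}(x_{i_{k-1}})\,E[p_k(x_{i_k})]\,p_{k+1}(x_{i_{k+1}})\cdots p_n(x_{i_n})]$$ whenever $p_1,\dots,p_n\in\mathcal{B}\langle X\rangle_0$, $i_1\ne i_2\ne\cdots\ne i_n$ (consecutive indices distinct) and $i_{k-1}<i_k>i_{k+1}$, where for $k=1$ or $k=n$ the inequality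 involving the non-existent index is omitted. *)

theory Defs
  imports "HOL-Analysis.Analysis" "HOL-Library.Poly_Mapping" "HOL-Library.Nonpos_Ints"
begin

section \<open>Complex algebras and complex Hilbert spaces\<close>

class scaleC =
  fixes scaleC :: "complex \<Rightarrow> 'a \<Rightarrow> 'a"  (infixr \<open>*\<^sub>C\<close> 75)

class complex_vector = scaleC + ab_group_add +
  assumes scaleC_add_right: "c *\<^sub>C (x + y) = c *\<^sub>C x + c *\<^sub>C y"
    and scaleC_add_left: "(c + d) *\<^sub>C x = c *\<^sub>C x + d *\<^sub>C x"
    and scaleC_scaleC: "c *\<^sub>C (d *\<^sub>C x) = (c * d) *\<^sub>C x"
    and scaleC_one: "1 *\<^sub>C x = x"

text \<open>Not based on \<^class>\<open>ring_1\<close>, so that the zero algebra is allowed.\<close>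

class complex_algebra_1 = complex_vector + ring + monoid_mult +
  assumes mult_scaleC_left: "(c *\<^sub>C x) * y = c *\<^sub>C (x * y)"
    and mult_scaleC_right: "x * (c *\<^sub>C y) = c *\<^sub>C (x * y)"

text \<open>The inner product is conjugate-linear in the first argument.\<close>

class chilbert_space = banach + complex_vector +
  fixes cinner :: "'a \<Rightarrow> 'a \<Rightarrow> complex"
  assumes scaleR_scaleC: "r *\<^sub>R x = complex_of_real r *\<^sub>C x"
    and cinner_commute: "cinner x y = cnj (cinner y x)"
    and cinner_add_right: "cinner x (y + z) = cinner x y + cinner x z"
    and cinner_scaleC_right: "cinner x (c *\<^sub>C y) = c * cinner x y"
    and cinner_self: "cinner x x = complex_of_real ((norm x)\<^sup>2)"

lemma scaleC_zero_right [simp]: "c *\<^sub>C (0 :: 'a::complex_vector) = 0"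
  using scaleC_add_right[of c "0::'a" 0] by simp

lemma scaleC_minus_right: "c *\<^sub>C (- x) = - (c *\<^sub>C (x :: 'a::complex_vector))"
  using scaleC_add_right[of c x "- x"] by (simp add: eq_neg_iff_add_eq_0 add.commute)

lemma scaleC_sum_right:
  "c *\<^sub>C (\<Sum>i\<in>S. f i) = (\<Sum>i\<in>S. c *\<^sub>C (f i :: 'a::complex_vector))"
  by (induction S rule: infinite_finite_induct) (simp_all add: scaleC_add_right)

lemma norm_scaleC: "norm (c *\<^sub>C (x :: 'a::chilbert_space)) = cmod c * norm x"
proof -
  have "cinner (c *\<^sub>C x) (c *\<^sub>C x) = c * cnj c * cinner x x"
    by (metis cinner_commute cinner_scaleC_right complex_cnj_mult mult.assoc)
  then have "complex_of_real ((norm (c *\<^sub>C x))\<^sup>2) = complex_of_real ((cmod c * norm x)\<^sup>2)"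
    by (simp only: cinner_self complex_norm_square[symmetric] of_real_mult[symmetric]
        power_mult_distrib)
  then have "(norm (c *\<^sub>C x))\<^sup>2 = (cmod c * norm x)\<^sup>2"
    using of_real_eq_iff by blast
  then show ?thesis
    by (rule power2_eq_imp_eq) simp_all
qed

lemma bounded_linear_scaleC: "bounded_linear (\<lambda>x :: 'a::chilbert_space. c *\<^sub>C x)"
proof (rule bounded_linear_intro[where K = "cmod c"])
  fix r and x :: 'a
  show "c *\<^sub>C (r *\<^sub>R x) = r *\<^sub>R (c *\<^sub>C x)"
    by (simp add: scaleR_scaleC scaleC_scaleC mult.commute)
qed (simp_all add: scaleC_add_right norm_scaleC mult.commute)

instantiation complex :: complex_algebra_1
begin

definition scaleC_complex :: "complex \<Rightarrow> complex \<Rightarrow> complex"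
  where "scaleC_complex = (*)"

instance
  by standard (simp_all add: scaleC_complex_def algebra_simps)

end


section \<open>Bounded operators\<close>

typedef (overloaded) 'h cop =
  "{f :: 'h::chilbert_space \<Rightarrow> 'h. bounded_linear f \<and> (\<forall>c x. f (c *\<^sub>C x) = c *\<^sub>C f x)}"
  morphisms cop_apply Cop
  by (rule exI[of _ "\<lambda>_. 0"]) simp

setup_lifting type_definition_cop

instantiation cop :: (chilbert_space) complex_algebra_1
begin

lift_definition zero_cop :: "'a cop" is "\<lambda>_. 0"
  by simp

lift_definition one_cop :: "'a cop" is "\<lambda>x. x"
  by simp

lift_definition plus_cop :: "'a cop \<Rightarrow> 'a cop \<Rightarrow> 'a cop" is "\<lambda>f g x. f x + g x"
  by (simp add: bounded_linear_add scaleC_add_right)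

lift_definition uminus_cop :: "'a cop \<Rightarrow> 'a cop" is "\<lambda>f x. - f x"
  by (simp add: bounded_linear_minus scaleC_minus_right)

lift_definition minus_cop :: "'a cop \<Rightarrow> 'a cop \<Rightarrow> 'a cop" is "\<lambda>f g x. f x - g x"
  by (simp only: mem_Collect_eq diff_conv_add_uminus scaleC_add_right scaleC_minus_right)
    (simp add: bounded_linear_sub)

lift_definition times_cop :: "'a cop \<Rightarrow> 'a cop \<Rightarrow> 'a cop" is "\<lambda>f g x. f (g x)"
  by (simp add: bounded_linear_compose)

lift_definition scaleC_cop :: "complex \<Rightarrow> 'a cop \<Rightarrow> 'a cop" is "\<lambda>c f x. c *\<^sub>C f x"
  by (auto simp: scaleC_scaleC mult.commute
      intro: bounded_linear_compose[OF bounded_linear_scaleC])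

instance
  by standard
    (transfer; auto simp: fun_eq_iff scaleC_add_right scaleC_add_left scaleC_scaleC scaleC_one
      linear_add[OF bounded_linear.linear])+

end

text \<open>The adjoint exists and is unique by the Riesz representation theorem.\<close>

definition adj :: "'h::chilbert_space cop \<Rightarrow> 'h cop"
  where "adj a = (THE b. \<forall>\<eta> \<zeta>. cinner (cop_apply b \<eta>) \<zeta> = cinner \<eta> (cop_apply a \<zeta>))"

definition selfadjoint :: "'h::chilbert_space cop \<Rightarrow> bool"
  where "selfadjoint a \<longleftrightarrow> adj a = a"

definition cop_le :: "'h::chilbert_space cop \<Rightarrow> 'h cop \<Rightarrow> bool"
  where "cop_le a b \<longleftrightarrow> (\<forall>\<eta>. cinner \<eta> (cop_apply (b - a) \<eta>) \<in> \<real>\<^sub>\<ge>\<^sub>0)"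

definition wot :: "'h::chilbert_space cop topology"
  where "wot = topology_generated_by
    {{a. cinner \<eta> (cop_apply a \<zeta>) \<in> U} | \<eta> \<zeta> U. open U}"


section \<open>Von Neumann algebras and probability spaces\<close>

text \<open>Subalgebras need not contain the unit.\<close>

definition subalgebra :: "'a::complex_algebra_1 set \<Rightarrow> bool"
  where "subalgebra B \<longleftrightarrow> 0 \<in> B \<and> (\<forall>a\<in>B. \<forall>b\<in>B. a + b \<in> B \<and> a * b \<in> B)
    \<and> (\<forall>c. \<forall>a\<in>B. c *\<^sub>C a \<in> B)"

definition von_neumann_algebra :: "'h::chilbert_space cop set \<Rightarrow> bool"
  where "von_neumann_algebra A \<longleftrightarrow>
    subalgebra A \<and> 1 \<in> A \<and> (\<forall>a\<in>A. adj a \<in> A) \<and> closedin wot A"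

definition linear_on :: "'a::complex_vector set \<Rightarrow> ('a \<Rightarrow> 'b::complex_vector) \<Rightarrow> bool"
  where "linear_on A f \<longleftrightarrow> (\<forall>a\<in>A. \<forall>b\<in>A. f (a + b) = f a + f b)
    \<and> (\<forall>c. \<forall>a\<in>A. f (c *\<^sub>C a) = c *\<^sub>C f a)"

definition state_on :: "'h::chilbert_space cop set \<Rightarrow> ('h cop \<Rightarrow> complex) \<Rightarrow> bool"
  where "state_on A \<phi> \<longleftrightarrow> linear_on A \<phi> \<and> (\<forall>a\<in>A. \<phi> (adj a * a) \<in> \<real>\<^sub>\<ge>\<^sub>0) \<and> \<phi> 1 = 1"

text \<open>
  Normality: \<open>\<phi>\<close> preserves suprema of upward directed families of selfadjoint elements.
  Here \<open>s\<close> is the least upper bound of \<open>D\<close> in the selfadjoint part of \<open>A\<close>.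
\<close>

definition normal_on :: "'h::chilbert_space cop set \<Rightarrow> ('h cop \<Rightarrow> complex) \<Rightarrow> bool"
  where "normal_on A \<phi> \<longleftrightarrow> (\<forall>D s.
    D \<noteq> {} \<and> D \<subseteq> {a \<in> A. selfadjoint a} \<and> s \<in> A \<and> selfadjoint s
    \<and> (\<forall>a\<in>D. \<forall>b\<in>D. \<exists>c\<in>D. cop_le a c \<and> cop_le b c)
    \<and> (\<forall>a\<in>D. cop_le a s)
    \<and> (\<forall>t\<in>A. selfadjoint t \<longrightarrow> (\<forall>a\<in>D. cop_le a t) \<longrightarrow> cop_le s t)
    \<longrightarrow> Re (\<phi> s) = (SUP a\<in>D. Re (\<phi> a)))"

definition nondegenerated_wstar_probability_space ::
    "'h::chilbert_space cop set \<Rightarrow> ('h cop \<Rightarrow> complex) \<Rightarrow> bool"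
  where "nondegenerated_wstar_probability_space A \<phi> \<longleftrightarrow>
    von_neumann_algebra A \<and> state_on A \<phi> \<and> normal_on A \<phi>
    \<and> (\<forall>x\<in>A. (\<forall>a\<in>A. \<forall>b\<in>A. \<phi> (a * x * b) = 0) \<longrightarrow> x = 0)"

text \<open>
  The algebra \<open>A\<close> is identified with its image under the GNS representation of \<open>\<phi>\<close>:
  the ambient Hilbert space is the GNS space, with cyclic vector \<open>\<Omega>\<close>. In particular
  \<^const>\<open>wot\<close> is then the weak operator topology of the GNS representation.
\<close>

definition acts_on_gns_space ::
    "'h::chilbert_space cop set \<Rightarrow> ('h cop \<Rightarrow> complex) \<Rightarrow> 'h \<Rightarrow> bool"
  where "acts_on_gns_space A \<phi> \<Omega> \<longleftrightarrow>
    (\<forall>a\<in>A. \<phi> a = cinner \<Omega> (cop_apply a \<Omega>))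
    \<and> closure ((\<lambda>a. cop_apply a \<Omega>) ` A) = UNIV"


section \<open>Noncommutative polynomials\<close>

text \<open>
  The free monoid is written additively because the product of \<^typ>\<open>'a \<Rightarrow>\<^sub>0 'b\<close> is
  convolution over an additive monoid.
\<close>

datatype 'x free_monoid = Word (letters: "'x list")

instantiation free_monoid :: (type) monoid_add
begin

definition zero_free_monoid :: "'a free_monoid"
  where "0 = Word []"

definition plus_free_monoid :: "'a free_monoid \<Rightarrow> 'a free_monoid \<Rightarrow> 'a free_monoid"
  where "v + w = Word (letters v @ letters w)"

instance
  by standard (simp_all add: zero_free_monoid_def plus_free_monoid_def)

end

instantiation poly_mapping :: (type, complex_vector) complex_vector
begin

lift_definition scaleC_poly_mapping :: "complex \<Rightarrow> ('a \<Rightarrow>\<^sub>0 'b) \<Rightarrow> ('a \<Rightarrow>\<^sub>0 'b)"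
  is "\<lambda>c f x. c *\<^sub>C f x"
  by (erule rev_finite_subset) auto

instance
  by standard (transfer; simp add: fun_eq_iff scaleC_add_right scaleC_add_left
      scaleC_scaleC scaleC_one)+

end

lemma scaleC_Sum_any:
  fixes f :: "'b \<Rightarrow> 'a::complex_vector"
  assumes "finite {a. f a \<noteq> 0}"
  shows "Sum_any (\<lambda>a. c *\<^sub>C f a) = c *\<^sub>C Sum_any f"
proof -
  have "Sum_any (\<lambda>a. c *\<^sub>C f a) = (\<Sum>a | f a \<noteq> 0. c *\<^sub>C f a)"
    by (rule Sum_any.expand_superset[OF assms]) auto
  then show ?thesis
    by (simp add: Sum_any.expand_set scaleC_sum_right)
qed

instance poly_mapping :: (monoid_add, "{complex_algebra_1, ring_1}") complex_algebra_1
proof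
  fix c and p q :: "'a \<Rightarrow>\<^sub>0 'b"
  show "(c *\<^sub>C p) * q = c *\<^sub>C (p * q)"
  proof transfer
    fix c and f g :: "'a \<Rightarrow> 'b"
    assume "finite {x. f x \<noteq> 0}"
    then have "finite {l. f l * (\<Sum>q. g q when k = l + q) \<noteq> 0}" for k
      by (rule rev_finite_subset) auto
    then show "prod_fun (\<lambda>x. c *\<^sub>C f x) g = (\<lambda>x. c *\<^sub>C prod_fun f g x)"
      by (simp add: prod_fun_def fun_eq_iff mult_scaleC_left scaleC_Sum_any)
  qed
  show "p * (c *\<^sub>C q) = c *\<^sub>C (p * q)"
  proof transfer
    fix c and f g :: "'a \<Rightarrow> 'b"
    assume f: "finite {x. f x \<noteq> 0}" and g: "finite {x. g x \<noteq> 0}"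
    have "finite {q. (g q when k = l + q) \<noteq> 0}" for k l
      by (rule rev_finite_subset[OF g]) (auto simp: when_def)
    then have "(\<Sum>q. c *\<^sub>C g q when k = l + q) = c *\<^sub>C (\<Sum>q. g q when k = l + q)" for k l
      by (subst scaleC_Sum_any[symmetric]) (auto simp: when_def intro!: Sum_any.cong)
    moreover have "finite {l. f l * (\<Sum>q. g q when k = l + q) \<noteq> 0}" for k
      by (rule rev_finite_subset[OF f]) auto
    ultimately show "prod_fun f (\<lambda>x. c *\<^sub>C g x) = (\<lambda>x. c *\<^sub>C prod_fun f g x)"
      by (simp add: prod_fun_def fun_eq_iff mult_scaleC_right scaleC_Sum_any)
  qed
qed

text \<open>
  A polynomial with coefficients in \<open>'b\<close> in variables \<open>X\<^sub>i\<close>, \<open>i\<close> of type \<open>'x\<close>; the variables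
  commute with the coefficients, so the type below is the algebraic tensor product of
  the complex noncommutative polynomials with \<open>'b\<close>, and \<^term>\<open>Poly_Mapping.single w b\<close> is
  the elementary tensor of the word \<open>w\<close> with \<open>b\<close>.
\<close>

type_synonym ('x, 'b) ncpoly = "'x free_monoid \<Rightarrow>\<^sub>0 'b"

definition nc_polys :: "nat \<Rightarrow> (nat, complex) ncpoly set"
  where "nc_polys k = {p. \<forall>w\<in>Poly_Mapping.keys p. set (letters w) \<subseteq> {1..k}}"

definition nc_eval :: "('x \<Rightarrow> 'b::complex_algebra_1) \<Rightarrow> ('x, complex) ncpoly \<Rightarrow> 'b"
  where "nc_eval f p =
    (\<Sum>w\<in>Poly_Mapping.keys p. Poly_Mapping.lookup p w *\<^sub>C prod_list (map f (letters w)))"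

definition joint_distribution ::
    "('a::complex_algebra_1 \<Rightarrow> complex) \<Rightarrow> ('x \<Rightarrow> 'a) \<Rightarrow> ('x, complex) ncpoly \<Rightarrow> complex"
  where "joint_distribution \<phi> x p = \<phi> (nc_eval x p)"

text \<open>The slice map \<open>\<mu> \<otimes> id\<close>.\<close>

definition slice_map :: "(('x, complex) ncpoly \<Rightarrow> complex) \<Rightarrow> ('x, 'b::complex_algebra_1) ncpoly \<Rightarrow> 'b"
  where "slice_map \<mu> q =
    (\<Sum>w\<in>Poly_Mapping.keys q. \<mu> (Poly_Mapping.single w 1) *\<^sub>C Poly_Mapping.lookup q w)"


section \<open>Universal unital C*-algebras given by generators and relations\<close>

text \<open>
  The free unital *-algebra on the generators \<open>'g\<close>: the letter \<open>(g, False)\<close> stands for the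
  generator \<open>g\<close> and \<open>(g, True)\<close> for its formal adjoint.
\<close>

type_synonym 'g free_star_algebra = "('g \<times> bool, complex) ncpoly"

definition free_gen :: "'g \<Rightarrow> 'g free_star_algebra"
  where "free_gen g = Poly_Mapping.single (Word [(g, False)]) 1"

definition free_star :: "'g free_star_algebra \<Rightarrow> 'g free_star_algebra"
  where "free_star p = (\<Sum>w\<in>Poly_Mapping.keys p.
    Poly_Mapping.single (Word (rev (map (\<lambda>(g, b). (g, \<not> b)) (letters w))))
      (cnj (Poly_Mapping.lookup p w)))"

definition cstar_seminorm :: "('g free_star_algebra \<Rightarrow> real) \<Rightarrow> bool"
  where "cstar_seminorm s \<longleftrightarrow>
    (\<forall>p q. s (p + q) \<le> s p + s q) \<and> (\<forall>c p. s (c *\<^sub>C p) = cmod c * s p)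
    \<and> (\<forall>p q. s (p * q) \<le> s p * s q) \<and> (\<forall>p. s (free_star p * p) = (s p)\<^sup>2)"

text \<open>
  For a set \<open>R\<close> of relators (elements required to vanish) that bounds the generators, the
  universal unital C*-algebra is the Hausdorff completion of the free unital *-algebra with
  respect to the largest C*-seminorm vanishing on \<open>R\<close>.
\<close>

definition universal_norm :: "'g free_star_algebra set \<Rightarrow> 'g free_star_algebra \<Rightarrow> real"
  where "universal_norm R p = (SUP s\<in>{s. cstar_seminorm s \<and> (\<forall>r\<in>R. s r = 0)}. s p)"

text \<open>
  Elements of the completion are equivalence classes of Cauchy sequences. The image of an
  element \<open>p\<close> of the free *-algebra is the class of the constant sequence \<open>p\<close>, that is, the
  set of all sequences converging to \<open>p\<close>.
\<close>

definition universal_class ::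
    "'g free_star_algebra set \<Rightarrow> 'g free_star_algebra \<Rightarrow> (nat \<Rightarrow> 'g free_star_algebra) set"
  where "universal_class R p = {q. (\<lambda>m. universal_norm R (q m - p)) \<longlonglongrightarrow> 0}"


section \<open>Monotone spreadability\<close>

abbreviation Mi_u :: "nat \<Rightarrow> nat \<Rightarrow> (nat \<times> nat) free_star_algebra"
  where "Mi_u i j \<equiv> free_gen (i, j)"

definition Mi_P :: "nat \<Rightarrow> nat \<Rightarrow> (nat \<times> nat) free_star_algebra"
  where "Mi_P n j = (\<Sum>i=1..n. Mi_u i j)"

text \<open>
  The type provides a generator \<open>Mi_u i j\<close> for all natural numbers \<open>i\<close>, \<open>j\<close>; those outside the
  index range of \<open>M\<^sub>i(n,k)\<close> are set to \<open>0\<close>.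
\<close>

definition Mi_relators :: "nat \<Rightarrow> nat \<Rightarrow> (nat \<times> nat) free_star_algebra set"
  where "Mi_relators n k =
      {Mi_u i j | i j. i \<notin> {1..n} \<or> j \<notin> {1..k}}
    \<union> {free_star (Mi_u i j) - Mi_u i j | i j. i \<in> {1..n} \<and> j \<in> {1..k}}
    \<union> {Mi_u i j * Mi_u i j - Mi_u i j | i j. i \<in> {1..n} \<and> j \<in> {1..k}}
    \<union> {Mi_P n j * Mi_u i' j' - Mi_u i' j' | j i' j'.
        j \<in> {1..k} \<and> i' \<in> {1..n} \<and> j' \<in> {1..k} \<and> j' \<le> j}
    \<union> {Mi_P n j * Mi_P n 1 - Mi_P n 1 | j. j \<in> {1..k}}
    \<union> {Mi_u i j * Mi_u i' j' | i j i' j'.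
        i \<in> {1..n} \<and> j \<in> {1..k} \<and> i' \<in> {1..n} \<and> j' \<in> {1..k} \<and> j < j' \<and> i' \<le> i}"

abbreviation Mi_class :: "nat \<Rightarrow> nat \<Rightarrow> (nat \<times> nat) free_star_algebra
    \<Rightarrow> (nat \<Rightarrow> (nat \<times> nat) free_star_algebra) set"
  where "Mi_class n k \<equiv> universal_class (Mi_relators n k)"

text \<open>
  The homomorphism \<open>\<alpha>\<close> from \<open>\<complex>\<langle>X\<^sub>1, \<dots>, X\<^sub>k\<rangle>\<close>, lifted to coefficients in the free *-algebra; it is composed
  with the quotient map in the invariance condition below. It does not depend on \<open>k\<close> except
  through the domain \<^term>\<open>nc_polys k\<close>.
\<close>

definition Mi_\<alpha> :: "nat \<Rightarrow> (nat, complex) ncpoly \<Rightarrow> (nat, (nat \<times> nat) free_star_algebra) ncpoly"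
  where "Mi_\<alpha> n = nc_eval (\<lambda>j. \<Sum>i=1..n. Poly_Mapping.single (Word [i]) (Mi_u i j))"

text \<open>
  Finite sequences are functions on the natural numbers considered on \<open>{1..n}\<close>. Since the
  words of a polynomial in \<^term>\<open>nc_polys k\<close> have letters in \<open>{1..k}\<close>, \<open>joint_distribution \<phi> x\<close>
  is the joint distribution of the first \<open>k\<close> members on the left, and that of the first \<open>n\<close>
  members on the right, of the equation.
\<close>

definition Mi_invariant ::
    "('a::complex_algebra_1 \<Rightarrow> complex) \<Rightarrow> (nat \<Rightarrow> 'a) \<Rightarrow> nat \<Rightarrow> nat \<Rightarrow> bool"
  where "Mi_invariant \<phi> x n k \<longleftrightarrow> (\<forall>p\<in>nc_polys k.
    Mi_class n k (joint_distribution \<phi> x p *\<^sub>C Mi_P n 1) =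
    Mi_class n k (Mi_P n 1 * slice_map (joint_distribution \<phi> x) (Mi_\<alpha> n p) * Mi_P n 1))"

definition monotonically_spreadable_fin ::
    "('a::complex_algebra_1 \<Rightarrow> complex) \<Rightarrow> (nat \<Rightarrow> 'a) \<Rightarrow> nat \<Rightarrow> bool"
  where "monotonically_spreadable_fin \<phi> x n \<longleftrightarrow> (\<forall>k\<in>{1..<n}. Mi_invariant \<phi> x n k)"

definition monotonically_spreadable ::
    "('a::complex_algebra_1 \<Rightarrow> complex) \<Rightarrow> ('i::linorder \<Rightarrow> 'a) \<Rightarrow> 'i set \<Rightarrow> bool"
  where "monotonically_spreadable \<phi> x I \<longleftrightarrow>
    (\<forall>l (s :: nat \<Rightarrow> 'i). strict_mono_on {1..l} s \<and> s ` {1..l} \<subseteq> I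
      \<longrightarrow> monotonically_spreadable_fin \<phi> (x \<circ> s) l)"


section \<open>Conditional expectations and monotone independence\<close>

definition conditional_expectation ::
    "'a::complex_algebra_1 set \<Rightarrow> 'a set \<Rightarrow> ('a \<Rightarrow> 'a) \<Rightarrow> bool"
  where "conditional_expectation C B E \<longleftrightarrow>
    subalgebra C \<and> subalgebra B \<and> B \<subseteq> C \<and> linear_on C E \<and> E ` C = B
    \<and> (\<forall>a\<in>C. \<forall>b1\<in>B. \<forall>b2\<in>B. E (b1 * a * b2) = b1 * E a * b2)
    \<and> (\<forall>b\<in>B. E b = b)"

text \<open>
  A monomial \<open>b\<^sub>0 X b\<^sub>1 X \<dots> X b\<^sub>n\<close> is represented by the list of its coefficients, and an
  element of \<open>B\<langle>X\<rangle>\<^sub>0\<close> by a formal linear combination of such lists of length at least two.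
\<close>

definition bpolys0 :: "'a::complex_algebra_1 set \<Rightarrow> ('a list \<Rightarrow>\<^sub>0 complex) set"
  where "bpolys0 B = {p. \<forall>bs\<in>Poly_Mapping.keys p.
    length bs \<ge> 2 \<and> set bs \<subseteq> B \<union> {c *\<^sub>C 1 | c. True}}"

fun bmono_eval :: "'a::complex_algebra_1 \<Rightarrow> 'a list \<Rightarrow> 'a"
  where
    "bmono_eval x [] = 1"
  | "bmono_eval x [b] = b"
  | "bmono_eval x (b # b' # bs) = b * x * bmono_eval x (b' # bs)"

definition bpoly_eval :: "('a list \<Rightarrow>\<^sub>0 complex) \<Rightarrow> 'a::complex_algebra_1 \<Rightarrow> 'a"
  where "bpoly_eval p x =
    (\<Sum>bs\<in>Poly_Mapping.keys p. Poly_Mapping.lookup p bs *\<^sub>C bmono_eval x bs)"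

definition identically_distributed ::
    "'a::complex_algebra_1 set \<Rightarrow> ('a \<Rightarrow> 'a) \<Rightarrow> 'i set \<Rightarrow> ('i \<Rightarrow> 'a) \<Rightarrow> bool"
  where "identically_distributed B E I x \<longleftrightarrow>
    (\<forall>i\<in>I. \<forall>j\<in>I. \<forall>p\<in>bpolys0 B. E (bpoly_eval p (x i)) = E (bpoly_eval p (x j)))"

definition monotonically_independent ::
    "'a::complex_algebra_1 set \<Rightarrow> ('a \<Rightarrow> 'a) \<Rightarrow> 'i::linorder set \<Rightarrow> ('i \<Rightarrow> 'a) \<Rightarrow> bool"
  where "monotonically_independent B E I x \<longleftrightarrow>
    (\<forall>ps js k. set ps \<subseteq> bpolys0 B \<and> set js \<subseteq> I \<and> length ps = length js \<and> distinct_adj js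
      \<and> k < length js
      \<and> (0 < k \<longrightarrow> js ! (k - 1) < js ! k)
      \<and> (Suc k < length js \<longrightarrow> js ! Suc k < js ! k)
      \<longrightarrow> (let ys = map2 (\<lambda>p j. bpoly_eval p (x j)) ps js in
        E (prod_list ys) = E (prod_list (take k ys) * E (ys ! k) * prod_list (drop (Suc k) ys))))"


section \<open>Future algebras and the tail algebra\<close>

definition future_algebra :: "(int \<Rightarrow> 'h::chilbert_space cop) \<Rightarrow> int \<Rightarrow> 'h cop set"
  where "future_algebra x k = wot closure_of (subalgebra hull (x ` {k..}))"

definition tail_algebra :: "(int \<Rightarrow> 'h::chilbert_space cop) \<Rightarrow> 'h cop set"
  where "tail_algebra x = (\<Inter>k\<in>{0<..}. future_algebra x k)"

end

theory Submission
  imports Defs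
begin

text \<open>
  Spreadability makes the bilateral shift of the words \<open>x\<^sub>w \<Omega>\<close> a unitary; its conjugation \<open>\<alpha>\<close> satisfies
  \<open>\<alpha> x\<^sub>i = x\<^sub>i\<^sub>+\<^sub>1\<close> and fixes the tail algebra, and \<open>E a\<close> is the weak limit of \<open>\<alpha>\<^sup>n a\<close>. One further
  representation of \<open>M\<^sub>i(n,k)\<close>, by two-by-two matrices, gives
  \<open>4 F(m,m) = F(m,m) + F(m,m+1) + F(m+1,m) + F(m+1,m+1)\<close> for moments
  \<open>F(a,b) = \<phi>(c\<^sub>1 p(x\<^sub>a) x\<^sub>i\<^sup>2 q(x\<^sub>b) c\<^sub>2)\<close> whose other letters are below \<open>m\<close>. The two mixed terms have both
  factors replaced by their expectations, and \<open>F(m+1,m+1) = F(m,m)\<close>, hence so does \<open>F(m,m)\<close>. Therefore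
  \<open>x\<^sub>i (p(x\<^sub>m) - E p(x\<^sub>m))\<close> annihilates the vectors generated by the letters below \<open>m\<close>, which improves to
  the operator identity \<open>x\<^sub>i (p(x\<^sub>m) - E p(x\<^sub>m)) x\<^sub>j = 0\<close> for \<open>i, j < m\<close>, that is, monotone independence.

  Conversely, in \<open>M\<^sub>i(n,k)\<close> the projections of one column are orthogonal and products of neighbouring
  columns with decreasing row index vanish. So in the sum over row indices a run of the largest column
  index is always a peak of the moment; by independence it collapses to a tail coefficient, the
  remaining sum of projections is absorbed, and induction on the length of the word applies.
\<close>

section \<open>Hilbert space geometry\<close>

text \<open>A shift moves all blocks of a letter at once, so it averages a block of
  \<open>x_m\<close> only when everything around it consists of lower letters and tail elements.
  That \<open>x_i (p(x_m) - E p(x_m))\<close> kills a vector is tested by the squared norm, and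
  there two blocks of the same letter occur, with the square of \<open>x_i\<close> between them. The
  two-by-two matrices serve to separate them: the lower letter in the middle carries a rank one
  projection with all entries \<open>1/2\<close>, so the blocks on its two sides choose between
  \<open>m\<close> and \<open>m + 1\<close> independently, and the four choices are the four
  moments. This controls only vectors made of lower letters. A further lower letter
  \<open>x_j\<close> on the right admits all vectors, because the annihilation itself allows the
  higher letters to be removed from the top downwards without changing the image under
  \<open>x_j\<close>. In the opposite direction, orthogonality of the projections in one column is
  not among the defining relations. Positivity would give it at once, but only the norm axioms of a
  C*-seminorm are at hand; the fact that the unit of a corner is an extreme point of the unit ball
  takes its place.\<close>

lemma scaleC_zero_left [simp]: "0 *\<^sub>C (x :: 'a::complex_vector) = 0"
  using scaleC_add_left[of 0 0 x] by simp

lemma scaleC_minus_left: "(- c) *\<^sub>C (x :: 'a::complex_vector) = - (c *\<^sub>C x)"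
  using scaleC_add_left[of c "- c" x] by (simp add: eq_neg_iff_add_eq_0 add.commute)

lemma scaleC_minus1 [simp]: "(- 1) *\<^sub>C (x :: 'a::complex_vector) = - x"
  by (simp add: scaleC_minus_left scaleC_one)

lemma scaleC_diff_right: "c *\<^sub>C (x - y :: 'a::complex_vector) = c *\<^sub>C x - c *\<^sub>C y"
  by (simp only: diff_conv_add_uminus scaleC_add_right scaleC_minus_right)

lemma cinner_zero_right [simp]: "cinner x (0 :: 'a::chilbert_space) = 0"
  using cinner_add_right[of x 0 0] by simp

lemma cinner_minus_right: "cinner x (- y :: 'a::chilbert_space) = - cinner x y"
  using cinner_scaleC_right[of x "- 1" y] by simp

lemma cinner_diff_right: "cinner x (y - z :: 'a::chilbert_space) = cinner x y - cinner x z"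
  by (simp only: diff_conv_add_uminus cinner_add_right cinner_minus_right)

lemma cinner_add_left: "cinner (x + y :: 'a::chilbert_space) z = cinner x z + cinner y z"
  by (metis cinner_commute cinner_add_right complex_cnj_add)

lemma cinner_scaleC_left: "cinner (c *\<^sub>C x :: 'a::chilbert_space) y = cnj c * cinner x y"
  by (metis cinner_commute cinner_scaleC_right complex_cnj_mult)

lemma cinner_zero_left [simp]: "cinner (0 :: 'a::chilbert_space) x = 0"
  by (metis cinner_commute cinner_zero_right complex_cnj_zero)

lemma cinner_minus_left: "cinner (- x :: 'a::chilbert_space) y = - cinner x y"
  using cinner_scaleC_left[of "- 1" x y] by simp

lemma cinner_diff_left: "cinner (x - y :: 'a::chilbert_space) z = cinner x z - cinner y z"
  by (simp only: diff_conv_add_uminus cinner_add_left cinner_minus_left)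

lemmas cinner_simps = cinner_add_left cinner_add_right cinner_diff_left cinner_diff_right
  cinner_scaleC_left cinner_scaleC_right cinner_minus_left cinner_minus_right

lemma cinner_eq_zero_iff [simp]: "cinner x x = 0 \<longleftrightarrow> x = (0 :: 'a::chilbert_space)"
  by (simp add: cinner_self)

lemma norm_squared_cinner: "(norm (x :: 'a::chilbert_space))\<^sup>2 = Re (cinner x x)"
  by (simp add: cinner_self)

lemma cinner_cauchy_schwarz: "cmod (cinner x (y :: 'a::chilbert_space)) \<le> norm x * norm y"
proof (cases "y = 0")
  case False
  define t where "t = cinner y x / (norm y)\<^sup>2"
  have eq: "cinner y y = (norm y)\<^sup>2" by (simp add: cinner_self)
  have yy: "cinner y y \<noteq> 0" using False by simp
  have "cinner (x - t *\<^sub>C y) (x - t *\<^sub>C y) =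
      cinner x x - t * cinner x y - cnj t * (cinner y x - t * cinner y y)"
    by (simp add: cinner_simps algebra_simps)
  also have "t * cinner y y = cinner y x"
    using False by (simp add: t_def cinner_self)
  finally have "cinner (x - t *\<^sub>C y) (x - t *\<^sub>C y) = cinner x x - t * cinner x y" by simp
  also have "t * cinner x y = (cmod (cinner x y))\<^sup>2 / (norm y)\<^sup>2"
    using complex_norm_square[of "cinner x y"] cinner_commute[of y x]
    by (simp add: t_def mult.commute)
  finally have "complex_of_real ((norm (x - t *\<^sub>C y))\<^sup>2) =
      complex_of_real ((norm x)\<^sup>2 - (cmod (cinner x y))\<^sup>2 / (norm y)\<^sup>2)"
    by (simp add: cinner_self)
  then have "(norm (x - t *\<^sub>C y))\<^sup>2 = (norm x)\<^sup>2 - (cmod (cinner x y))\<^sup>2 / (norm y)\<^sup>2"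
    by (simp only: of_real_eq_iff)
  then have "(cmod (cinner x y))\<^sup>2 / (norm y)\<^sup>2 \<le> (norm x)\<^sup>2"
    using zero_le_power2[of "norm (x - t *\<^sub>C y)"] by linarith
  then have "(cmod (cinner x y))\<^sup>2 \<le> (norm x * norm y)\<^sup>2"
    using False by (simp add: divide_simps power_mult_distrib)
  then show ?thesis by (rule power2_le_imp_le) simp
qed simp

lemma bounded_bilinear_cinner: "bounded_bilinear (cinner :: 'a::chilbert_space \<Rightarrow> _)"
proof
  show "\<exists>K. \<forall>a b :: 'a. cmod (cinner a b) \<le> norm a * norm b * K"
    by (rule exI[of _ 1]) (simp add: cinner_cauchy_schwarz)
qed (simp_all add: cinner_simps scaleR_scaleC scaleR_conv_of_real)

lemmas tendsto_cinner [tendsto_intros] = bounded_bilinear.tendsto[OF bounded_bilinear_cinner]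

lemma parallelogram:
  "(norm (x + y :: 'a::chilbert_space))\<^sup>2 + (norm (x - y))\<^sup>2 = 2 * (norm x)\<^sup>2 + 2 * (norm y)\<^sup>2"
  by (simp add: norm_squared_cinner cinner_simps)

lemma cinner_ext_right: "(\<And>z. cinner z x = cinner z y) \<Longrightarrow> x = (y :: 'a::chilbert_space)"
proof -
  assume "\<And>z. cinner z x = cinner z y"
  then have "cinner (x - y) (x - y) = 0" by (simp add: cinner_diff_right)
  then show "x = y" by simp
qed

section \<open>Complex subspaces, orthogonal projection and representation of functionals\<close>

definition csubspace :: "'a::complex_vector set \<Rightarrow> bool"
  where "csubspace S \<longleftrightarrow> 0 \<in> S \<and> (\<forall>x\<in>S. \<forall>y\<in>S. x + y \<in> S) \<and> (\<forall>c. \<forall>x\<in>S. c *\<^sub>C x \<in> S)"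

lemma csubspaceI:
  "0 \<in> S \<Longrightarrow> (\<And>x y. x \<in> S \<Longrightarrow> y \<in> S \<Longrightarrow> x + y \<in> S) \<Longrightarrow> (\<And>c x. x \<in> S \<Longrightarrow> c *\<^sub>C x \<in> S) \<Longrightarrow> csubspace S"
  by (auto simp: csubspace_def)

lemma csubspaceD:
  assumes "csubspace S"
  shows "0 \<in> S" "x \<in> S \<Longrightarrow> y \<in> S \<Longrightarrow> x + y \<in> S" "x \<in> S \<Longrightarrow> c *\<^sub>C x \<in> S"
    "x \<in> S \<Longrightarrow> y \<in> S \<Longrightarrow> x - y \<in> S"
proof -
  show "x \<in> S \<Longrightarrow> y \<in> S \<Longrightarrow> x - y \<in> S"
    using assms unfolding csubspace_def by (metis scaleC_minus1 diff_conv_add_uminus)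
qed (use assms in \<open>auto simp: csubspace_def\<close>)

lemma csubspace_sum: "csubspace S \<Longrightarrow> (\<And>i. i \<in> I \<Longrightarrow> f i \<in> S) \<Longrightarrow> sum f I \<in> S"
  by (induction I rule: infinite_finite_induct) (auto intro: csubspaceD)

lemma csubspace_hull: "csubspace (csubspace hull S)"
  by (rule hull_in) (auto simp: csubspace_def)

text \<open>A sequence in \<open>M\<close> minimising the distance to \<open>x\<close> is Cauchy:
  the midpoint of two members lies in \<open>M\<close> and cannot be nearer than the infimum, so the
  parallelogram identity bounds the distance of the two members. The limit is the projection of
  \<open>x\<close>.\<close>

lemma orthogonal_decomposition:
  fixes M :: "'a::chilbert_space set"
  assumes M: "csubspace M" and cl: "closed M"
  obtains m where "m \<in> M" "\<And>y. y \<in> M \<Longrightarrow> cinner y (x - m) = 0"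
proof -
  define d where "d = Inf ((\<lambda>m. (norm (x - m))\<^sup>2) ` M)"
  have bdd: "bdd_below ((\<lambda>m. (norm (x - m))\<^sup>2) ` M)"
    by (rule bdd_belowI[of _ 0]) auto
  have ne: "(\<lambda>m. (norm (x - m))\<^sup>2) ` M \<noteq> {}"
    using csubspaceD(1)[OF M] by auto
  have d_le: "d \<le> (norm (x - m))\<^sup>2" if "m \<in> M" for m
    unfolding d_def using bdd that by (intro cInf_lower) auto
  have "\<exists>m\<in>M. (norm (x - m))\<^sup>2 < d + inverse (real (Suc n))" for n
    using cInf_lessD[OF ne, of "d + inverse (real (Suc n))"] unfolding d_def by auto
  then obtain m where mM: "\<And>n. m n \<in> M"
    and mlt: "\<And>n. (norm (x - m n))\<^sup>2 < d + inverse (real (Suc n))"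
    by metis
  have half: "(1/2) *\<^sub>R y \<in> M" if "y \<in> M" for y
    using that M by (simp add: scaleR_scaleC csubspaceD)
  have key: "(norm (m k - m l))\<^sup>2 \<le> 2 * inverse (real (Suc k)) + 2 * inverse (real (Suc l))" for k l
  proof -
    have "(norm ((x - m k) + (x - m l)))\<^sup>2 + (norm ((x - m k) - (x - m l)))\<^sup>2 =
        2 * (norm (x - m k))\<^sup>2 + 2 * (norm (x - m l))\<^sup>2"
      by (rule parallelogram)
    moreover have "(norm ((x - m k) + (x - m l)))\<^sup>2 = 4 * (norm (x - (1/2) *\<^sub>R (m k + m l)))\<^sup>2"
    proof -
      have "(x - m k) + (x - m l) = 2 *\<^sub>R (x - (1/2) *\<^sub>R (m k + m l))"
        by (simp add: algebra_simps scaleR_2)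
      then show ?thesis by (simp add: power_mult_distrib)
    qed
    moreover have "d \<le> (norm (x - (1/2) *\<^sub>R (m k + m l)))\<^sup>2"
      by (intro d_le half csubspaceD[OF M] mM)
    moreover have "(x - m k) - (x - m l) = m l - m k" by simp
    ultimately show ?thesis
      using mlt[of k] mlt[of l] by (simp add: norm_minus_commute)
  qed
  have "Cauchy m"
  proof (rule metric_CauchyI)
    fix e :: real assume "e > 0"
    then obtain N where N: "inverse (real (Suc N)) < e\<^sup>2 / 4"
      using reals_Archimedean[of "e\<^sup>2 / 4"] by auto
    show "\<exists>M. \<forall>k\<ge>M. \<forall>l\<ge>M. dist (m k) (m l) < e"
    proof (intro exI[of _ N] allI impI)
      fix k l assume "N \<le> k" "N \<le> l"
      then have "inverse (real (Suc k)) \<le> inverse (real (Suc N))"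
        "inverse (real (Suc l)) \<le> inverse (real (Suc N))"
        by auto
      then have "(norm (m k - m l))\<^sup>2 < e\<^sup>2"
        using key[of k l] N by linarith
      then show "dist (m k) (m l) < e"
        using \<open>e > 0\<close> by (simp add: dist_norm power_less_imp_less_base)
    qed
  qed
  then obtain p where p: "m \<longlonglongrightarrow> p"
    using Cauchy_convergent convergent_def by blast
  have pM: "p \<in> M"
    using closed_sequentially[OF cl] mM p by blast
  have "(\<lambda>n. (norm (x - m n))\<^sup>2) \<longlonglongrightarrow> (norm (x - p))\<^sup>2"
    by (intro tendsto_intros p)
  moreover have "(\<lambda>n. d + inverse (real (Suc n))) \<longlonglongrightarrow> d + 0"
    by (intro tendsto_intros LIMSEQ_inverse_real_of_nat)
  ultimately have "(norm (x - p))\<^sup>2 \<le> d + 0"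
    by (rule LIMSEQ_le) (use mlt less_imp_le in blast)
  then have pmin: "(norm (x - p))\<^sup>2 \<le> (norm (x - q))\<^sup>2" if "q \<in> M" for q
    using d_le[OF that] by linarith
  have "cinner y (x - p) = 0" if y: "y \<in> M" for y
  proof (rule ccontr)
    assume ne: "cinner y (x - p) \<noteq> 0"
    then have y0: "y \<noteq> 0" by auto
    \<comment> \<open>The optimal step along \<open>y\<close>: it would lower the squared distance
      by the square of \<open>cmod (cinner y (x - p)) / norm y\<close>, against the minimality of
      \<open>p\<close>.\<close>
    define t where "t = cinner y (x - p) / (norm y)\<^sup>2"
    have "(norm (x - p))\<^sup>2 \<le> (norm (x - (p + t *\<^sub>C y)))\<^sup>2"
      by (intro pmin csubspaceD[OF M] pM y)
    also have "x - (p + t *\<^sub>C y) = (x - p) - t *\<^sub>C y" by simp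
    also have "(norm ((x - p) - t *\<^sub>C y))\<^sup>2 = Re (cinner (x - p) (x - p)
        - t * cinner (x - p) y - cnj t * (cinner y (x - p) - t * cinner y y))"
      unfolding norm_squared_cinner by (simp add: cinner_simps algebra_simps)
    also have "t * cinner y y = cinner y (x - p)"
      using y0 by (simp add: t_def cinner_self)
    finally have "Re (t * cinner (x - p) y) \<le> 0"
      by (simp add: norm_squared_cinner)
    moreover have "t * cinner (x - p) y = (cmod (cinner y (x - p)))\<^sup>2 / (norm y)\<^sup>2"
      using complex_norm_square[of "cinner y (x - p)"] cinner_commute[of "x - p" y]
      by (simp add: t_def)
    moreover have "(cmod (cinner y (x - p)))\<^sup>2 / (norm y)\<^sup>2 > 0"
      using ne y0 by simp
    ultimately show False
      by (metis Re_complex_of_real of_real_divide not_less)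
  qed
  with pM show ?thesis by (rule that)
qed

lemma closure_csubspace:
  fixes S :: "'a::chilbert_space set"
  assumes "csubspace S" shows "csubspace (closure S)"
proof (rule csubspaceI)
  show "0 \<in> closure S" using csubspaceD(1)[OF assms] closure_subset by blast
next
  fix x y assume "x \<in> closure S" "y \<in> closure S"
  then obtain f g where "\<And>n. f n \<in> S" "f \<longlonglongrightarrow> x" "\<And>n. g n \<in> S" "g \<longlonglongrightarrow> y"
    unfolding closure_sequential by blast
  then have "\<forall>n. f n + g n \<in> S" "(\<lambda>n. f n + g n) \<longlonglongrightarrow> x + y"
    using assms by (auto intro: csubspaceD tendsto_add)
  then show "x + y \<in> closure S"
    unfolding closure_sequential by (intro exI conjI)
next
  fix c x assume "x \<in> closure S"
  then obtain f where "\<And>n. f n \<in> S" "f \<longlonglongrightarrow> x"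
    unfolding closure_sequential by blast
  then have "\<forall>n. c *\<^sub>C f n \<in> S" "(\<lambda>n. c *\<^sub>C f n) \<longlonglongrightarrow> c *\<^sub>C x"
    using assms by (auto intro: csubspaceD bounded_linear.tendsto[OF bounded_linear_scaleC])
  then show "c *\<^sub>C x \<in> closure S"
    unfolding closure_sequential by (intro exI conjI)
qed

text \<open>Phrased by a trivial orthogonal complement rather than by a dense span, because this is
  what inner products with word vectors test directly. Density of the span then follows by
  projection.\<close>

definition total :: "'a::chilbert_space set \<Rightarrow> bool"
  where "total S \<longleftrightarrow> (\<forall>\<eta>. (\<forall>v\<in>S. cinner v \<eta> = 0) \<longrightarrow> \<eta> = 0)"

lemma total_mono: "total S \<Longrightarrow> S \<subseteq> T \<Longrightarrow> total T"
  unfolding total_def by blast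

lemma totalD: "total S \<Longrightarrow> (\<And>v. v \<in> S \<Longrightarrow> cinner v \<eta> = cinner v \<zeta>) \<Longrightarrow> \<eta> = \<zeta>"
  unfolding total_def using cinner_diff_right by (metis eq_iff_diff_eq_0)

lemma total_imp_dense:
  assumes "total S" shows "closure (csubspace hull S) = UNIV"
proof -
  let ?M = "closure (csubspace hull S)"
  have "x \<in> ?M" for x
  proof -
    obtain m where m: "m \<in> ?M" "\<And>y. y \<in> ?M \<Longrightarrow> cinner y (x - m) = 0"
      using orthogonal_decomposition[of ?M x] closure_csubspace[OF csubspace_hull] by auto
    have "cinner v (x - m) = 0" if "v \<in> S" for v
      using m(2) that hull_subset closure_subset by (metis subsetD)
    then have "x - m = 0" using assms unfolding total_def by blast
    with m(1) show ?thesis by simp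
  qed
  then show ?thesis by blast
qed

lemma riesz:
  fixes f :: "'a::chilbert_space \<Rightarrow> complex"
  assumes add: "\<And>x y. f (x + y) = f x + f y" and scale: "\<And>c x. f (c *\<^sub>C x) = c * f x"
    and bound: "\<And>x. cmod (f x) \<le> K * norm x"
  obtains t where "\<And>x. f x = cinner t x"
proof -
  have bl: "bounded_linear f"
    by (rule bounded_linear_intro[where K = K])
      (auto simp: add scaleR_scaleC scale scaleR_conv_of_real bound mult.commute)
  define M where "M = {x. f x = 0}"
  have f0: "f 0 = 0" using scale[of 0 0] by simp
  have M: "csubspace M"
    by (rule csubspaceI) (auto simp: M_def add scale f0)
  have clM: "closed M"
    unfolding M_def using bounded_linear.continuous_on[OF bl continuous_on_id]
    by (intro closed_Collect_eq) auto
  show ?thesis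
  proof (cases "\<exists>x. f x \<noteq> 0")
    case False
    then show ?thesis by (intro that[of 0]) auto
  next
    case True
    then obtain x where x: "f x \<noteq> 0" by blast
    obtain m where m: "m \<in> M" "\<And>y. y \<in> M \<Longrightarrow> cinner y (x - m) = 0"
      using orthogonal_decomposition[OF M clM] by blast
    define z where "z = x - m"
    have fx: "f x = f z + f m" using add[of z m] by (simp add: z_def)
    then have fz: "f z \<noteq> 0" using x m(1) by (simp add: M_def)
    then have z0: "z \<noteq> 0" using f0 by auto
    have "f y = cinner ((cnj (f z) / (norm z)\<^sup>2) *\<^sub>C z) y" for y
    proof -
      have "f (y + (- (f y / f z)) *\<^sub>C z) = 0"
        by (simp only: add scale) (use fz in simp)
      then have "cinner (y + (- (f y / f z)) *\<^sub>C z) z = 0"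
        using m(2) by (simp add: M_def z_def)
      then have "cinner z (y + (- (f y / f z)) *\<^sub>C z) = 0"
        by (metis cinner_commute complex_cnj_zero)
      then have "cinner z y = (f y / f z) * (norm z)\<^sup>2"
        by (simp add: cinner_simps cinner_self)
      then show ?thesis
        using fz z0 by (simp add: cinner_scaleC_left)
    qed
    then show ?thesis by (rule that)
  qed
qed

section \<open>Adjoints and limits of operators\<close>

lemma cop_apply_simps [simp]:
  "cop_apply 0 v = 0" "cop_apply 1 v = v" "cop_apply (a + b) v = cop_apply a v + cop_apply b v"
  "cop_apply (a - b) v = cop_apply a v - cop_apply b v" "cop_apply (- a) v = - cop_apply a v"
  "cop_apply (a * b) v = cop_apply a (cop_apply b v)"
  "cop_apply (c *\<^sub>C a) v = c *\<^sub>C cop_apply a v"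
  by (transfer, simp)+

lemma bounded_linear_cop_apply: "bounded_linear (cop_apply a)"
  using cop_apply[of a] by simp

lemma cop_apply_linear [simp]:
  "cop_apply a (v + w) = cop_apply a v + cop_apply a w"
  "cop_apply a (v - w) = cop_apply a v - cop_apply a w"
  "cop_apply a 0 = 0" "cop_apply a (c *\<^sub>C v) = c *\<^sub>C cop_apply a v"
  using cop_apply[of a] bounded_linear.linear[OF bounded_linear_cop_apply[of a]]
  by (auto simp: linear_add linear_diff linear_0)

lemma cop_bound: obtains K where "K \<ge> 0" "\<And>v. norm (cop_apply a v) \<le> K * norm v"
proof -
  obtain K where "0 \<le> K" "\<forall>v. norm (cop_apply a v) \<le> norm v * K"
    using bounded_linear.nonneg_bounded[OF bounded_linear_cop_apply[of a]] by blast
  then show ?thesis by (intro that[of K]) (auto simp: mult.commute)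
qed

lemma cop_eqI: "(\<And>v. cop_apply a v = cop_apply b v) \<Longrightarrow> a = b"
  by (metis cop_apply_inject ext)

lemma cop_eqI_total:
  assumes S: "total S" and eq: "\<And>v w. v \<in> S \<Longrightarrow> w \<in> S \<Longrightarrow> cinner v (cop_apply a w) = cinner v (cop_apply b w)"
  shows "a = b"
proof (rule cop_eqI)
  fix v
  have "closed {w. cop_apply a w = cop_apply b w}"
    by (intro closed_Collect_eq bounded_linear.continuous_on[OF bounded_linear_cop_apply] continuous_on_id)
  moreover have "S \<subseteq> {w. cop_apply a w = cop_apply b w}"
    using totalD[OF S] eq by blast
  then have "csubspace hull S \<subseteq> {w. cop_apply a w = cop_apply b w}"
    by (rule hull_minimal) (auto intro!: csubspaceI)
  ultimately have "closure (csubspace hull S) \<subseteq> {w. cop_apply a w = cop_apply b w}"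
    by (rule closure_minimal[rotated])
  then show "cop_apply a v = cop_apply b v"
    by (auto simp: total_imp_dense[OF S])
qed

text \<open>Riesz representation for each fixed second argument; the conjugate of the form is what
  is linear in the first argument. Both adjoints and weak limits of operators are obtained in this
  way.\<close>

lemma sesquilinear_form_operator:
  fixes L :: "'a::chilbert_space \<Rightarrow> 'a \<Rightarrow> complex"
  assumes add: "\<And>x y z. L (x + y) z = L x z + L y z" "\<And>x y z. L z (x + y) = L z x + L z y"
    and scale: "\<And>c x z. L (c *\<^sub>C x) z = cnj c * L x z" "\<And>c x z. L z (c *\<^sub>C x) = c * L z x"
    and bound: "\<And>x z. cmod (L x z) \<le> K * norm x * norm z"
  obtains T where "\<And>x z. L x z = cinner x (cop_apply T z)"
proof -
  have "\<exists>t. \<forall>x. cnj (L x z) = cinner t x" for z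
  proof -
    obtain t where "\<And>x. cnj (L x z) = cinner t x"
      by (rule riesz[of "\<lambda>x. cnj (L x z)" "K * norm z"])
        (use bound[of _ z] in \<open>auto simp: add scale mult_ac\<close>)
    then show ?thesis by blast
  qed
  then obtain t where t: "\<And>z x. cnj (L x z) = cinner (t z) x" by metis
  have t': "cinner x (t z) = L x z" for x z
    using t by (metis cinner_commute complex_cnj_cnj)
  have t_add: "t (z + w) = t z + t w" for z w
    by (rule cinner_ext_right) (simp add: t' add cinner_simps)
  have t_scale: "t (c *\<^sub>C z) = c *\<^sub>C t z" for c z
    by (rule cinner_ext_right) (simp add: t' scale cinner_simps)
  have t_bound: "norm (t z) \<le> norm z * \<bar>K\<bar>" for z
  proof (cases "t z = 0")
    case False
    have "(norm (t z))\<^sup>2 = cmod (L (t z) z)"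
      by (simp add: t'[symmetric] cinner_self norm_power)
    also have "\<dots> \<le> K * norm (t z) * norm z" by (rule bound)
    also have "\<dots> \<le> \<bar>K\<bar> * norm (t z) * norm z" by (intro mult_right_mono) auto
    finally show ?thesis using False by (simp add: power2_eq_square mult_ac)
  qed simp
  have "bounded_linear t"
    by (rule bounded_linear_intro[where K = "\<bar>K\<bar>"])
      (simp_all add: t_add t_scale scaleR_scaleC t_bound)
  then have "cop_apply (Cop t) = t"
    by (intro Cop_inverse) (simp add: t_scale)
  then show ?thesis by (intro that[of "Cop t"]) (simp add: t')
qed

text \<open>Resolves the definite description in \<open>adj\<close>: existence comes from the
  bounded form with values \<open>cinner (cop_apply a x) z\<close>, uniqueness from the fact that an
  operator is determined by its coefficients.\<close>

lemma cinner_adj [simp]: "cinner (cop_apply (adj a) \<eta>) \<zeta> = cinner \<eta> (cop_apply a \<zeta>)"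
proof -
  obtain K where K: "K \<ge> 0" "\<And>v. norm (cop_apply a v) \<le> K * norm v"
    using cop_bound[of a] by blast
  have bnd: "cmod (cinner (cop_apply a x) z) \<le> K * norm x * norm z" for x z
    by (rule order_trans[OF cinner_cauchy_schwarz]) (simp add: K mult_right_mono)
  obtain b where b: "\<And>x z. cinner (cop_apply a x) z = cinner x (cop_apply b z)"
    by (rule sesquilinear_form_operator[of "\<lambda>x z. cinner (cop_apply a x) z" K])
      (auto simp: cinner_simps bnd)
  have b': "cinner (cop_apply b \<eta>) \<zeta> = cinner \<eta> (cop_apply a \<zeta>)" for \<eta> \<zeta>
    using b by (metis cinner_commute)
  have "(THE b. \<forall>\<eta> \<zeta>. cinner (cop_apply b \<eta>) \<zeta> = cinner \<eta> (cop_apply a \<zeta>)) = b"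
  proof (rule the_equality)
    fix b' assume "\<forall>\<eta> \<zeta>. cinner (cop_apply b' \<eta>) \<zeta> = cinner \<eta> (cop_apply a \<zeta>)"
    then show "b' = b"
      by (intro cop_eqI cinner_ext_right) (metis b' cinner_commute)
  qed (simp add: b')
  then show ?thesis by (simp add: adj_def b')
qed

lemma cinner_adj_right: "cinner \<zeta> (cop_apply (adj a) \<eta>) = cinner (cop_apply a \<zeta>) \<eta>"
  by (metis cinner_commute cinner_adj)

lemma adj_unique: "(\<And>\<eta> \<zeta>. cinner (cop_apply b \<eta>) \<zeta> = cinner \<eta> (cop_apply a \<zeta>)) \<Longrightarrow> adj a = b"
  by (rule cop_eqI, rule cinner_ext_right) (metis cinner_adj cinner_commute)

lemma adj_simps [simp]:
  "adj (adj a) = a" "adj (a + b) = adj a + adj b" "adj (a * b) = adj b * adj a"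
  "adj (c *\<^sub>C a) = cnj c *\<^sub>C adj a" "adj 1 = 1" "adj 0 = 0"
  by (rule adj_unique; simp add: cinner_simps cinner_adj_right)+

text \<open>Sequences suffice here, since the only weak limits to be formed are those of iterates of
  one automorphism. Weak closures are treated separately, through continuity of maps for the
  topology \<open>wot\<close>.\<close>

definition wot_tendsto :: "(nat \<Rightarrow> 'h::chilbert_space cop) \<Rightarrow> 'h cop \<Rightarrow> bool"
  where "wot_tendsto T a \<longleftrightarrow> (\<forall>\<eta> \<zeta>. (\<lambda>n. cinner \<eta> (cop_apply (T n) \<zeta>)) \<longlonglongrightarrow> cinner \<eta> (cop_apply a \<zeta>))"

lemma wot_tendsto_unique: "wot_tendsto T a \<Longrightarrow> wot_tendsto T b \<Longrightarrow> a = b"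
  unfolding wot_tendsto_def
  by (intro cop_eqI cinner_ext_right) (metis LIMSEQ_unique)

lemma wot_tendsto_const: "wot_tendsto (\<lambda>_. a) a"
  by (simp add: wot_tendsto_def)

lemma wot_tendsto_add: "wot_tendsto S a \<Longrightarrow> wot_tendsto T b \<Longrightarrow> wot_tendsto (\<lambda>n. S n + T n) (a + b)"
  by (auto simp: wot_tendsto_def cinner_simps intro!: tendsto_add)

lemma wot_tendsto_scaleC: "wot_tendsto S a \<Longrightarrow> wot_tendsto (\<lambda>n. c *\<^sub>C S n) (c *\<^sub>C a)"
  by (auto simp: wot_tendsto_def cinner_simps intro!: tendsto_mult)

lemma wot_tendsto_mult_left: "wot_tendsto S a \<Longrightarrow> wot_tendsto (\<lambda>n. b * S n) (b * a)"
  by (auto simp: wot_tendsto_def cinner_adj[symmetric] simp del: cinner_adj)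

lemma wot_tendsto_mult_right: "wot_tendsto S a \<Longrightarrow> wot_tendsto (\<lambda>n. S n * b) (a * b)"
  by (auto simp: wot_tendsto_def)

lemma wot_tendsto_adj: "wot_tendsto S a \<Longrightarrow> wot_tendsto (\<lambda>n. adj (S n)) (adj a)"
  unfolding wot_tendsto_def cinner_adj_right
  by (subst (1 2) cinner_commute) (auto intro!: tendsto_cnj)

lemma wot_tendsto_shift: "wot_tendsto S a \<Longrightarrow> wot_tendsto (\<lambda>n. S (n + k)) a"
  unfolding wot_tendsto_def by (auto intro: LIMSEQ_ignore_initial_segment)

lemma convergent_dense:
  fixes f :: "nat \<Rightarrow> 'a::real_normed_vector \<Rightarrow> complex"
  assumes lip: "\<And>n x y. cmod (f n x - f n y) \<le> K * norm (x - y)"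
    and conv: "\<And>x. x \<in> D \<Longrightarrow> convergent (\<lambda>n. f n x)" and D: "closure D = UNIV"
  shows "convergent (\<lambda>n. f n x)"
proof -
  have "Cauchy (\<lambda>n. f n x)"
  proof (rule metric_CauchyI)
    fix e :: real assume e: "e > 0"
    define d where "d = e / (3 * (\<bar>K\<bar> + 1))"
    have d: "d > 0" using e by (simp add: d_def)
    obtain y where y: "y \<in> D" "dist y x < d"
      using D d closure_approachable[of x D] by auto
    have close: "cmod (f n x - f n y) < e / 3" for n
    proof -
      have "cmod (f n x - f n y) \<le> K * norm (x - y)" by (rule lip)
      also have "\<dots> \<le> (\<bar>K\<bar> + 1) * norm (x - y)" by (intro mult_right_mono) auto
      also have "\<dots> < (\<bar>K\<bar> + 1) * d"
        using y(2) by (intro mult_strict_left_mono) (auto simp: dist_norm norm_minus_commute)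
      also have "\<dots> = e / 3" by (simp add: d_def field_simps)
      finally show ?thesis .
    qed
    have "Cauchy (\<lambda>n. f n y)" using conv[OF y(1)] Cauchy_convergent_iff by blast
    then obtain M where M: "\<And>m n. m \<ge> M \<Longrightarrow> n \<ge> M \<Longrightarrow> cmod (f m y - f n y) < e / 3"
      using e unfolding Cauchy_def dist_norm by (metis divide_pos_pos zero_less_numeral)
    show "\<exists>M. \<forall>m\<ge>M. \<forall>n\<ge>M. dist (f m x) (f n x) < e"
    proof (intro exI[of _ M] allI impI)
      fix m n assume mn: "m \<ge> M" "n \<ge> M"
      have "f m x - f n x = (f m x - f m y) + (f m y - f n y) - (f n x - f n y)" by simp
      then have "cmod (f m x - f n x) \<le> cmod (f m x - f m y) + cmod (f m y - f n y) + cmod (f n x - f n y)"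
        by (metis norm_triangle_ineq norm_triangle_ineq4 add_right_mono order_trans)
      then show "dist (f m x) (f n x) < e"
        using close[of m] close[of n] M[OF mn] by (simp add: dist_norm)
    qed
  qed
  then show ?thesis using Cauchy_convergent_iff by blast
qed

text \<open>The uniform bound makes the coefficients Lipschitz in each argument with a constant not
  depending on \<open>n\<close>. Hence convergence spreads from \<open>S\<close> to all vectors in
  the right argument and then in the left one, and the limit form is bounded by the same
  \<open>K\<close>.\<close>

lemma wot_convergent:
  fixes T :: "nat \<Rightarrow> 'h::chilbert_space cop"
  assumes bound: "\<And>n v. norm (cop_apply (T n) v) \<le> K * norm v" and S: "total S"
    and conv: "\<And>v w. v \<in> S \<Longrightarrow> w \<in> S \<Longrightarrow> convergent (\<lambda>n. cinner v (cop_apply (T n) w))"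
  obtains a where "wot_tendsto T a"
proof -
  let ?c = "\<lambda>v w n. cinner v (cop_apply (T n) w)"
  have bnd: "cmod (?c v w n) \<le> norm v * (K * norm w)" for v w n
    by (rule order_trans[OF cinner_cauchy_schwarz]) (intro mult_left_mono bound norm_ge_zero)
  have dense: "closure (csubspace hull S) = UNIV" by (rule total_imp_dense[OF S])
  have sub1: "csubspace {w. convergent (?c v w)}" for v
    by (rule csubspaceI) (auto simp: cinner_simps convergent_const
        intro: convergent_add convergent_mult)
  have "csubspace hull S \<subseteq> {w. convergent (?c v w)}" if "v \<in> S" for v
    by (rule hull_minimal) (use sub1 conv that in auto)
  then have h1: "convergent (?c v w)" if "v \<in> S" "w \<in> csubspace hull S" for v w
    using that by blast
  have c1: "convergent (?c v w)" if v: "v \<in> S" for v w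
    by (rule convergent_dense[where K = "norm v * K" and f = "\<lambda>n w. ?c v w n", OF _ h1[OF v] dense])
      (use bnd[of v] in \<open>auto simp: cinner_diff_right[symmetric] mult.assoc
         simp flip: cop_apply_linear(2)\<close>)
  have sub2: "csubspace {v. convergent (?c v w)}" for w
    by (rule csubspaceI) (auto simp: cinner_simps convergent_const
        intro: convergent_add convergent_mult)
  have "csubspace hull S \<subseteq> {v. convergent (?c v w)}" for w
    by (rule hull_minimal) (use sub2 c1 in auto)
  then have h2: "convergent (?c v w)" if "v \<in> csubspace hull S" for v w
    using that by blast
  have c2: "convergent (?c v w)" for v w
    by (rule convergent_dense[where K = "K * norm w" and f = "\<lambda>n v. ?c v w n", OF _ h2 dense])
      (use bnd[of _ _ w] in \<open>auto simp: cinner_diff_left[symmetric] mult.commute[of "K * norm w"]\<close>)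
  define L where "L v w = lim (?c v w)" for v w
  have L: "?c v w \<longlonglongrightarrow> L v w" for v w
    using c2 unfolding L_def convergent_LIMSEQ_iff .
  obtain a where "\<And>v w. L v w = cinner v (cop_apply a w)"
  proof (rule sesquilinear_form_operator[of L K])
    fix x y z c
    show "L (x + y) z = L x z + L y z"
      by (rule LIMSEQ_unique[OF L]) (auto simp: cinner_simps intro!: tendsto_add L)
    show "L z (x + y) = L z x + L z y"
      by (rule LIMSEQ_unique[OF L]) (auto simp: cinner_simps intro!: tendsto_add L)
    show "L (c *\<^sub>C x) z = cnj c * L x z"
      by (rule LIMSEQ_unique[OF L]) (auto simp: cinner_simps intro!: tendsto_mult L)
    show "L z (c *\<^sub>C x) = c * L z x"
      by (rule LIMSEQ_unique[OF L]) (auto simp: cinner_simps intro!: tendsto_mult L)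
    show "cmod (L x z) \<le> K * norm x * norm z"
      by (rule LIMSEQ_le_const2[OF tendsto_norm[OF L]]) (use bnd[of x _ z] in \<open>auto simp: mult_ac\<close>)
  qed blast
  with L have "wot_tendsto T a" by (simp add: wot_tendsto_def)
  then show ?thesis by (rule that)
qed

text \<open>The graph of the linear extension of the assignment from \<open>f i\<close> to
  \<open>g i\<close>. It is kept as a relation because the vectors \<open>f i\<close> may be
  linearly dependent; it turns out to be single-valued when the Gram matrices agree.\<close>

inductive span_relation :: "('i \<Rightarrow> 'a::complex_vector) \<Rightarrow> ('i \<Rightarrow> 'b::complex_vector) \<Rightarrow> 'a \<Rightarrow> 'b \<Rightarrow> bool"
  for f g where
    base: "span_relation f g (f i) (g i)"
  | zero: "span_relation f g 0 0"
  | add: "span_relation f g v w \<Longrightarrow> span_relation f g v' w' \<Longrightarrow> span_relation f g (v + v') (w + w')"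
  | scale: "span_relation f g v w \<Longrightarrow> span_relation f g (c *\<^sub>C v) (c *\<^sub>C w)"

lemma span_relation_diff:
  assumes "span_relation f g v w" "span_relation f g v' w'"
  shows "span_relation f g (v - v') (w - w')"
  using span_relation.add[OF assms(1) span_relation.scale[OF assms(2), of "- 1"]] by simp

lemma span_relation_total:
  assumes "v \<in> csubspace hull range f" shows "\<exists>w. span_relation f g v w"
proof -
  have "csubspace hull range f \<subseteq> {v. \<exists>w. span_relation f g v w}"
    by (rule hull_minimal) (auto intro: span_relation.intros csubspaceI)
  with assms show ?thesis by blast
qed

text \<open>Vectors related by \<open>span_relation\<close> have equal norms, so the images of an
  approximating sequence are again Cauchy. Describing the operator by its coefficients against the
  total family \<open>g\<close> yields linearity without returning to the span.\<close>

lemma isometry_from_gram: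
  fixes f g :: "'i \<Rightarrow> 'h::chilbert_space"
  assumes gram: "\<And>i j. cinner (f i) (f j) = cinner (g i) (g j)"
    and f: "total (range f)" and g: "total (range g)"
  obtains U where "\<And>v i. cinner (g i) (cop_apply U v) = cinner (f i) v"
proof -
  have gram1: "cinner (f i) v = cinner (g i) w" if "span_relation f g v w" for v w i
    using that by induction (auto simp: gram cinner_simps)
  have gram2: "cinner v v' = cinner w w'" if "span_relation f g v w" "span_relation f g v' w'" for v w v' w'
    using that by induction (auto simp: gram1 cinner_simps)
  have iso: "norm v = norm w" if "span_relation f g v w" for v w
    using gram2[OF that that] by (simp add: cinner_self del: of_real_power)
  have ex: "\<exists>w. (\<forall>i. cinner (g i) w = cinner (f i) v) \<and> norm w = norm v" for v
  proof -
    have "v \<in> closure (csubspace hull range f)" by (simp add: total_imp_dense[OF f])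
    then obtain s where s: "\<And>n. s n \<in> csubspace hull range f" "s \<longlonglongrightarrow> v"
      unfolding closure_sequential by blast
    have "\<forall>n. \<exists>w. span_relation f g (s n) w"
      by (intro allI span_relation_total s(1))
    then obtain t where t: "\<And>n. span_relation f g (s n) (t n)"
      by metis
    have "norm (s m - s n) = norm (t m - t n)" for m n
      by (intro iso span_relation_diff t)
    then have "Cauchy t"
      using LIMSEQ_imp_Cauchy[OF s(2)] by (simp add: Cauchy_def dist_norm)
    then obtain w where w: "t \<longlonglongrightarrow> w"
      using Cauchy_convergent convergent_def by blast
    have "(\<lambda>n. cinner (g i) (t n)) \<longlonglongrightarrow> cinner (g i) w" "(\<lambda>n. cinner (f i) (s n)) \<longlonglongrightarrow> cinner (f i) v" for i
      by (intro tendsto_intros w s(2))+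
    then have "cinner (g i) w = cinner (f i) v" for i
      unfolding gram1[OF t, symmetric] by (rule LIMSEQ_unique)
    moreover have "(\<lambda>n. norm (t n)) \<longlonglongrightarrow> norm w" "(\<lambda>n. norm (s n)) \<longlonglongrightarrow> norm v"
      by (intro tendsto_intros w s(2))+
    then have "norm w = norm v"
      unfolding iso[OF t, symmetric] by (rule LIMSEQ_unique)
    ultimately show ?thesis by blast
  qed
  then obtain u where u: "\<And>v i. cinner (g i) (u v) = cinner (f i) v" "\<And>v. norm (u v) = norm v"
    by metis
  have lin: "u (v + w) = u v + u w" "u (c *\<^sub>C v) = c *\<^sub>C u v" for v w c
    by (rule totalD[OF g], clarify, simp add: u(1) cinner_simps)+
  have "bounded_linear u"
    by (rule bounded_linear_intro[where K = 1]) (simp_all add: lin scaleR_scaleC u(2))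
  then have "cop_apply (Cop u) = u"
    by (intro Cop_inverse) (simp add: lin)
  then show ?thesis by (intro that[of "Cop u"]) (simp add: u)
qed

lemma unitary_from_gram:
  fixes f g :: "'i \<Rightarrow> 'h::chilbert_space"
  assumes gram: "\<And>i j. cinner (f i) (f j) = cinner (g i) (g j)"
    and f: "total (range f)" and g: "total (range g)"
  obtains U where "U * adj U = 1" "adj U * U = 1" "\<And>i. cop_apply U (f i) = g i"
proof -
  obtain U where U: "\<And>v i. cinner (g i) (cop_apply U v) = cinner (f i) v"
    using isometry_from_gram[OF assms] by blast
  have Uf: "cop_apply U (f i) = g i" for i
    by (rule totalD[OF g]) (auto simp: U gram)
  have Ug: "cop_apply (adj U) (g i) = f i" for i
    by (rule totalD[OF f], clarify) (simp add: cinner_adj_right Uf gram)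
  have "U * adj U = 1"
    by (rule cop_eqI_total[OF g]) (auto simp: Uf Ug)
  moreover have "adj U * U = 1"
    by (rule cop_eqI_total[OF f]) (auto simp: Uf Ug)
  ultimately show ?thesis using Uf that by blast
qed

section \<open>The weak operator topology\<close>

lemma topspace_wot [simp]: "topspace (wot :: 'h::chilbert_space cop topology) = UNIV"
proof -
  have "(UNIV :: 'h cop set) \<in> {{a. cinner \<eta> (cop_apply a \<zeta>) \<in> U} | \<eta> \<zeta> U. open U}"
    by (auto intro!: exI[of _ UNIV])
  then have "UNIV \<subseteq> \<Union> {{a. cinner \<eta> (cop_apply a \<zeta>) \<in> U} | (\<eta> :: 'h) \<zeta> U. open U}"
    by (rule Union_upper)
  then show ?thesis unfolding wot_def topology_generated_by_topspace by (rule top.extremum_uniqueI)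
qed

lemma continuous_map_wot_coeff: "continuous_map wot euclidean (\<lambda>a. cinner \<eta> (cop_apply a \<zeta>))"
proof -
  have "openin wot {a. cinner \<eta> (cop_apply a \<zeta>) \<in> U}" if "open U" for U
    unfolding wot_def by (rule topology_generated_by_Basis) (use that in blast)
  then show ?thesis by (auto simp: continuous_map_def)
qed

lemma continuous_map_into_wot:
  fixes f :: "'x \<Rightarrow> 'h::chilbert_space cop"
  assumes "\<And>\<eta> \<zeta>. continuous_map X euclidean (\<lambda>x. cinner \<eta> (cop_apply (f x) \<zeta>))"
  shows "continuous_map X wot f"
  unfolding wot_def
proof (rule continuous_on_generated_topo)
  fix V assume "V \<in> {{a. cinner \<eta> (cop_apply a \<zeta>) \<in> U} | (\<eta> :: 'h) \<zeta> U. open U}"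
  then obtain \<eta> \<zeta> U where V: "V = {a. cinner \<eta> (cop_apply a \<zeta>) \<in> U}" "open U" by blast
  have "openin X {x \<in> topspace X. cinner \<eta> (cop_apply (f x) \<zeta>) \<in> U}"
    using openin_continuous_map_preimage[OF assms] V(2) by auto
  also have "{x \<in> topspace X. cinner \<eta> (cop_apply (f x) \<zeta>) \<in> U} = f -` V \<inter> topspace X"
    using V(1) by auto
  finally show "openin X (f -` V \<inter> topspace X)" .
next
  show "f ` topspace X \<subseteq> \<Union> {{a. cinner \<eta> (cop_apply a \<zeta>) \<in> U} | (\<eta> :: 'h) \<zeta> U. open U}"
    using topspace_wot unfolding wot_def topology_generated_by_topspace by blast
qed

lemma continuous_map_wot_mult_left: "continuous_map wot wot (\<lambda>a. b * a)"
proof (intro continuous_map_into_wot)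
  fix \<eta> \<zeta> :: 'a
  show "continuous_map wot euclidean (\<lambda>a. cinner \<eta> (cop_apply (b * a) \<zeta>))"
    using continuous_map_wot_coeff[of "cop_apply (adj b) \<eta>" \<zeta>] by simp
qed

lemma continuous_map_wot_mult_right: "continuous_map wot wot (\<lambda>a. a * b)"
proof (intro continuous_map_into_wot)
  fix \<eta> \<zeta> :: 'a
  show "continuous_map wot euclidean (\<lambda>a. cinner \<eta> (cop_apply (a * b) \<zeta>))"
    using continuous_map_wot_coeff[of \<eta> "cop_apply b \<zeta>"] by simp
qed

lemma continuous_map_wot_add: "continuous_map wot wot (\<lambda>a. a + b)"
proof (intro continuous_map_into_wot)
  fix \<eta> \<zeta> :: 'a
  have "continuous_map wot euclidean
      (\<lambda>a. cinner \<eta> (cop_apply a \<zeta>) + cinner \<eta> (cop_apply b \<zeta>))"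
    by (intro continuous_map_add continuous_map_wot_coeff continuous_map_const[THEN iffD2]) simp
  then show "continuous_map wot euclidean (\<lambda>a. cinner \<eta> (cop_apply (a + b) \<zeta>))"
    by (simp add: cinner_add_right)
qed

lemma continuous_map_wot_scaleC: "continuous_map wot wot (\<lambda>a. c *\<^sub>C a)"
proof (intro continuous_map_into_wot)
  fix \<eta> \<zeta> :: 'a
  show "continuous_map wot euclidean (\<lambda>a. cinner \<eta> (cop_apply (c *\<^sub>C a) \<zeta>))"
    using continuous_map_wot_coeff[of "cnj c *\<^sub>C \<eta>" \<zeta>] by (simp add: cinner_simps)
qed

lemma continuous_map_wot_adj: "continuous_map wot wot adj"
proof (intro continuous_map_into_wot)
  fix \<eta> \<zeta> :: 'a
  have "continuous_map euclidean euclidean cnj"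
    by (intro iffD2[OF continuous_map_iff_continuous2]) (intro continuous_intros)
  then have "continuous_map wot euclidean (cnj \<circ> (\<lambda>a. cinner \<zeta> (cop_apply a \<eta>)))"
    by (rule continuous_map_compose[OF continuous_map_wot_coeff])
  also have "cnj \<circ> (\<lambda>a. cinner \<zeta> (cop_apply a \<eta>)) = (\<lambda>a. cinner \<eta> (cop_apply (adj a) \<zeta>))"
    by (rule ext) (metis comp_apply cinner_adj_right cinner_commute)
  finally show "continuous_map wot euclidean (\<lambda>a. cinner \<eta> (cop_apply (adj a) \<zeta>))" .
qed

lemma wot_closure_image:
  assumes "continuous_map wot wot f" "\<And>a. a \<in> S \<Longrightarrow> f a \<in> wot closure_of T" "a \<in> wot closure_of S"
  shows "f a \<in> wot closure_of T"
proof -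
  have "f ` (wot closure_of S) \<subseteq> wot closure_of (f ` S)"
    by (rule continuous_map_image_closure_subset[OF assms(1)])
  also have "\<dots> \<subseteq> wot closure_of (wot closure_of T)"
    by (rule closure_of_mono) (use assms(2) in blast)
  finally show ?thesis using assms(3) by auto
qed

lemma wot_closure_incr: "a \<in> S \<Longrightarrow> a \<in> wot closure_of S"
  using closure_of_subset[of S wot] by auto

lemma wot_closure_eq:
  assumes "\<And>a. a \<in> S \<Longrightarrow> f a = g a" "a \<in> wot closure_of S"
    and "continuous_map wot euclidean f" "continuous_map wot euclidean g"
  shows "f a = (g a :: complex)"
  by (rule forall_in_closure_of_eq[OF assms(2) _ assms(3,4)]) (simp_all add: assms(1))

lemma wot_tendsto_closed:
  assumes T: "wot_tendsto T a" and ev: "eventually (\<lambda>n. T n \<in> C) sequentially" and C: "closedin wot C"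
  shows "a \<in> C"
proof (rule ccontr)
  assume a: "a \<notin> C"
  \<comment> \<open>\<open>wot\<close> is given by a subbasis, so eventual membership in an open
    neighbourhood of \<open>a\<close> is proved by induction on the generation of the open
    set.\<close>
  have open_ev: "a \<in> U \<longrightarrow> eventually (\<lambda>n. T n \<in> U) sequentially"
    if "generate_topology_on {{a. cinner \<eta> (cop_apply a \<zeta>) \<in> U} | \<eta> \<zeta> U. open U} U" for U
    using that
  proof induction
    case (UN K)
    show ?case
    proof
      assume "a \<in> \<Union> K"
      then obtain k where "k \<in> K" "a \<in> k" by blast
      with UN.IH have "eventually (\<lambda>n. T n \<in> k) sequentially" by blast
      then show "eventually (\<lambda>n. T n \<in> \<Union> K) sequentially"
        by (rule eventually_mono) (use \<open>k \<in> K\<close> in blast)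
    qed
  next
    case (Basis s)
    then obtain \<eta> \<zeta> U where s: "s = {a. cinner \<eta> (cop_apply a \<zeta>) \<in> U}" "open U" by blast
    show ?case
      using T s topological_tendstoD[of "\<lambda>n. cinner \<eta> (cop_apply (T n) \<zeta>)" _ sequentially U]
      by (auto simp: wot_tendsto_def)
  qed (auto elim: eventually_elim2)
  have "openin wot (- C)" using C by (simp add: closedin_def Compl_eq_Diff_UNIV)
  then have "eventually (\<lambda>n. T n \<in> - C) sequentially"
    using open_ev[of "- C"] a unfolding wot_def openin_topology_generated_by_iff by blast
  with ev have "eventually (\<lambda>n. False) sequentially"
    by eventually_elim auto
  then show False by simp
qed

section \<open>Generated algebras without unit and their weak closures\<close>

lemma subalgebra_hull: "subalgebra (subalgebra hull S)"
  by (rule hull_in) (auto simp: subalgebra_def)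

lemma subalgebraD:
  assumes "subalgebra B"
  shows "0 \<in> B" "a \<in> B \<Longrightarrow> b \<in> B \<Longrightarrow> a + b \<in> B" "a \<in> B \<Longrightarrow> b \<in> B \<Longrightarrow> a * b \<in> B"
    "a \<in> B \<Longrightarrow> c *\<^sub>C a \<in> B"
  using assms by (auto simp: subalgebra_def)

lemma subalgebra_csubspace: "subalgebra B \<Longrightarrow> csubspace B"
  by (auto simp: subalgebra_def csubspace_def)

lemma subalgebra_Inter: "(\<And>B. B \<in> \<B> \<Longrightarrow> subalgebra B) \<Longrightarrow> subalgebra (\<Inter>\<B>)"
  by (auto simp: subalgebra_def)

lemma prod_list_in_subalgebra:
  "subalgebra B \<Longrightarrow> ws \<noteq> [] \<Longrightarrow> set ws \<subseteq> B \<Longrightarrow> prod_list ws \<in> B"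
proof (induction ws)
  case (Cons w ws)
  then show ?case by (cases "ws = []") (auto intro: subalgebraD)
qed simp

text \<open>The span of the nonempty words is closed under products and therefore contains the
  generated algebra. The empty word is excluded because the unit need not belong to that
  algebra.\<close>

lemma subalgebra_hull_subset_csubspace:
  assumes T: "csubspace T" and words: "\<And>ws. ws \<noteq> [] \<Longrightarrow> set ws \<subseteq> S \<Longrightarrow> prod_list ws \<in> T"
  shows "subalgebra hull S \<subseteq> T"
proof -
  let ?W = "{prod_list ws | ws. ws \<noteq> [] \<and> set ws \<subseteq> S}"
  let ?H = "csubspace hull ?W"
  note H = csubspaceD[OF csubspace_hull]
  have WW: "v * w \<in> ?W" if vw: "v \<in> ?W" "w \<in> ?W" for v w
  proof -
    obtain vs ws where "v = prod_list vs" "vs \<noteq> []" "set vs \<subseteq> S" "w = prod_list ws" "set ws \<subseteq> S"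
      using vw by blast
    then show ?thesis by (intro CollectI exI[of _ "vs @ ws"]) auto
  qed
  have "csubspace {b. v * b \<in> ?H}" for v
    by (auto intro!: csubspaceI H simp: distrib_left mult_scaleC_right)
  then have "?H \<subseteq> {b. v * b \<in> ?H}" if "v \<in> ?W" for v
    by (rule hull_minimal[rotated]) (rule subsetI, rule CollectI, rule hull_inc, rule WW[OF that])
  then have 1: "v * b \<in> ?H" if "v \<in> ?W" "b \<in> ?H" for v b
    using that by blast
  have "csubspace {a. a * b \<in> ?H}" for b
    by (auto intro!: csubspaceI H simp: distrib_right mult_scaleC_left)
  then have "?H \<subseteq> {a. a * b \<in> ?H}" if "b \<in> ?H" for b
    by (rule hull_minimal[rotated]) (rule subsetI, rule CollectI, rule 1[OF _ that])
  then have "subalgebra ?H" unfolding subalgebra_def by (auto intro: H)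
  moreover have "S \<subseteq> ?H"
  proof
    fix s assume "s \<in> S"
    then have "s \<in> ?W" by (intro CollectI exI[of _ "[s]"]) auto
    then show "s \<in> ?H" by (rule hull_inc)
  qed
  ultimately have "subalgebra hull S \<subseteq> ?H" by (intro hull_minimal)
  also have "?H \<subseteq> T" by (rule hull_minimal) (use T words in auto)
  finally show ?thesis .
qed

text \<open>Multiplication is only separately continuous for the weak topology, so the closure is
  taken in one factor while the other is held fixed, and afterwards in the other.\<close>

lemma subalgebra_wot_closure:
  assumes B: "subalgebra B" shows "subalgebra (wot closure_of B)"
proof -
  let ?C = "wot closure_of B"
  have add1: "a + b \<in> ?C" if "a \<in> ?C" "b \<in> B" for a b
    by (rule wot_closure_image[OF continuous_map_wot_add _ that(1)])
      (auto intro: wot_closure_incr subalgebraD[OF B] that)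
  have add: "a + b \<in> ?C" if "a \<in> ?C" "b \<in> ?C" for a b
    using wot_closure_image[OF continuous_map_wot_add[of a] _ that(2), of B] add1[OF that(1)]
    by (simp add: add.commute)
  have mult1: "a * b \<in> ?C" if "a \<in> ?C" "b \<in> B" for a b
    by (rule wot_closure_image[OF continuous_map_wot_mult_right _ that(1)])
      (auto intro: wot_closure_incr subalgebraD[OF B] that)
  have mult: "a * b \<in> ?C" if "a \<in> ?C" "b \<in> ?C" for a b
    by (rule wot_closure_image[OF continuous_map_wot_mult_left _ that(2)]) (rule mult1[OF that(1)])
  have scale: "c *\<^sub>C a \<in> ?C" if "a \<in> ?C" for a c
    by (rule wot_closure_image[OF continuous_map_wot_scaleC _ that])
      (auto intro: wot_closure_incr subalgebraD[OF B])
  show ?thesis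
    unfolding subalgebra_def using add mult scale wot_closure_incr[OF subalgebraD(1)[OF B]] by blast
qed

section \<open>Noncommutative polynomials and C*-seminorms\<close>

lemma ncpoly_expand: "p = (\<Sum>w\<in>Poly_Mapping.keys p. Poly_Mapping.single w (Poly_Mapping.lookup p w))"
  by (rule poly_mapping_eqI) (simp add: lookup_sum lookup_single when_def in_keys_iff)

lemma ncpoly_induct:
  assumes "\<And>w c. P (Poly_Mapping.single w c)" "\<And>p q. P p \<Longrightarrow> P q \<Longrightarrow> P (p + q)"
  shows "P (p :: 'a \<Rightarrow>\<^sub>0 'b::ab_group_add)"
proof -
  have 0: "P 0" using assms(1)[of undefined 0] by simp
  have "P (\<Sum>w\<in>S. Poly_Mapping.single w (Poly_Mapping.lookup p w))" for S
    by (induction S rule: infinite_finite_induct) (auto intro: assms 0)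
  then show ?thesis using ncpoly_expand[of p] by metis
qed

lemma scaleC_single: "c *\<^sub>C Poly_Mapping.single w (b :: 'b::complex_vector) = Poly_Mapping.single w (c *\<^sub>C b)"
  by transfer (auto simp: fun_eq_iff when_def)

lemma scaleC_single': "Poly_Mapping.single w (c :: complex) = c *\<^sub>C Poly_Mapping.single w 1"
  by (simp add: scaleC_single scaleC_complex_def)

lemma single_mult_Word:
  "Poly_Mapping.single (Word v) a * Poly_Mapping.single (Word w) b = Poly_Mapping.single (Word (v @ w)) (a * b)"
  by (simp add: mult_single plus_free_monoid_def)

lemma nc_eval_add: "nc_eval f (p + q) = nc_eval f p + nc_eval f q"
  unfolding nc_eval_def by (rule setsum_keys_plus_distrib) (simp_all add: scaleC_add_left)

lemma nc_eval_single: "nc_eval f (Poly_Mapping.single (Word js) c) = c *\<^sub>C prod_list (map f js)"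
  by (simp add: nc_eval_def)

lemma nc_eval_mult: "nc_eval f (p * q) = nc_eval f p * nc_eval f q"
proof -
  have 1: "nc_eval f (Poly_Mapping.single v a * q) = nc_eval f (Poly_Mapping.single v a) * nc_eval f q" for v a
  proof (induction q rule: ncpoly_induct)
    case (1 w c)
    show ?case
      by (cases v; cases w) (simp add: single_mult_Word nc_eval_single mult_scaleC_left
          mult_scaleC_right scaleC_scaleC mult.commute)
  qed (simp add: distrib_left nc_eval_add)
  show ?thesis
    by (induction p rule: ncpoly_induct) (simp_all add: 1 distrib_right nc_eval_add)
qed

lemma nc_eval_scaleC: "nc_eval f (c *\<^sub>C p) = c *\<^sub>C nc_eval f p"
proof (induction p rule: ncpoly_induct)
  case (1 w d)
  show ?case by (cases w) (simp add: scaleC_single nc_eval_single scaleC_complex_def scaleC_scaleC)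
qed (simp add: scaleC_add_right nc_eval_add)

lemma nc_eval_diff: "nc_eval f (p - q) = nc_eval f p - nc_eval f q"
  using nc_eval_add[of f p "- q"] nc_eval_scaleC[of f "- 1" q] by simp

lemma nc_eval_0 [simp]: "nc_eval f 0 = 0"
  by (simp add: nc_eval_def)

lemma nc_eval_sum: "nc_eval f (sum g I) = (\<Sum>i\<in>I. nc_eval f (g i))"
  by (induction I rule: infinite_finite_induct) (auto simp: nc_eval_add)

lemma nc_eval_free_gen: "nc_eval f (free_gen g) = f (g, False)"
  by (simp add: free_gen_def nc_eval_single scaleC_one)

lemma slice_map_add: "slice_map \<mu> (p + q) = slice_map \<mu> p + slice_map \<mu> q"
  unfolding slice_map_def by (rule setsum_keys_plus_distrib) (simp_all add: scaleC_add_right)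

lemma slice_map_single:
  "slice_map \<mu> (Poly_Mapping.single w b) = \<mu> (Poly_Mapping.single w 1) *\<^sub>C b"
  by (simp add: slice_map_def)

lemma slice_map_0 [simp]: "slice_map \<mu> 0 = 0"
  by (simp add: slice_map_def)

lemma slice_map_sum: "slice_map \<mu> (sum g I) = (\<Sum>i\<in>I. slice_map \<mu> (g i))"
  by (induction I rule: infinite_finite_induct) (auto simp: slice_map_add)

lemma slice_map_scaleC: "slice_map \<mu> (c *\<^sub>C p) = c *\<^sub>C slice_map \<mu> p"
proof (induction p rule: ncpoly_induct)
  case (1 w b)
  show ?case by (simp add: scaleC_single slice_map_single scaleC_scaleC mult.commute)
qed (simp add: scaleC_add_right slice_map_add)

section \<open>Expansion of the homomorphism \<alpha> on words as a sum over tuples of row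
  indices\<close>

definition index_lists :: "nat \<Rightarrow> nat \<Rightarrow> nat list set"
  where "index_lists n L = {is. length is = L \<and> set is \<subseteq> {1..n}}"

lemma finite_index_lists [simp]: "finite (index_lists n L)"
  unfolding index_lists_def
  using finite_lists_length_eq[of "{1..n}" L] by (simp add: conj_commute)

lemma index_lists_0 [simp]: "index_lists n 0 = {[]}"
  by (auto simp: index_lists_def)

lemma sum_index_lists_append:
  "(\<Sum>is\<in>index_lists n (K + L). g is) = (\<Sum>is\<in>index_lists n K. \<Sum>is'\<in>index_lists n L. g (is @ is'))"
proof -
  have "(\<Sum>is\<in>index_lists n K. \<Sum>is'\<in>index_lists n L. g (is @ is')) =
      (\<Sum>(is, is')\<in>index_lists n K \<times> index_lists n L. g (is @ is'))"
    by (simp add: sum.cartesian_product)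
  also have "\<dots> = (\<Sum>is\<in>index_lists n (K + L). g is)"
    by (rule sum.reindex_bij_witness[of _ "\<lambda>is. (take K is, drop K is)" "\<lambda>(is, is'). is @ is'"])
      (auto simp: index_lists_def dest: in_set_takeD in_set_dropD)
  finally show ?thesis by simp
qed

lemma sum_index_lists_1: "(\<Sum>is\<in>index_lists n (Suc 0). g is) = (\<Sum>i=1..n. g [i])"
  by (rule sum.reindex_bij_witness[of _ "\<lambda>i. [i]" hd]) (auto simp: index_lists_def length_Suc_conv)

lemma sum_index_lists_Suc:
  "(\<Sum>is\<in>index_lists n (Suc L). g is) = (\<Sum>i=1..n. \<Sum>is\<in>index_lists n L. g (i # is))"
  using sum_index_lists_append[of g n "Suc 0" L] by (simp add: sum_index_lists_1)

lemma prod_list_sum_expand: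
  fixes f :: "nat \<Rightarrow> 'j \<Rightarrow> 'a::complex_algebra_1"
  shows "prod_list (map (\<lambda>j. \<Sum>i=1..n. f i j) js) =
    (\<Sum>is\<in>index_lists n (length js). prod_list (map2 f is js))"
proof (induction js)
  case (Cons j js)
  then show ?case
    by (simp add: sum_index_lists_Suc sum_distrib_left sum_distrib_right)
      (rule sum.swap)
qed simp

lemma prod_list_map2_single:
  "length is = length js \<Longrightarrow> prod_list (map2 (\<lambda>i j. Poly_Mapping.single (Word [i]) (u i j)) is js) =
    Poly_Mapping.single (Word is) (prod_list (map2 u is js))"
proof (induction "is" js rule: list_induct2)
  case Nil
  then show ?case by (simp add: zero_free_monoid_def[symmetric])
next
  case (Cons i "is" j js)
  then show ?case by (simp add: single_mult_Word)
qed

text \<open>The coefficient of the word \<open>is\<close> in the image under \<alpha> of the word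
  \<open>js\<close>: rows come from the new word, columns from the old one.\<close>

definition word_product :: "nat list \<Rightarrow> nat list \<Rightarrow> (nat \<times> nat) free_star_algebra"
  where "word_product is js = prod_list (map2 Mi_u is js)"

lemma slice_map_Mi_\<alpha>_word:
  "slice_map \<mu> (Mi_\<alpha> n (Poly_Mapping.single (Word js) 1)) =
    (\<Sum>is\<in>index_lists n (length js). \<mu> (Poly_Mapping.single (Word is) 1) *\<^sub>C word_product is js)"
proof -
  have "Mi_\<alpha> n (Poly_Mapping.single (Word js) 1) =
      (\<Sum>is\<in>index_lists n (length js). prod_list (map2 (\<lambda>i j. Poly_Mapping.single (Word [i]) (Mi_u i j)) is js))"
    unfolding Mi_\<alpha>_def nc_eval_single scaleC_one by (rule prod_list_sum_expand)
  also have "\<dots> = (\<Sum>is\<in>index_lists n (length js). Poly_Mapping.single (Word is) (word_product is js))"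
    by (intro sum.cong refl) (simp add: prod_list_map2_single word_product_def index_lists_def)
  finally show ?thesis by (simp add: slice_map_sum slice_map_single)
qed

lemma slice_map_Mi_\<alpha>:
  "slice_map \<mu> (Mi_\<alpha> n p) = (\<Sum>w\<in>Poly_Mapping.keys p. Poly_Mapping.lookup p w *\<^sub>C
    slice_map \<mu> (Mi_\<alpha> n (Poly_Mapping.single w 1)))"
proof -
  have scale: "slice_map \<mu> (Mi_\<alpha> n (c *\<^sub>C q)) = c *\<^sub>C slice_map \<mu> (Mi_\<alpha> n q)" for c q
    by (simp add: Mi_\<alpha>_def nc_eval_scaleC slice_map_scaleC)
  have "slice_map \<mu> (Mi_\<alpha> n (\<Sum>w\<in>S. Poly_Mapping.single w (f w))) =
      (\<Sum>w\<in>S. f w *\<^sub>C slice_map \<mu> (Mi_\<alpha> n (Poly_Mapping.single w 1)))" for S f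
    unfolding scale[symmetric] scaleC_single'[symmetric]
    by (simp add: Mi_\<alpha>_def nc_eval_sum slice_map_sum)
  from this[of "Poly_Mapping.lookup p" "Poly_Mapping.keys p"] show ?thesis
    by (simp flip: ncpoly_expand)
qed

section \<open>The involution of the free *-algebra and calculation modulo a C*-seminorm\<close>

definition word_star :: "('g \<times> bool) free_monoid \<Rightarrow> ('g \<times> bool) free_monoid"
  where "word_star w = Word (rev (map (\<lambda>(g, b). (g, \<not> b)) (letters w)))"

lemma free_star_add: "free_star (p + q) = free_star p + free_star q"
  unfolding free_star_def by (rule setsum_keys_plus_distrib) (simp_all add: single_add)

lemma free_star_single: "free_star (Poly_Mapping.single w c) = Poly_Mapping.single (word_star w) (cnj c)"
  by (simp add: free_star_def word_star_def)

lemma free_star_mult: "free_star (p * q) = free_star q * free_star p"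
proof -
  have 1: "free_star (Poly_Mapping.single v a * q) = free_star q * free_star (Poly_Mapping.single v a)" for v a
  proof (induction q rule: ncpoly_induct)
    case (1 w c)
    show ?case
      by (simp add: mult_single free_star_single word_star_def plus_free_monoid_def mult.commute)
  qed (simp add: distrib_left distrib_right free_star_add)
  show ?thesis
    by (induction p rule: ncpoly_induct) (simp_all add: 1 distrib_right distrib_left free_star_add)
qed

lemma free_star_involution: "free_star (free_star p) = p"
proof (induction p rule: ncpoly_induct)
  case (1 w c)
  have "word_star (word_star w) = w"
    by (cases w) (simp add: word_star_def rev_map[symmetric] o_def case_prod_unfold)
  then show ?case by (simp add: free_star_single)
qed (simp add: free_star_add)

lemma free_star_scaleC: "free_star (c *\<^sub>C p) = cnj c *\<^sub>C free_star p"
proof (induction p rule: ncpoly_induct)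
  case (1 w d)
  show ?case by (simp add: scaleC_single free_star_single scaleC_complex_def)
qed (simp add: scaleC_add_right free_star_add)

lemma free_star_diff: "free_star (p - q) = free_star p - free_star q"
  using free_star_add[of p "- q"] free_star_scaleC[of "- 1" q] by simp

lemma free_star_0 [simp]: "free_star 0 = 0"
  by (simp add: free_star_def)

lemma free_star_1 [simp]: "free_star 1 = 1"
proof -
  have "word_star (0 :: ('a \<times> bool) free_monoid) = 0"
    by (simp add: word_star_def zero_free_monoid_def)
  then show ?thesis using free_star_single[of "0 :: ('a \<times> bool) free_monoid" 1] by simp
qed

locale cstar =
  fixes \<nu> :: "'g free_star_algebra \<Rightarrow> real"
  assumes cstar_seminorm: "cstar_seminorm \<nu>"
begin

lemma triangle: "\<nu> (p + q) \<le> \<nu> p + \<nu> q"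
  and scale: "\<nu> (c *\<^sub>C p) = cmod c * \<nu> p"
  and submult: "\<nu> (p * q) \<le> \<nu> p * \<nu> q"
  and cstar: "\<nu> (free_star p * p) = (\<nu> p)\<^sup>2"
  using cstar_seminorm by (auto simp: cstar_seminorm_def)

lemma zero [simp]: "\<nu> 0 = 0"
  using scale[of 0 0] by simp

lemma minus [simp]: "\<nu> (- p) = \<nu> p"
  using scale[of "- 1" p] by simp

lemma nonneg [simp]: "0 \<le> \<nu> p"
  using triangle[of p "- p"] by simp

lemma diff_commute: "\<nu> (p - q) = \<nu> (q - p)"
  using minus[of "p - q"] by simp

lemma triangle_sum: "\<nu> (sum f I) \<le> (\<Sum>i\<in>I. \<nu> (f i))"
proof (induction I rule: infinite_finite_induct)
  case (insert i I)
  then show ?case using triangle[of "f i" "sum f I"] by simp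
qed simp_all

lemma star [simp]: "\<nu> (free_star p) = \<nu> p"
proof -
  have le: "\<nu> p \<le> \<nu> (free_star p)" for p
  proof (cases "\<nu> p = 0")
    case False
    have "(\<nu> p)\<^sup>2 \<le> \<nu> (free_star p) * \<nu> p" using cstar[of p] submult by metis
    moreover have "\<nu> p > 0" using False nonneg[of p] by linarith
    ultimately show ?thesis by (simp add: power2_eq_square)
  qed simp
  show ?thesis using le[of p] le[of "free_star p"] by (simp add: free_star_involution)
qed

text \<open>Equality in the quotient by the null ideal of \<nu>. Its congruence rules stand in for
  the quotient algebra, which is never formed.\<close>

definition sim :: "'g free_star_algebra \<Rightarrow> 'g free_star_algebra \<Rightarrow> bool"  (infix \<open>\<doteq>\<close> 50)
  where "p \<doteq> q \<longleftrightarrow> \<nu> (p - q) = 0"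

lemma sim_refl [simp, intro]: "p \<doteq> p"
  by (simp add: sim_def)

lemma sim_sym: "p \<doteq> q \<Longrightarrow> q \<doteq> p"
  by (simp add: sim_def diff_commute)

lemma zero_add: "\<nu> p = 0 \<Longrightarrow> \<nu> q = 0 \<Longrightarrow> \<nu> (p + q) = 0"
  using triangle[of p q] nonneg[of "p + q"] by linarith

lemma sim_trans [trans]: "p \<doteq> q \<Longrightarrow> q \<doteq> r \<Longrightarrow> p \<doteq> r"
  using zero_add[of "p - q" "q - r"] by (simp add: sim_def)

lemma sim_add: "p \<doteq> q \<Longrightarrow> p' \<doteq> q' \<Longrightarrow> p + p' \<doteq> q + q'"
  using zero_add[of "p - q" "p' - q'"] by (simp add: sim_def algebra_simps)

lemma sim_scale: "p \<doteq> q \<Longrightarrow> c *\<^sub>C p \<doteq> c *\<^sub>C q"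
  by (simp add: sim_def scale flip: scaleC_diff_right)

lemma sim_minus: "p \<doteq> q \<Longrightarrow> - p \<doteq> - q"
  using sim_scale[of p q "- 1"] by simp

lemma sim_diff: "p \<doteq> q \<Longrightarrow> p' \<doteq> q' \<Longrightarrow> p - p' \<doteq> q - q'"
  using sim_add[OF _ sim_minus, of p q p' q'] by simp

lemma zero_mult: "\<nu> p = 0 \<Longrightarrow> \<nu> (p * q) = 0" "\<nu> p = 0 \<Longrightarrow> \<nu> (q * p) = 0"
  using submult[of p q] submult[of q p] nonneg[of "p * q"] nonneg[of "q * p"] by auto

lemma sim_mult: "p \<doteq> q \<Longrightarrow> p' \<doteq> q' \<Longrightarrow> p * p' \<doteq> q * q'"
  using zero_add[OF zero_mult(1)[of "p - q" p'] zero_mult(2)[of "p' - q'" q]]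
  by (simp add: sim_def algebra_simps)

lemma sim_sum: "(\<And>i. i \<in> I \<Longrightarrow> f i \<doteq> g i) \<Longrightarrow> sum f I \<doteq> sum g I"
  by (induction I rule: infinite_finite_induct) (auto intro: sim_add)

lemma sim_star: "p \<doteq> q \<Longrightarrow> free_star p \<doteq> free_star q"
  by (simp add: sim_def flip: free_star_diff)

lemma sim_norm: "p \<doteq> q \<Longrightarrow> \<nu> p = \<nu> q"
  using triangle[of q "p - q"] triangle[of p "q - p"] by (simp add: sim_def diff_commute[of q p])

lemma sim_0_iff: "p \<doteq> 0 \<longleftrightarrow> \<nu> p = 0"
  by (simp add: sim_def)

definition proj :: "'g free_star_algebra \<Rightarrow> bool"
  where "proj e \<longleftrightarrow> free_star e \<doteq> e \<and> e * e \<doteq> e"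

lemma proj_norm: "proj e \<Longrightarrow> \<nu> e \<le> 1"
proof -
  assume "proj e"
  then have "free_star e * e \<doteq> e"
    unfolding proj_def using sim_mult[of "free_star e" e e e] sim_trans by blast
  then have "(\<nu> e)\<^sup>2 = \<nu> e" using cstar[of e] sim_norm by metis
  then show ?thesis by (cases "\<nu> e = 0") (auto simp: power2_eq_square)
qed

lemma proj_1: "proj 1"
  by (simp add: proj_def)

lemma proj_compl:
  assumes "proj e" shows "proj (1 - e)"
proof -
  have "free_star (1 - e) \<doteq> 1 - e"
    using assms by (auto simp: proj_def free_star_diff intro: sim_diff)
  moreover have "(1 - e) * (1 - e) = 1 - e - (e - e * e)" by (simp add: algebra_simps)
  moreover have "1 - e - (e - e * e) \<doteq> 1 - e - (e - e)"
    using assms by (intro sim_diff) (auto simp: proj_def)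
  ultimately show ?thesis by (simp add: proj_def)
qed

lemma word_norm:
  assumes "\<And>g. \<nu> (free_gen g) \<le> 1"
  shows "\<nu> (Poly_Mapping.single (Word w) 1) \<le> 1"
proof (induction w)
  case Nil
  then show ?case using proj_norm[OF proj_1] by (simp add: zero_free_monoid_def[symmetric])
next
  case (Cons a w)
  have "\<nu> (Poly_Mapping.single (Word [a]) 1) \<le> 1"
  proof (cases a)
    case (Pair g b)
    have "free_star (free_gen g) = Poly_Mapping.single (Word [(g, True)]) 1"
      by (simp add: free_gen_def free_star_single word_star_def)
    then have "\<nu> (Poly_Mapping.single (Word [(g, True)]) 1) = \<nu> (free_gen g)" by (metis star)
    then show ?thesis using assms[of g] Pair by (cases b) (auto simp: free_gen_def)
  qed
  then have "\<nu> (Poly_Mapping.single (Word [a]) 1) * \<nu> (Poly_Mapping.single (Word w) 1) \<le> 1 * 1"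
    using Cons by (intro mult_mono) auto
  then show ?case
    using submult[of "Poly_Mapping.single (Word [a]) 1" "Poly_Mapping.single (Word w) 1"]
    by (simp add: single_mult_Word)
qed

text \<open>The right-hand side does not mention the seminorm, so the supremum defining
  \<open>universal_norm\<close> is taken over a bounded set as soon as all admissible seminorms are
  at most one on the generators.\<close>

lemma norm_bound:
  assumes "\<And>g. \<nu> (free_gen g) \<le> 1"
  shows "\<nu> p \<le> (\<Sum>w\<in>Poly_Mapping.keys p. cmod (Poly_Mapping.lookup p w))"
proof -
  have "\<nu> p = \<nu> (\<Sum>w\<in>Poly_Mapping.keys p. Poly_Mapping.single w (Poly_Mapping.lookup p w))"
    using ncpoly_expand by metis
  also have "\<dots> \<le> (\<Sum>w\<in>Poly_Mapping.keys p. \<nu> (Poly_Mapping.single w (Poly_Mapping.lookup p w)))"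
    by (rule triangle_sum)
  also have "\<dots> \<le> (\<Sum>w\<in>Poly_Mapping.keys p. cmod (Poly_Mapping.lookup p w))"
  proof (intro sum_mono)
    fix w
    show "\<nu> (Poly_Mapping.single w (Poly_Mapping.lookup p w)) \<le> cmod (Poly_Mapping.lookup p w)"
      using word_norm[OF assms, of "letters w"] unfolding scaleC_single'[of w "Poly_Mapping.lookup p w"] scale
      by (simp add: mult_left_le)
  qed
  finally show ?thesis .
qed

end

definition cstar_seminorms_on :: "'g free_star_algebra set \<Rightarrow> ('g free_star_algebra \<Rightarrow> real) set"
  where "cstar_seminorms_on R = {s. cstar_seminorm s \<and> (\<forall>r\<in>R. s r = 0)}"

lemma zero_seminorm: "(\<lambda>_. 0) \<in> cstar_seminorms_on R"
  by (simp add: cstar_seminorms_on_def cstar_seminorm_def)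

text \<open>The two suprema agree term by term. An identity in the universal algebra thus becomes a
  computation in a single seminorm.\<close>

lemma universal_class_eqI:
  assumes "\<And>s. s \<in> cstar_seminorms_on R \<Longrightarrow> s (p - q) = 0"
  shows "universal_class R p = universal_class R q"
proof -
  have "s (r - p) = s (r - q)" if s: "s \<in> cstar_seminorms_on R" for s r
  proof -
    interpret cstar s using s by unfold_locales (simp add: cstar_seminorms_on_def)
    have "sim (r - p) (r - q)" using assms[OF s] by (intro sim_diff) (auto simp: sim_def)
    then show ?thesis by (rule sim_norm)
  qed
  then have "universal_norm R (r - p) = universal_norm R (r - q)" for r
    unfolding universal_norm_def cstar_seminorms_on_def[symmetric] by (rule SUP_cong[OF refl])
  then show ?thesis by (simp add: universal_class_def)
qed

text \<open>The constant sequence \<open>p\<close> lies in both classes, so the universal norm of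
  \<open>p - q\<close> is zero; each admissible seminorm is below that norm because the supremum is
  finite. This allows an identity in the universal algebra to be tested in one
  representation.\<close>

lemma universal_class_eqD:
  assumes eq: "universal_class R p = universal_class R q"
    and bound: "\<And>s g. s \<in> cstar_seminorms_on R \<Longrightarrow> s (free_gen g) \<le> 1"
    and s: "s \<in> cstar_seminorms_on R"
  shows "s (p - q) = 0"
proof -
  have s0: "t 0 = 0" if "t \<in> cstar_seminorms_on R" for t
  proof -
    interpret cstar t using that by unfold_locales (simp add: cstar_seminorms_on_def)
    show ?thesis by simp
  qed
  have "universal_norm R 0 = (SUP t\<in>cstar_seminorms_on R. 0)"
    unfolding universal_norm_def cstar_seminorms_on_def[symmetric] by (rule SUP_cong) (auto simp: s0)
  also have "\<dots> = 0" using zero_seminorm by (intro cSUP_const) auto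
  finally have "(\<lambda>_. p) \<in> universal_class R p" by (simp add: universal_class_def)
  then have "(\<lambda>_. p) \<in> universal_class R q" using eq by simp
  then have "universal_norm R (p - q) = 0"
    by (simp add: universal_class_def LIMSEQ_const_iff)
  moreover have "s (p - q) \<le> universal_norm R (p - q)"
    unfolding universal_norm_def cstar_seminorms_on_def[symmetric]
  proof (rule cSUP_upper[OF s], rule bdd_aboveI2)
    fix t assume t: "t \<in> cstar_seminorms_on R"
    interpret cstar t using t by unfold_locales (simp add: cstar_seminorms_on_def)
    show "t (p - q) \<le> (\<Sum>w\<in>Poly_Mapping.keys (p - q). cmod (Poly_Mapping.lookup (p - q) w))"
      by (rule norm_bound) (rule bound[OF t])
  qed
  moreover have "0 \<le> s (p - q)"
    using cstar.nonneg[of s] s by (simp add: cstar_def cstar_seminorms_on_def)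
  ultimately show ?thesis by linarith
qed

section \<open>The relations of \<open>M\<^sub>i(n,k)\<close> modulo an admissible seminorm\<close>

locale Mi_seminorm = cstar \<nu> for \<nu> :: "(nat \<times> nat) free_star_algebra \<Rightarrow> real" +
  fixes n k :: nat
  assumes relators: "r \<in> Mi_relators n k \<Longrightarrow> \<nu> r = 0"
begin

lemma u_outside: "i \<notin> {1..n} \<or> j \<notin> {1..k} \<Longrightarrow> Mi_u i j \<doteq> 0"
  unfolding sim_0_iff by (rule relators) (auto simp: Mi_relators_def)

lemma u_proj: "i \<in> {1..n} \<Longrightarrow> j \<in> {1..k} \<Longrightarrow> proj (Mi_u i j)"
  unfolding proj_def sim_def
  by (intro conjI; rule relators; unfold Mi_relators_def; blast)

lemma P_absorb:
  "j \<in> {1..k} \<Longrightarrow> i' \<in> {1..n} \<Longrightarrow> j' \<in> {1..k} \<Longrightarrow> j' \<le> j \<Longrightarrow> Mi_P n j * Mi_u i' j' \<doteq> Mi_u i' j'"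
  unfolding sim_def by (rule relators, unfold Mi_relators_def) blast

lemma P_absorb_P: "j \<in> {1..k} \<Longrightarrow> Mi_P n j * Mi_P n 1 \<doteq> Mi_P n 1"
  unfolding sim_def by (rule relators, unfold Mi_relators_def) blast

lemma u_increasing:
  "i \<in> {1..n} \<Longrightarrow> j \<in> {1..k} \<Longrightarrow> i' \<in> {1..n} \<Longrightarrow> j' \<in> {1..k} \<Longrightarrow> j < j' \<Longrightarrow> i' \<le> i
    \<Longrightarrow> Mi_u i j * Mi_u i' j' \<doteq> 0"
  unfolding sim_0_iff by (rule relators, unfold Mi_relators_def) blast

lemma gen_norm: "\<nu> (free_gen g) \<le> 1"
proof (cases g)
  case (Pair i j)
  show ?thesis
  proof (cases "i \<in> {1..n} \<and> j \<in> {1..k}")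
    case True
    then show ?thesis using Pair proj_norm[OF u_proj, of i j] by simp
  next
    case False
    then show ?thesis using Pair u_outside[of i j] by (auto simp: sim_0_iff)
  qed
qed

end

lemma Mi_seminormI: "s \<in> cstar_seminorms_on (Mi_relators n k) \<Longrightarrow> Mi_seminorm s n k"
  by unfold_locales (auto simp: cstar_seminorms_on_def)

lemma Mi_class_eqD:
  assumes "Mi_class n k p = Mi_class n k q" "s \<in> cstar_seminorms_on (Mi_relators n k)"
  shows "s (p - q) = 0"
  using universal_class_eqD[OF assms(1) _ assms(2)] Mi_seminorm.gen_norm[OF Mi_seminormI] by blast

text \<open>As \<open>\<omega>\<close> is a primitive root of order \<open>N + 1\<close>, the factor
  \<open>(\<omega> ^ k) ^ N\<close> is the inverse of \<open>\<omega> ^ k\<close>. The sum is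
  therefore the discrete Fourier formula that extracts the coefficient of index \<open>1\<close>
  from a polynomial of degree at most \<open>N\<close>.\<close>

lemma sum_roots_of_unity_power:
  assumes N: "N \<ge> 1" and j: "j \<le> N"
  defines "\<omega> \<equiv> exp (2 * of_real pi * \<i> / of_nat (Suc N))"
  shows "(\<Sum>k<Suc N. (\<omega> ^ k) ^ N * (\<omega> ^ k) ^ j) = (if j = 1 then of_nat (Suc N) else 0)"
proof -
  define z where "z = \<omega> ^ (N + j)"
  have pow: "\<omega> ^ m = exp (2 * of_real pi * \<i> * of_nat m / of_nat (Suc N))" for m
    by (simp add: \<omega>_def exp_of_nat_mult[symmetric] mult_ac)
  have "Suc N dvd N + j \<longleftrightarrow> j = 1"
  proof
    assume "Suc N dvd N + j"
    then obtain q where q: "N + j = Suc N * q" by blast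
    show "j = 1"
    proof (cases q)
      case 0
      then show ?thesis using q N by simp
    next
      case (Suc r)
      then have "j = 1 + Suc N * r" using q by simp
      then show ?thesis using j by (cases r) auto
    qed
  qed simp
  then have z1: "z = 1 \<longleftrightarrow> j = 1"
    unfolding z_def pow using complex_root_unity_eq_1[of "Suc N" "N + j"] by simp
  have "z ^ Suc N = (\<omega> ^ Suc N) ^ (N + j)"
    unfolding z_def by (simp only: power_mult[symmetric] mult.commute)
  also have "\<omega> ^ Suc N = 1" using complex_root_unity_eq_1[of "Suc N" "Suc N"] unfolding pow by simp
  finally have zN: "z ^ Suc N = 1" by simp
  have "(\<Sum>k<Suc N. (\<omega> ^ k) ^ N * (\<omega> ^ k) ^ j) = (\<Sum>k<Suc N. z ^ k)"
    unfolding z_def by (intro sum.cong refl) (simp add: power_add[symmetric] power_mult[symmetric] algebra_simps)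
  also have "\<dots> = (if j = 1 then of_nat (Suc N) else 0)"
  proof (cases "j = 1")
    case False
    then have "(\<Sum>k<Suc N. z ^ k) = (z ^ Suc N - 1) / (z - 1)"
      using z1 geometric_sum by blast
    then show ?thesis using zN False by simp
  qed (use z1 in simp)
  finally show ?thesis .
qed

section \<open>Extremality of the unit of a corner, and orthogonality of projections\<close>

context cstar
begin

context
  fixes e g
  assumes e: "proj e" and eg: "e * g \<doteq> g" and ge: "g * e \<doteq> g" and sa: "free_star g \<doteq> g"
    and plus: "\<nu> (e + g) \<le> 1" and minus: "\<nu> (e - g) \<le> 1"
begin

text \<open>By the C*-identity the squared norm is that of \<open>e * e + g * g\<close>, since the
  mixed terms cancel; and this element is the mean of the squares of \<open>e + g\<close> and
  \<open>e - g\<close>.\<close>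

lemma corner_unit_imaginary: "\<nu> (e + c *\<^sub>C g) \<le> 1" if c: "c = \<i> \<or> c = - \<i>"
proof -
  have "free_star (e + c *\<^sub>C g) * (e + c *\<^sub>C g) \<doteq> (e + cnj c *\<^sub>C g) * (e + c *\<^sub>C g)"
    using e sa by (intro sim_mult) (auto simp: proj_def free_star_add free_star_scaleC intro: sim_add sim_scale)
  also have "\<dots> = e * e + (c *\<^sub>C (e * g) + cnj c *\<^sub>C (g * e)) + g * g"
    using c by (auto simp: algebra_simps mult_scaleC_left mult_scaleC_right scaleC_scaleC scaleC_one
          scaleC_add_right)
  also have "\<dots> \<doteq> e * e + (c *\<^sub>C g + cnj c *\<^sub>C g) + g * g"
    by (intro sim_add sim_scale eg ge sim_refl)
  also have "\<dots> = (1/2) *\<^sub>C ((e + g) * (e + g)) + (1/2) *\<^sub>C ((e - g) * (e - g))"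
  proof -
    have "(1/2) *\<^sub>C x + (1/2) *\<^sub>C x = x" for x :: "'g free_star_algebra"
      by (simp add: scaleC_one flip: scaleC_add_left)
    then have "(1/2) *\<^sub>C ((e + g) * (e + g)) + (1/2) *\<^sub>C ((e - g) * (e - g)) = e * e + g * g"
      by (simp add: algebra_simps scaleC_add_right scaleC_diff_right)
    moreover have "c *\<^sub>C g + cnj c *\<^sub>C g = 0"
      using c by (auto simp flip: scaleC_add_left)
    ultimately show ?thesis by simp
  qed
  finally have "\<nu> (free_star (e + c *\<^sub>C g) * (e + c *\<^sub>C g)) =
      \<nu> ((1/2) *\<^sub>C ((e + g) * (e + g)) + (1/2) *\<^sub>C ((e - g) * (e - g)))"
    by (rule sim_norm)
  also have "\<dots> \<le> 1/2 * (\<nu> (e + g) * \<nu> (e + g)) + 1/2 * (\<nu> (e - g) * \<nu> (e - g))"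
    using submult[of "e + g" "e + g"] submult[of "e - g" "e - g"]
    by (intro order_trans[OF triangle]) (simp add: scale norm_divide)
  also have "\<dots> \<le> 1/2 * (1 * 1) + 1/2 * (1 * 1)"
    using plus minus by (intro add_mono mult_left_mono mult_mono) auto
  finally have "(\<nu> (e + c *\<^sub>C g))\<^sup>2 \<le> 1\<^sup>2" by (simp add: cstar)
  then show ?thesis by (rule power2_le_imp_le) simp
qed

text \<open>The condition describes the square with corners \<open>1\<close>, \<open>- 1\<close>,
  \<open>\<i>\<close> and \<open>- \<i>\<close>. On it \<open>e + z *\<^sub>C g\<close> is a convex
  combination of \<open>e\<close> and of its values at two neighbouring corners.\<close>

lemma corner_unit_disc: "\<nu> (e + z *\<^sub>C g) \<le> 1" if z: "\<bar>Re z\<bar> + \<bar>Im z\<bar> \<le> 1"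
proof -
  let ?a = "\<bar>Re z\<bar>" and ?b = "\<bar>Im z\<bar>"
  define s :: complex where "s = (if Re z \<ge> 0 then 1 else - 1)"
  define t where "t = (if Im z \<ge> 0 then \<i> else - \<i>)"
  have zst: "z = of_real ?a * s + of_real ?b * t"
    by (simp add: s_def t_def complex_eq_iff)
  have "e + z *\<^sub>C g = of_real (1 - ?a - ?b) *\<^sub>C e + (of_real ?a *\<^sub>C (e + s *\<^sub>C g) + of_real ?b *\<^sub>C (e + t *\<^sub>C g))"
  proof -
    have "of_real (1 - ?a - ?b) *\<^sub>C e + (of_real ?a *\<^sub>C (e + s *\<^sub>C g) + of_real ?b *\<^sub>C (e + t *\<^sub>C g)) =
        (of_real (1 - ?a - ?b) + of_real ?a + of_real ?b) *\<^sub>C e + (of_real ?a * s + of_real ?b * t) *\<^sub>C g"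
      by (simp only: scaleC_add_right scaleC_add_left scaleC_scaleC add_ac)
    also have "(of_real (1 - ?a - ?b) + of_real ?a + of_real ?b :: complex) = 1" by simp
    finally show ?thesis by (simp only: zst[symmetric] scaleC_one)
  qed
  then have "\<nu> (e + z *\<^sub>C g) \<le> (1 - ?a - ?b) * \<nu> e + (?a * \<nu> (e + s *\<^sub>C g) + ?b * \<nu> (e + t *\<^sub>C g))"
  proof (simp only:, intro order_trans[OF triangle] add_mono)
    show "\<nu> (of_real (1 - ?a - ?b) *\<^sub>C e) \<le> (1 - ?a - ?b) * \<nu> e"
      unfolding scale norm_of_real using z by simp
  qed (simp_all add: scale)
  also have "\<dots> \<le> (1 - ?a - ?b) * 1 + (?a * 1 + ?b * 1)"
    using z proj_norm[OF e] corner_unit_imaginary[of t] plus minus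
    by (intro add_mono mult_left_mono) (auto simp: s_def t_def scaleC_one)
  finally show ?thesis by simp
qed

text \<open>Powers are taken in the corner, whose unit is \<open>e\<close> and not \<open>1\<close>;
  hence the zeroth power is \<open>e\<close>.\<close>

primrec corner_power where
  "corner_power 0 = e"
| "corner_power (Suc j) = corner_power j * g"

primrec corner_binomial where
  "corner_binomial z 0 = e"
| "corner_binomial z (Suc N) = corner_binomial z N * (e + z *\<^sub>C g)"

lemma corner_power_unit: "corner_power j * e \<doteq> corner_power j"
proof (cases j)
  case (Suc i)
  then show ?thesis
    using sim_mult[OF sim_refl ge, of "corner_power i"] by (simp add: mult.assoc)
qed (use e in \<open>simp add: proj_def\<close>)

lemma corner_binomial_expand:
  "corner_binomial z N \<doteq> (\<Sum>j\<le>N. (of_nat (N choose j) * z ^ j) *\<^sub>C corner_power j)"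
proof (induction N)
  case (Suc N)
  let ?c = "\<lambda>N j. of_nat (N choose j) * z ^ j"
  have "corner_binomial z (Suc N) \<doteq> (\<Sum>j\<le>N. ?c N j *\<^sub>C corner_power j) * (e + z *\<^sub>C g)"
    using Suc by (auto intro: sim_mult)
  also have "\<dots> = (\<Sum>j\<le>N. ?c N j *\<^sub>C (corner_power j * e)) + (\<Sum>j\<le>N. (?c N j * z) *\<^sub>C corner_power (Suc j))"
    by (simp add: distrib_left sum_distrib_right mult_scaleC_left mult_scaleC_right
          scaleC_scaleC scaleC_sum_right mult_ac)
  also have "\<dots> \<doteq> (\<Sum>j\<le>N. ?c N j *\<^sub>C corner_power j) + (\<Sum>j\<le>N. (?c N j * z) *\<^sub>C corner_power (Suc j))"
    by (intro sim_add sim_sum sim_scale corner_power_unit sim_refl)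
  also have "\<dots> = (\<Sum>j\<le>Suc N. ?c (Suc N) j *\<^sub>C corner_power j)"
  proof -
    have "(\<Sum>j\<le>Suc N. ?c (Suc N) j *\<^sub>C corner_power j) = corner_power 0 +
        (\<Sum>j\<le>N. ?c (Suc N) (Suc j) *\<^sub>C corner_power (Suc j))"
      by (subst sum.atMost_Suc_shift) (simp add: scaleC_one)
    also have "(\<Sum>j\<le>N. ?c (Suc N) (Suc j) *\<^sub>C corner_power (Suc j)) =
        (\<Sum>j\<le>N. (?c N j * z) *\<^sub>C corner_power (Suc j)) + (\<Sum>j\<le>N. ?c N (Suc j) *\<^sub>C corner_power (Suc j))"
      by (simp only: sum.distrib[symmetric])
        (intro sum.cong refl, simp add: scaleC_add_left[symmetric] algebra_simps)
    also have "corner_power 0 + ((\<Sum>j\<le>N. (?c N j * z) *\<^sub>C corner_power (Suc j)) +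
        (\<Sum>j\<le>N. ?c N (Suc j) *\<^sub>C corner_power (Suc j))) =
        (\<Sum>j\<le>N. (?c N j * z) *\<^sub>C corner_power (Suc j)) + (\<Sum>j\<le>Suc N. ?c N j *\<^sub>C corner_power j)"
      using sum.atMost_Suc_shift[of "\<lambda>j. ?c N j *\<^sub>C corner_power j" N]
      by (simp add: scaleC_one add_ac del: sum.atMost_Suc)
    also have "(\<Sum>j\<le>Suc N. ?c N j *\<^sub>C corner_power j) = (\<Sum>j\<le>N. ?c N j *\<^sub>C corner_power j)"
      by (simp add: binomial_eq_0)
    finally show ?thesis by (simp only: add.commute)
  qed
  finally show ?case .
qed (simp add: scaleC_one)

lemma corner_binomial_norm:
  assumes "\<bar>Re z\<bar> + \<bar>Im z\<bar> \<le> 1" shows "\<nu> (corner_binomial z N) \<le> 1"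
proof (induction N)
  case (Suc N)
  have "\<nu> (corner_binomial z N) * \<nu> (e + z *\<^sub>C g) \<le> 1 * 1"
    using Suc corner_unit_disc[OF assms] by (intro mult_mono) auto
  then show ?case using submult[of "corner_binomial z N" "e + z *\<^sub>C g"] by simp
qed (use proj_norm[OF e] in simp)

text \<open>
  The unit is an extreme point of the unit ball: a Cauchy estimate for the coefficient of \<open>z\<close> in
  \<open>(e + z g)\<^sup>N\<close>, extracted exactly by averaging over roots of unity, gives \<open>N \<parallel>g\<parallel> \<le> 2\<close> for all \<open>N\<close>.
\<close>

lemma corner_unit_extreme: "g \<doteq> 0"
proof -
  have bound: "real N * \<nu> g \<le> 2" if N: "N \<ge> 1" for N
  proof -
    define \<omega> where "\<omega> = exp (2 * of_real pi * \<i> / of_nat (Suc N))"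
    have "\<omega> = cis (2 * pi / real (Suc N))"
      unfolding \<omega>_def cis_conv_exp by (simp add: mult_ac)
    then have norm\<omega>: "cmod (\<omega> ^ k) = 1" for k
      by (simp add: norm_power)
    \<comment> \<open>Averaging over points of modulus \<open>1/2\<close> stays inside the square on
      which the norm bound holds. This radius is the origin of the constant
      \<open>2\<close>.\<close>
    let ?S = "\<Sum>k<Suc N. ((\<omega> ^ k) ^ N) *\<^sub>C corner_binomial (\<omega> ^ k / 2) N"
    have "?S \<doteq> (\<Sum>k<Suc N. ((\<omega> ^ k) ^ N) *\<^sub>C (\<Sum>j\<le>N. (of_nat (N choose j) * (\<omega> ^ k / 2) ^ j) *\<^sub>C corner_power j))"
      by (intro sim_sum sim_scale corner_binomial_expand)
    also have "\<dots> = (\<Sum>k<Suc N. \<Sum>j\<le>N. (of_nat (N choose j) / 2 ^ j * ((\<omega> ^ k) ^ N * (\<omega> ^ k) ^ j)) *\<^sub>C corner_power j)"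
      by (simp add: scaleC_sum_right scaleC_scaleC power_divide mult_ac)
    also have "\<dots> = (\<Sum>j\<le>N. \<Sum>k<Suc N. (of_nat (N choose j) / 2 ^ j * ((\<omega> ^ k) ^ N * (\<omega> ^ k) ^ j)) *\<^sub>C corner_power j)"
      by (rule sum.swap)
    also have "\<dots> = (\<Sum>j\<le>N. (of_nat (N choose j) / 2 ^ j * (if j = 1 then of_nat (Suc N) else 0)) *\<^sub>C corner_power j)"
    proof (intro sum.cong refl)
      fix j assume "j \<in> {..N}"
      have "(\<Sum>k\<in>K. f k *\<^sub>C corner_power j) = (\<Sum>k\<in>K. f k) *\<^sub>C corner_power j" for K and f :: "nat \<Rightarrow> complex"
        by (induction K rule: infinite_finite_induct) (simp_all add: scaleC_add_left)
      then show "(\<Sum>k<Suc N. (of_nat (N choose j) / 2 ^ j * ((\<omega> ^ k) ^ N * (\<omega> ^ k) ^ j)) *\<^sub>C corner_power j) =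
          (of_nat (N choose j) / 2 ^ j * (if j = 1 then of_nat (Suc N) else 0)) *\<^sub>C corner_power j"
        using sum_roots_of_unity_power[OF N, of j] \<open>j \<in> {..N}\<close>
        by (simp only: sum_distrib_left[symmetric] \<omega>_def atMost_iff)
    qed
    also have "\<dots> = (\<Sum>j\<in>{1}. (of_nat (N choose j) / 2 ^ j * (if j = 1 then of_nat (Suc N) else 0)) *\<^sub>C corner_power j)"
      using N by (intro sum.mono_neutral_right) auto
    also have "\<dots> = (of_nat N / 2 * of_nat (Suc N)) *\<^sub>C (e * g)" by simp
    also have "\<dots> \<doteq> (of_nat N / 2 * of_nat (Suc N)) *\<^sub>C g" by (intro sim_scale eg)
    finally have "\<nu> ?S = \<nu> ((of_nat N / 2 * of_nat (Suc N)) *\<^sub>C g)" by (rule sim_norm)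
    also have "\<dots> = cmod (of_nat N / 2 * of_nat (Suc N)) * \<nu> g" by (rule scale)
    also have "cmod (of_nat N / 2 * of_nat (Suc N)) = real N / 2 * real (Suc N)"
      by (simp add: norm_mult norm_divide del: of_nat_Suc)
    finally have "real N / 2 * real (Suc N) * \<nu> g = \<nu> ?S" by simp
    also have "\<dots> \<le> (\<Sum>k<Suc N. \<nu> (((\<omega> ^ k) ^ N) *\<^sub>C corner_binomial (\<omega> ^ k / 2) N))"
      by (rule triangle_sum)
    also have "\<dots> \<le> (\<Sum>k<Suc N. 1)"
    proof (intro sum_mono)
      fix k
      have "\<bar>Re (\<omega> ^ k / 2)\<bar> + \<bar>Im (\<omega> ^ k / 2)\<bar> \<le> 1"
        using abs_Re_le_cmod[of "\<omega> ^ k / 2"] abs_Im_le_cmod[of "\<omega> ^ k / 2"] norm\<omega>[of k]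
        by (simp add: norm_divide)
      then show "\<nu> (((\<omega> ^ k) ^ N) *\<^sub>C corner_binomial (\<omega> ^ k / 2) N) \<le> 1"
        using corner_binomial_norm norm\<omega>[of k] by (simp add: scale norm_power)
    qed
    finally have "real (Suc N) * (real N / 2 * \<nu> g) \<le> real (Suc N) * 1" by (simp add: mult_ac)
    then have "real N / 2 * \<nu> g \<le> 1" by (rule mult_left_le_imp_le) simp
    then show ?thesis by simp
  qed
  have "\<nu> g \<le> 0"
  proof (rule ccontr)
    assume "\<not> \<nu> g \<le> 0"
    then obtain N where "2 < real N * \<nu> g" using reals_Archimedean3[of "\<nu> g"] by auto
    moreover from this have "N \<ge> 1" by (cases N) auto
    ultimately show False using bound[of N] by simp
  qed
  then show ?thesis using nonneg[of g] by (simp add: sim_0_iff)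
qed

end

text \<open>Compressed by \<open>e = p a\<close>, the projections add up to \<open>e\<close>, and
  \<open>p a\<close> alone already contributes \<open>e\<close>, so the remaining compressions add
  up to zero. Positivity would make each of them vanish. Instead, a small multiple of
  \<open>X b\<close> is shown to satisfy the hypotheses of the extremality of \<open>e\<close>; the
  C*-identity then leads from \<open>X b\<close> to \<open>p b * e\<close>.\<close>

lemma projections_orthogonal:
  assumes I: "finite I" and pr: "\<And>i. i \<in> I \<Longrightarrow> proj (p i)"
    and absorb: "\<And>i. i \<in> I \<Longrightarrow> sum p I * p i \<doteq> p i"
    and ab: "a \<in> I" "b \<in> I" "a \<noteq> b"
  shows "p b * p a \<doteq> 0"
proof -
  define e where "e = p a"
  define X where "X i = e * p i * e" for i
  have e: "proj e" "free_star e \<doteq> e" "e * e \<doteq> e" using pr[OF ab(1)] by (auto simp: e_def proj_def)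
  have eX: "e * X i \<doteq> X i" for i
    using sim_mult[OF e(3), of "p i * e" "p i * e"] by (simp add: X_def mult.assoc)
  have Xe: "X i * e \<doteq> X i" for i
    using sim_mult[OF _ e(3), of "e * p i" "e * p i"] by (simp add: X_def mult.assoc)
  have X_star: "free_star (X i) \<doteq> X i" if "i \<in> I" for i
  proof -
    have "free_star (X i) = free_star e * (free_star (p i) * free_star e)"
      by (simp add: X_def free_star_mult)
    also have "\<dots> \<doteq> e * (p i * e)"
      using pr[OF that] by (intro sim_mult e) (simp add: proj_def)
    finally show ?thesis by (simp add: X_def mult.assoc)
  qed
  have norm_eX: "\<nu> (e - X i) \<le> 1" if "i \<in> I" for i
  proof -
    have "e - X i \<doteq> e * e - X i" by (intro sim_diff sim_sym[OF e(3)] sim_refl)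
    also have "e * e - X i = e * (1 - p i) * e" by (simp add: X_def algebra_simps)
    finally have "\<nu> (e - X i) = \<nu> (e * (1 - p i) * e)" by (rule sim_norm)
    also have "\<dots> \<le> \<nu> e * \<nu> (1 - p i) * \<nu> e"
      by (intro order_trans[OF submult] mult_right_mono submult) simp
    also have "\<dots> \<le> 1 * 1 * 1"
      using proj_norm[OF e(1)] proj_norm[OF proj_compl[OF pr[OF that]]] by (intro mult_mono) auto
    finally show ?thesis by simp
  qed
  define T where "T = I - {a, b}"
  have I_split: "I = insert a (insert b T)" "finite T" "a \<notin> insert b T" "b \<notin> T"
    using ab I by (auto simp: T_def)
  have sumX: "X b + sum X T \<doteq> 0"
  proof -
    have "X a + (X b + sum X T) = sum X I"
      using I_split by (simp add: sum.insert)
    also have "sum X I = e * (sum p I * p a)"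
      by (simp add: X_def sum_distrib_left sum_distrib_right e_def mult.assoc)
    finally have "X b + sum X T = e * (sum p I * p a) - X a" by (simp add: algebra_simps)
    also have "\<dots> \<doteq> e * p a - e" 
    proof (intro sim_diff sim_mult sim_refl absorb ab)
      have "X a \<doteq> e * e" unfolding X_def using e(3) by (auto simp: e_def intro: sim_mult)
      then show "X a \<doteq> e" using e(3) sim_trans by blast
    qed
    also have "\<dots> \<doteq> e - e" using e(3) by (intro sim_diff sim_refl) (simp add: e_def)
    finally show ?thesis by simp
  qed
  \<comment> \<open>Modulo the seminorm, \<open>r\<close> times \<open>e\<close> plus
    \<open>X b\<close> equals \<open>e\<close> plus the \<open>card T\<close> elements
    \<open>e - X i\<close>, each of norm at most one, so its norm is at most \<open>r\<close>. On
    the other side \<open>e - g\<close> is a convex combination of \<open>e\<close> and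
    \<open>e - X b\<close>.\<close>
  define r where "r = real (card T + 1)"
  have r: "r \<ge> 1" by (simp add: r_def)
  define g where "g = of_real (1 / r) *\<^sub>C X b"
  have "g \<doteq> 0"
  proof (rule corner_unit_extreme[OF e(1)])
    show "e * g \<doteq> g" "g * e \<doteq> g"
      by (auto simp: g_def mult_scaleC_left mult_scaleC_right intro: sim_scale eX Xe)
    show "free_star g \<doteq> g" using X_star[OF ab(2)] by (auto simp: g_def free_star_scaleC intro: sim_scale)
    have cardT: "(\<Sum>i\<in>T. e) = of_real (real (card T)) *\<^sub>C e"
      using I_split(2) by (induction T) (simp_all add: scaleC_add_left scaleC_one del: sum_constant)
    have r_inv: "of_real (1 / r) *\<^sub>C of_real r *\<^sub>C e = e"
      using r by (simp add: scaleC_scaleC scaleC_one)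
    have eq: "of_real r *\<^sub>C e + X b \<doteq> e + (\<Sum>i\<in>T. e - X i)"
    proof -
      have "of_real r *\<^sub>C e + X b = e + (of_real (real (card T)) *\<^sub>C e - sum X T) + (X b + sum X T)"
        by (simp add: r_def scaleC_add_left scaleC_one)
      also have "\<dots> \<doteq> e + (of_real (real (card T)) *\<^sub>C e - sum X T) + 0"
        by (intro sim_add sim_refl sumX)
      finally show ?thesis by (simp add: sum_subtractf cardT del: sum_constant)
    qed
    have "\<nu> (e + g) = \<nu> (of_real (1 / r) *\<^sub>C (of_real r *\<^sub>C e + X b))"
      by (simp only: g_def scaleC_add_right r_inv)
    also have "\<dots> = (1 / r) * \<nu> (e + (\<Sum>i\<in>T. e - X i))"
      unfolding scale sim_norm[OF eq] norm_of_real using r by simp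
    also have "\<dots> \<le> (1 / r) * (1 + (\<Sum>i\<in>T. 1))"
    proof (intro mult_left_mono order_trans[OF triangle] add_mono)
      show "\<nu> (\<Sum>i\<in>T. e - X i) \<le> (\<Sum>i\<in>T. 1)"
        using norm_eX by (intro order_trans[OF triangle_sum] sum_mono) (auto simp: T_def)
    qed (use r proj_norm[OF e(1)] in auto)
    also have "\<dots> = 1" using r by (simp add: r_def)
    finally show "\<nu> (e + g) \<le> 1" .
    have "e - g = of_real (1 - 1 / r) *\<^sub>C e + of_real (1 / r) *\<^sub>C (e - X b)"
    proof -
      have "of_real (1 - 1 / r) *\<^sub>C e + of_real (1 / r) *\<^sub>C (e - X b) =
          (of_real (1 - 1 / r) + of_real (1 / r)) *\<^sub>C e - g"
        by (simp only: g_def scaleC_diff_right scaleC_add_left add_diff_eq)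
      also have "(of_real (1 - 1 / r) + of_real (1 / r) :: complex) = 1" by simp
      finally show ?thesis by (simp add: scaleC_one)
    qed
    then have "\<nu> (e - g) \<le> cmod (of_real (1 - 1 / r)) * \<nu> e + cmod (of_real (1 / r)) * \<nu> (e - X b)"
      using triangle[of "of_real (1 - 1 / r) *\<^sub>C e" "of_real (1 / r) *\<^sub>C (e - X b)"]
      by (simp only: scale)
    also have "\<dots> \<le> (1 - 1 / r) * 1 + (1 / r) * 1"
    proof (intro add_mono mult_mono)
      have "1 / r \<le> 1" using r by simp
      then show "cmod (of_real (1 - 1 / r)) \<le> 1 - 1 / r" "0 \<le> 1 - 1 / r"
        by (simp_all only: norm_of_real abs_of_nonneg diff_ge_0_iff_ge order_refl)
    qed (use r proj_norm[OF e(1)] norm_eX[OF ab(2)] in \<open>auto simp: norm_divide\<close>)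
    finally show "\<nu> (e - g) \<le> 1" by simp
  qed
  then have "\<nu> (X b) = 0" using r by (simp add: g_def sim_0_iff scale)
  moreover have "free_star (p b * e) * (p b * e) \<doteq> X b"
  proof -
    have "free_star (p b * e) * (p b * e) = free_star e * ((free_star (p b) * p b) * e)"
      by (simp add: free_star_mult mult.assoc)
    also have "\<dots> \<doteq> e * ((p b * p b) * e)"
      using pr[OF ab(2)] by (intro sim_mult e sim_refl) (simp add: proj_def)
    also have "\<dots> \<doteq> e * (p b * e)"
      using pr[OF ab(2)] by (intro sim_mult sim_refl) (simp add: proj_def)
    finally show ?thesis by (simp add: X_def mult.assoc)
  qed
  then have "(\<nu> (p b * e))\<^sup>2 = \<nu> (X b)" using cstar sim_norm by metis
  ultimately show ?thesis by (simp add: sim_0_iff e_def)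
qed

end

section \<open>Products of generators that vanish or collapse\<close>

lemma word_product_simps [simp]:
  "word_product [] [] = 1" "word_product (i # is) (j # js) = Mi_u i j * word_product is js"
  by (simp_all add: word_product_def)

lemma word_product_append:
  "length is = length js \<Longrightarrow> word_product (is @ is') (js @ js') = word_product is js * word_product is' js'"
  by (simp add: word_product_def)

context Mi_seminorm
begin

lemma u_orthogonal:
  assumes "i \<in> {1..n}" "i' \<in> {1..n}" "i \<noteq> i'" "j \<in> {1..k}"
  shows "Mi_u i j * Mi_u i' j \<doteq> 0"
  using assms u_proj P_absorb
  by (intro projections_orthogonal[of "{1..n}" "\<lambda>i. Mi_u i j"]) (auto simp: Mi_P_def)

lemma u_decreasing:
  assumes ij: "i \<in> {1..n}" "j \<in> {1..k}" "i' \<in> {1..n}" "j' \<in> {1..k}" and less: "j < j'" "i' \<le> i"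
  shows "Mi_u i' j' * Mi_u i j \<doteq> 0"
proof -
  have "Mi_u i' j' * Mi_u i j \<doteq> free_star (Mi_u i' j') * free_star (Mi_u i j)"
    using u_proj[of i j] u_proj[of i' j'] ij by (intro sim_mult sim_sym[of "free_star _"]) (auto simp: proj_def)
  also have "\<dots> = free_star (Mi_u i j * Mi_u i' j')" by (simp add: free_star_mult)
  also have "\<dots> \<doteq> free_star 0" by (intro sim_star u_increasing assms)
  finally show ?thesis by simp
qed

text \<open>Within one column different rows are orthogonal, so only constant tuples of row indices
  survive, and a product of \<open>r\<close> equal projections is that projection. An empty run
  would give a multiple of \<open>1\<close> instead.\<close>

lemma sum_run:
  assumes r: "r \<ge> 1" and J: "J \<in> {1..k}"
  shows "(\<Sum>is\<in>index_lists n r. g is *\<^sub>C word_product is (replicate r J)) \<doteq>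
    (\<Sum>i=1..n. g (replicate r i) *\<^sub>C Mi_u i J)"
  using r
proof (induction r arbitrary: g rule: nat_induct_at_least)
  case base
  then show ?case by (simp add: sum_index_lists_1)
next
  case (Suc r)
  have "(\<Sum>is\<in>index_lists n (Suc r). g is *\<^sub>C word_product is (replicate (Suc r) J)) =
      (\<Sum>i=1..n. Mi_u i J * (\<Sum>is\<in>index_lists n r. g (i # is) *\<^sub>C word_product is (replicate r J)))"
    by (simp add: sum_index_lists_Suc sum_distrib_left mult_scaleC_right)
  also have "\<dots> \<doteq> (\<Sum>i=1..n. Mi_u i J * (\<Sum>i'=1..n. g (i # replicate r i') *\<^sub>C Mi_u i' J))"
    by (intro sim_sum sim_mult sim_refl Suc.IH)
  also have "\<dots> \<doteq> (\<Sum>i=1..n. g (replicate (Suc r) i) *\<^sub>C Mi_u i J)"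
  proof (intro sim_sum)
    fix i assume i: "i \<in> {1..n}"
    have "Mi_u i J * (\<Sum>i'=1..n. g (i # replicate r i') *\<^sub>C Mi_u i' J) =
        (\<Sum>i'=1..n. g (i # replicate r i') *\<^sub>C (Mi_u i J * Mi_u i' J))"
      by (simp add: sum_distrib_left mult_scaleC_right)
    also have "\<dots> \<doteq> (\<Sum>i'=1..n. if i' = i then g (i # replicate r i) *\<^sub>C Mi_u i J else 0)"
    proof (intro sim_sum)
      fix i' assume i': "i' \<in> {1..n}"
      show "g (i # replicate r i') *\<^sub>C (Mi_u i J * Mi_u i' J) \<doteq>
          (if i' = i then g (i # replicate r i) *\<^sub>C Mi_u i J else 0)"
      proof (cases "i' = i")
        case True
        then show ?thesis using u_proj[OF i J] by (auto simp: proj_def intro: sim_scale)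
      next
        case False
        then show ?thesis using sim_scale[OF u_orthogonal[OF i i' _ J], of "g (i # replicate r i')"] by simp
      qed
    qed
    also have "\<dots> = g (replicate (Suc r) i) *\<^sub>C Mi_u i J" using i by simp
    finally show "Mi_u i J * (\<Sum>i'=1..n. g (i # replicate r i') *\<^sub>C Mi_u i' J) \<doteq>
        g (replicate (Suc r) i) *\<^sub>C Mi_u i J" .
  qed
  finally show ?case .
qed

text \<open>A step to a larger column forces a strictly larger row. This, with its mirror image
  below, removes the tuples of rows in which a run of the largest column would fail to be a
  peak.\<close>

lemma word_product_last_zero:
  assumes "is \<noteq> []" "length is = length js" "set is \<subseteq> {1..n}" "set js \<subseteq> {1..k}" "last js < J" "J \<in> {1..k}"
    "i \<in> {1..n}" "i \<le> last is"
  shows "word_product is js * Mi_u i J \<doteq> 0"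
proof -
  have js: "js \<noteq> []" using assms by auto
  have "word_product is js = word_product (butlast is @ [last is]) (butlast js @ [last js])"
    using assms js by simp
  also have "\<dots> = word_product (butlast is) (butlast js) * Mi_u (last is) (last js)"
    by (subst word_product_append) (use assms in simp_all)
  finally have "word_product is js * Mi_u i J =
      word_product (butlast is) (butlast js) * (Mi_u (last is) (last js) * Mi_u i J)"
    by (simp add: mult.assoc)
  also have "\<dots> \<doteq> word_product (butlast is) (butlast js) * 0"
    using assms js last_in_set[of "is"] last_in_set[of js]
    by (intro sim_mult sim_refl u_increasing) (blast | simp)+
  finally show ?thesis by simp
qed

lemma word_product_first_zero:
  assumes "is \<noteq> []" "length is = length js" "set is \<subseteq> {1..n}" "set js \<subseteq> {1..k}" "hd js < J" "J \<in> {1..k}"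
    "i \<in> {1..n}" "i \<le> hd is"
  shows "Mi_u i J * word_product is js \<doteq> 0"
proof -
  obtain i' is' where is': "is = i' # is'" using assms by (cases "is") auto
  obtain j' js' where js': "js = j' # js'" using assms by (cases js) auto
  have "Mi_u i J * word_product is js = Mi_u i J * Mi_u i' j' * word_product is' js'"
    by (simp add: is' js' mult.assoc)
  also have "\<dots> \<doteq> 0 * word_product is' js'"
    using assms is' js' by (intro sim_mult sim_refl u_decreasing) simp_all
  finally show ?thesis by simp
qed

text \<open>
  Algebraic core of the implication from independence to invariance: \<open>W cs is\<close> stands for the
  moment of the word with letters \<open>is\<close> and coefficients \<open>cs\<close>, and a run of equal letters that is
  larger than its neighbours may be replaced by a coefficient not depending on that letter.
\<close>

lemma invariance_from_collapse:
  fixes W :: "'c list \<Rightarrow> nat list \<Rightarrow> complex"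
  assumes k: "1 \<le> k" "k \<le> n"
    and collapse: "\<And>cs is1 r i is2. set cs \<subseteq> C \<Longrightarrow> length cs = Suc (length is1 + r + length is2) \<Longrightarrow> r \<ge> 1 \<Longrightarrow>
      set is1 \<subseteq> {1..n} \<Longrightarrow> set is2 \<subseteq> {1..n} \<Longrightarrow> i \<in> {1..n} \<Longrightarrow>
      (is1 \<noteq> [] \<Longrightarrow> last is1 < i) \<Longrightarrow> (is2 \<noteq> [] \<Longrightarrow> hd is2 < i) \<Longrightarrow>
      W cs (is1 @ replicate r i @ is2) = W (clps (length is1) r cs) (is1 @ is2)"
    and clps: "\<And>a r cs. set cs \<subseteq> C \<Longrightarrow> a + r < length cs \<Longrightarrow> r \<ge> 1 \<Longrightarrow> set (clps a r cs) \<subseteq> C"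
      "\<And>a r cs. a + r < length cs \<Longrightarrow> length (clps a r cs) = length cs - r"
  shows "set js \<subseteq> {1..k} \<Longrightarrow> set cs \<subseteq> C \<Longrightarrow> length cs = Suc (length js) \<Longrightarrow>
    (\<Sum>is\<in>index_lists n (length js). W cs is *\<^sub>C (Mi_P n 1 * word_product is js * Mi_P n 1)) \<doteq>
      W cs js *\<^sub>C Mi_P n 1"
proof (induction "length js" arbitrary: js cs rule: less_induct)
  case less
  let ?P = "Mi_P n 1"
  show ?case
  proof (cases "js = []")
    case True
    then show ?thesis using P_absorb_P[of 1] k by (auto intro: sim_scale)
  next
    case False
    \<comment> \<open>The first run of the largest column is singled out. Its neighbours are
      strictly smaller columns, as needed both for the vanishing products and for the absorption of
      \<open>Mi_P n J\<close>.\<close>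
    define J where "J = Max (set js)"
    have J: "J \<in> set js" and Jmax: "\<And>j. j \<in> set js \<Longrightarrow> j \<le> J"
      using False by (auto simp: J_def)
    obtain js1 zs where js1: "js = js1 @ J # zs" "J \<notin> set js1"
      using split_list_first[OF J] by blast
    define r where "r = Suc (length (takeWhile (\<lambda>j. j = J) zs))"
    define js2 where "js2 = dropWhile (\<lambda>j. j = J) zs"
    have "takeWhile (\<lambda>j. j = J) zs = replicate (r - 1) J"
      by (intro replicate_eqI) (auto simp: r_def dest: set_takeWhileD)
    then have zs: "zs = replicate (r - 1) J @ js2"
      using takeWhile_dropWhile_id[of "\<lambda>j. j = J" zs] by (simp add: js2_def)
    then have js: "js = js1 @ replicate r J @ js2"
      using js1(1) by (simp add: r_def)
    have r: "r \<ge> 1" by (simp add: r_def)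
    have Jk: "J \<in> {1..k}" using J less.prems(1) by blast
    have js12: "set js1 \<subseteq> {1..k}" "set js2 \<subseteq> {1..k}" using less.prems(1) js by auto
    have js1_less: "last js1 < J" if "js1 \<noteq> []"
      using js1 that Jmax[of "last js1"] by (metis Un_iff last_in_set le_neq_implies_less set_append)
    have js2_less: "hd js2 < J" if "js2 \<noteq> []"
    proof -
      have "hd js2 \<noteq> J" using hd_dropWhile[of "\<lambda>j. j = J" zs] that by (simp add: js2_def)
      moreover have "hd js2 \<in> set js" using that js by simp
      ultimately show ?thesis using Jmax[of "hd js2"] by simp
    qed
    define cs' where "cs' = clps (length js1) r cs"
    have len: "length cs = Suc (length js1 + r + length js2)"
      using less.prems(3) js by simp
    have cs': "set cs' \<subseteq> C" "length cs' = Suc (length (js1 @ js2))"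
      using clps(1)[of cs "length js1" r] clps(2)[of "length js1" r cs] less.prems(2) len r
      by (auto simp: cs'_def)
    have step: "(\<Sum>m\<in>index_lists n r. W cs (is1 @ m @ is2) *\<^sub>C
          (?P * word_product (is1 @ m @ is2) js * ?P)) \<doteq>
        W cs' (is1 @ is2) *\<^sub>C (?P * word_product (is1 @ is2) (js1 @ js2) * ?P)"
      if is1: "is1 \<in> index_lists n (length js1)" and is2: "is2 \<in> index_lists n (length js2)" for is1 is2
    proof -
      let ?L = "?P * word_product is1 js1" and ?R = "word_product is2 js2 * ?P"
      have "(\<Sum>m\<in>index_lists n r. W cs (is1 @ m @ is2) *\<^sub>C (?P * word_product (is1 @ m @ is2) js * ?P)) =
          (\<Sum>m\<in>index_lists n r. W cs (is1 @ m @ is2) *\<^sub>C (?L * (word_product m (replicate r J) * ?R)))"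
        using is1 by (intro sum.cong refl) (simp add: js word_product_append index_lists_def mult.assoc)
      also have "\<dots> = ?L * ((\<Sum>m\<in>index_lists n r. W cs (is1 @ m @ is2) *\<^sub>C word_product m (replicate r J)) * ?R)"
        by (simp add: sum_distrib_left sum_distrib_right mult_scaleC_left mult_scaleC_right mult.assoc)
      also have "\<dots> \<doteq> ?L * ((\<Sum>i=1..n. W cs (is1 @ replicate r i @ is2) *\<^sub>C Mi_u i J) * ?R)"
        by (intro sim_mult sim_refl sum_run r Jk)
      also have "\<dots> = (\<Sum>i=1..n. W cs (is1 @ replicate r i @ is2) *\<^sub>C (?L * (Mi_u i J * ?R)))"
        by (simp add: sum_distrib_left sum_distrib_right mult_scaleC_left mult_scaleC_right mult.assoc)
      also have "\<dots> \<doteq> (\<Sum>i=1..n. W cs' (is1 @ is2) *\<^sub>C (?L * (Mi_u i J * ?R)))"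
      proof (intro sim_sum)
        fix i assume i: "i \<in> {1..n}"
        \<comment> \<open>If \<open>i\<close> is not a peak, the product of generators vanishes and
          both sides are zero. So the replacement is valid for every \<open>i\<close>, and the free
          sum over \<open>i\<close> can be formed.\<close>
        show "W cs (is1 @ replicate r i @ is2) *\<^sub>C (?L * (Mi_u i J * ?R)) \<doteq>
          W cs' (is1 @ is2) *\<^sub>C (?L * (Mi_u i J * ?R))"
        proof (cases "(is1 \<noteq> [] \<longrightarrow> last is1 < i) \<and> (is2 \<noteq> [] \<longrightarrow> hd is2 < i)")
          case True
          have "W cs (is1 @ replicate r i @ is2) = W (clps (length is1) r cs) (is1 @ is2)"
            by (rule collapse) (use True is1 is2 i r len less.prems(2) in \<open>auto simp: index_lists_def\<close>)
          then show ?thesis using is1 by (simp add: cs'_def index_lists_def)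
        next
          case False
          have "?L * (Mi_u i J * ?R) \<doteq> 0"
          proof (cases "is1 \<noteq> [] \<and> i \<le> last is1")
            case True
            have "js1 \<noteq> []" using True is1 by (auto simp: index_lists_def)
            have "word_product is1 js1 * Mi_u i J \<doteq> 0"
              using True is1 js12 Jk i js1_less[OF \<open>js1 \<noteq> []\<close>]
              by (intro word_product_last_zero) (auto simp: index_lists_def)
            then have "?P * ((word_product is1 js1 * Mi_u i J) * ?R) \<doteq> ?P * (0 * ?R)"
              by (intro sim_mult sim_refl)
            then show ?thesis by (simp add: mult.assoc)
          next
            case 2: False
            have "js2 \<noteq> []" using False 2 is2 by (auto simp: index_lists_def)
            have "Mi_u i J * word_product is2 js2 \<doteq> 0"
              using False 2 is2 js12 Jk i js2_less[OF \<open>js2 \<noteq> []\<close>]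
              by (intro word_product_first_zero) (auto simp: index_lists_def)
            then have "?L * ((Mi_u i J * word_product is2 js2) * ?P) \<doteq> ?L * (0 * ?P)"
              by (intro sim_mult sim_refl)
            then show ?thesis by (simp add: mult.assoc)
          qed
          from sim_scale[OF this] have z: "c *\<^sub>C (?L * (Mi_u i J * ?R)) \<doteq> 0" for c by simp
          show ?thesis by (rule sim_trans[OF z sim_sym[OF z]])
        qed
      qed
      also have "\<dots> = W cs' (is1 @ is2) *\<^sub>C (?L * (Mi_P n J * ?R))"
        by (simp add: Mi_P_def[of n J] sum_distrib_left sum_distrib_right scaleC_sum_right)
      also have "\<dots> \<doteq> W cs' (is1 @ is2) *\<^sub>C (?L * ?R)"
      proof (rule sim_scale, rule sim_mult[OF sim_refl])
        \<comment> \<open>If no letter follows the run, it is the outer projection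
          \<open>Mi_P n 1\<close> that absorbs \<open>Mi_P n J\<close>; otherwise it is the next
          generator, whose column is smaller than \<open>J\<close>.\<close>
        show "Mi_P n J * ?R \<doteq> ?R"
        proof (cases "js2 = []")
          case True
          then show ?thesis using is2 P_absorb_P[OF Jk] by (simp add: index_lists_def)
        next
          case False
          then obtain j' js' where j': "js2 = j' # js'" by (cases js2) auto
          then obtain i' is' where i': "is2 = i' # is'" using is2 by (cases is2) (auto simp: index_lists_def)
          have "Mi_P n J * Mi_u i' j' * (word_product is' js' * ?P) \<doteq> Mi_u i' j' * (word_product is' js' * ?P)"
            using is2 js12 Jk js2_less by (intro sim_mult sim_refl P_absorb) (auto simp: i' j' index_lists_def)
          then show ?thesis by (simp add: i' j' mult.assoc)
        qed
      qed
      also have "\<dots> = W cs' (is1 @ is2) *\<^sub>C (?P * word_product (is1 @ is2) (js1 @ js2) * ?P)"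
        using is1 by (simp add: word_product_append index_lists_def mult.assoc)
      finally show ?thesis .
    qed
    have "(\<Sum>is\<in>index_lists n (length js). W cs is *\<^sub>C (?P * word_product is js * ?P)) =
        (\<Sum>is1\<in>index_lists n (length js1). \<Sum>m\<in>index_lists n r. \<Sum>is2\<in>index_lists n (length js2).
          W cs (is1 @ m @ is2) *\<^sub>C (?P * word_product (is1 @ m @ is2) js * ?P))"
      by (simp add: js sum_index_lists_append)
    also have "\<dots> = (\<Sum>is1\<in>index_lists n (length js1). \<Sum>is2\<in>index_lists n (length js2).
        \<Sum>m\<in>index_lists n r. W cs (is1 @ m @ is2) *\<^sub>C (?P * word_product (is1 @ m @ is2) js * ?P))"
      by (rule sum.cong[OF refl], rule sum.swap)
    also have "\<dots> \<doteq> (\<Sum>is1\<in>index_lists n (length js1). \<Sum>is2\<in>index_lists n (length js2).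
        W cs' (is1 @ is2) *\<^sub>C (?P * word_product (is1 @ is2) (js1 @ js2) * ?P))"
      by (intro sim_sum step)
    also have "\<dots> = (\<Sum>is\<in>index_lists n (length (js1 @ js2)).
        W cs' is *\<^sub>C (?P * word_product is (js1 @ js2) * ?P))"
      by (simp add: sum_index_lists_append)
    also have "\<dots> \<doteq> W cs' (js1 @ js2) *\<^sub>C ?P"
      by (rule less.hyps) (use js12 cs' js r in auto)
    \<comment> \<open>Since \<open>k \<le> n\<close>, the columns \<open>js\<close> form an
      admissible tuple of rows with the same peak, so the collapse can be undone there.\<close>
    also have "W cs' (js1 @ js2) = W cs js"
      unfolding cs'_def js
      by (rule collapse[symmetric]) (use less.prems(2) len r js12 k Jk js1_less js2_less in auto)
    finally show ?thesis .
  qed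
qed

end

section \<open>Independence implies spreadability\<close>

text \<open>One coefficient more than letters. Equal neighbouring letters are allowed, in contrast
  to the alternating products in the definition of independence. An empty list of coefficients gives
  the default value \<open>1\<close>.\<close>

fun word_eval :: "('i \<Rightarrow> 'a::complex_algebra_1) \<Rightarrow> 'a list \<Rightarrow> 'i list \<Rightarrow> 'a"
  where
    "word_eval x [] js = 1"
  | "word_eval x (c # cs) [] = c"
  | "word_eval x (c # cs) (j # js) = c * x j * word_eval x cs js"

lemma word_eval_bmono_eval: "length cs = Suc r \<Longrightarrow> word_eval x cs (replicate r i) = bmono_eval (x i) cs"
proof (induction r arbitrary: cs)
  case 0
  then show ?case by (auto simp: length_Suc_conv)
next
  case (Suc r)
  then obtain c c' cs' where "cs = c # c' # cs'" by (metis length_Suc_conv)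
  then show ?case using Suc by simp
qed

lemma word_eval_append:
  "length cs = length js \<Longrightarrow> ds \<noteq> [] \<Longrightarrow>
    word_eval x (cs @ ds) (js @ js') = word_eval x (cs @ [1]) js * word_eval x ds js'"
proof (induction cs js rule: list_induct2)
  case Nil
  then show ?case by simp
qed (simp add: mult.assoc)

lemma word_eval_Cons_coeff:
  assumes "length ds = length js" shows "word_eval x (c # ds) js = c * word_eval x (1 # ds) js"
  using assms by (cases js) (auto simp: mult.assoc)

lemma word_eval_segment:
  "length seg = Suc r \<Longrightarrow> length ds = length js \<Longrightarrow>
    word_eval x (seg @ ds) (replicate r i @ js) = bmono_eval (x i) seg * word_eval x (1 # ds) js"
proof (induction r arbitrary: seg)
  case 0
  then obtain c where "seg = [c]" by (auto simp: length_Suc_conv)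
  then show ?case using word_eval_Cons_coeff[OF 0(2), of x c] by simp
next
  case (Suc r)
  then obtain c c' seg' where "seg = c # c' # seg'" by (metis length_Suc_conv)
  then show ?case using Suc.IH[of "c' # seg'"] Suc.prems by (simp add: mult.assoc)
qed

lemma word_eval_ones: "word_eval x (replicate (Suc (length js)) 1) js = prod_list (map x js)"
  by (induction js) auto

lemma bpoly_eval_single: "bpoly_eval (Poly_Mapping.single bs 1) x = bmono_eval x bs"
  by (simp add: bpoly_eval_def scaleC_one)

text \<open>Scalars are adjoined because \<open>B\<close> may lack the unit, while the definition of
  \<open>B<X>_0\<close> allows them as coefficients.\<close>

definition coefficients :: "'a::complex_algebra_1 set \<Rightarrow> 'a set"
  where "coefficients B = B \<union> {c *\<^sub>C 1 | c. True}"

lemma one_coefficient [simp]: "1 \<in> coefficients B"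
  unfolding coefficients_def by (auto intro!: exI[of _ 1] simp: scaleC_one)

lemma single_bpolys0: "length bs \<ge> 2 \<Longrightarrow> set bs \<subseteq> coefficients B \<Longrightarrow> Poly_Mapping.single bs 1 \<in> bpolys0 B"
  by (simp add: bpolys0_def coefficients_def)

text \<open>Equal neighbouring letters are merged into one monomial. Where two different letters
  meet, the coefficient between them goes to the monomial on the right, and the one on the left is
  closed with \<open>1\<close>.\<close>

lemma word_eval_grouping:
  assumes "is \<noteq> []" "length cs = Suc (length is)" "set cs \<subseteq> coefficients B"
  shows "\<exists>bss js. length bss = length js \<and> js \<noteq> [] \<and> (\<forall>bs\<in>set bss. length bs \<ge> 2 \<and> set bs \<subseteq> coefficients B) \<and>
    set js \<subseteq> set is \<and> distinct_adj js \<and> hd js = hd is \<and> last js = last is \<and>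
    prod_list (map2 (\<lambda>bs j. bmono_eval (x j) bs) bss js) = word_eval x cs is"
  using assms
proof (induction "is" arbitrary: cs)
  case (Cons i "is")
  show ?case
  proof (cases "is = []")
    case True
    then obtain c d where "cs = [c, d]" using Cons.prems(2) by (auto simp: length_Suc_conv)
    then show ?thesis using True Cons.prems(3)
      by (intro exI[of _ "[cs]"] exI[of _ "[i]"]) simp
  next
    case False
    obtain c cs' where cs: "cs = c # cs'" using Cons.prems(2) by (cases cs) auto
    have "length cs' = Suc (length is)" "set cs' \<subseteq> coefficients B"
      using Cons.prems cs by auto
    from Cons.IH[OF False this] obtain bss js where
      IH: "length bss = length js" "js \<noteq> []" "\<forall>bs\<in>set bss. length bs \<ge> 2 \<and> set bs \<subseteq> coefficients B"
        "set js \<subseteq> set is" "distinct_adj js" "hd js = hd is" "last js = last is"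
        "prod_list (map2 (\<lambda>bs j. bmono_eval (x j) bs) bss js) = word_eval x cs' is"
      by blast
    have c: "c \<in> coefficients B" using Cons.prems(3) cs by simp
    obtain j js' where js: "js = j # js'" using IH(2) by (cases js) auto
    obtain bs bss' where bss: "bss = bs # bss'" using IH(1) js by (cases bss) auto
    obtain d ds where bs: "bs = d # ds" using IH(3) bss by (cases bs) auto
    show ?thesis
    proof (cases "j = i")
      case True
      have "prod_list (map2 (\<lambda>bs j. bmono_eval (x j) bs) ((c # bs) # bss') js) = word_eval x cs (i # is)"
        using IH(8) True by (simp add: js bss bs cs mult.assoc)
      then show ?thesis using IH c False
        by (intro exI[of _ "(c # bs) # bss'"] exI[of _ js]) (auto simp: js bss True)
    next
      case False
      have "prod_list (map2 (\<lambda>bs j. bmono_eval (x j) bs) ([c, 1] # bss) (i # js)) = word_eval x cs (i # is)"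
        using IH(8) by (simp add: cs)
      then show ?thesis using IH c False \<open>is \<noteq> []\<close>
        by (intro exI[of _ "[c, 1] # bss"] exI[of _ "i # js"]) (auto simp: js)
    qed
  qed
qed simp

lemma word_eval_in_subalgebra:
  assumes C: "subalgebra C" and B: "B \<subseteq> C" and x: "\<And>i. i \<in> set is \<Longrightarrow> x i \<in> C"
  shows "is \<noteq> [] \<Longrightarrow> length cs = Suc (length is) \<Longrightarrow> set cs \<subseteq> coefficients B \<Longrightarrow> word_eval x cs is \<in> C"
  using x
proof (induction "is" arbitrary: cs)
  case (Cons i "is")
  have left: "c * a \<in> C" and right: "a * c \<in> C" if "c \<in> coefficients B" "a \<in> C" for a c
    using that subalgebraD[OF C] B by (auto simp: coefficients_def mult_scaleC_left mult_scaleC_right)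
  obtain c cs' where cs: "cs = c # cs'" using Cons.prems(2) by (cases cs) auto
  have ci: "c * x i \<in> C" using Cons.prems cs by (intro left) auto
  show ?case
  proof (cases "is = []")
    case True
    then obtain d where "cs' = [d]" using Cons.prems(2) cs by (auto simp: length_Suc_conv)
    then show ?thesis using ci Cons.prems(3) True cs by (auto intro: right)
  next
    case False
    then have "word_eval x cs' is \<in> C" using Cons.prems cs by (intro Cons.IH) auto
    then show ?thesis using ci cs by (auto intro: subalgebraD[OF C])
  qed
qed simp

text \<open>Translates the indexed form of monotone independence to words with coefficients. An
  empty outer word contributes no monomial and the factor \<open>1\<close>, which matches the
  omitted inequality at an end of the product.\<close>

lemma monotone_peak:
  fixes x :: "'i::linorder \<Rightarrow> 'a::complex_algebra_1"
  assumes mi: "monotonically_independent B E I x"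
    and cs: "set cs1 \<subseteq> coefficients B" "set seg \<subseteq> coefficients B" "set cs2 \<subseteq> coefficients B"
    and len: "length cs1 = length is1" "length seg \<ge> 2" "length cs2 = length is2"
    and I: "set is1 \<subseteq> I" "i \<in> I" "set is2 \<subseteq> I"
    and peak: "is1 \<noteq> [] \<Longrightarrow> last is1 < i" "is2 \<noteq> [] \<Longrightarrow> hd is2 < i"
  shows "E (word_eval x (cs1 @ [1]) is1 * bmono_eval (x i) seg * word_eval x (1 # cs2) is2) =
    E (word_eval x (cs1 @ [1]) is1 * E (bmono_eval (x i) seg) * word_eval x (1 # cs2) is2)"
proof -
  let ?m = "\<lambda>bs. Poly_Mapping.single bs (1 :: complex)"
  have grp: "\<exists>bss js. length bss = length js \<and> (\<forall>bs\<in>set bss. length bs \<ge> 2 \<and> set bs \<subseteq> coefficients B) \<and>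
      set js \<subseteq> set is \<and> distinct_adj js \<and> (js = [] \<longleftrightarrow> is = []) \<and> (js \<noteq> [] \<longrightarrow> hd js = hd is \<and> last js = last is) \<and>
      prod_list (map2 (\<lambda>bs j. bmono_eval (x j) bs) bss js) = word_eval x cs is"
    if "length cs = Suc (length is)" "set cs \<subseteq> coefficients B" "is = [] \<Longrightarrow> cs = [1]" for cs "is"
  proof (cases "is = []")
    case True
    then show ?thesis using that by (intro exI[of _ "[]"]) simp
  next
    case False
    then show ?thesis using word_eval_grouping[OF False that(1,2), of x] by auto
  qed
  obtain bss1 js1 where 1: "length bss1 = length js1" "\<forall>bs\<in>set bss1. length bs \<ge> 2 \<and> set bs \<subseteq> coefficients B"
      "set js1 \<subseteq> set is1" "distinct_adj js1" "js1 = [] \<longleftrightarrow> is1 = []" "js1 \<noteq> [] \<longrightarrow> last js1 = last is1"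
      "prod_list (map2 (\<lambda>bs j. bmono_eval (x j) bs) bss1 js1) = word_eval x (cs1 @ [1]) is1"
  proof -
    have "length (cs1 @ [1]) = Suc (length is1)" "set (cs1 @ [1]) \<subseteq> coefficients B" "is1 = [] \<Longrightarrow> cs1 @ [1] = [1]"
      using len cs by auto
    from grp[OF this] that show ?thesis by blast
  qed
  obtain bss2 js2 where 2: "length bss2 = length js2" "\<forall>bs\<in>set bss2. length bs \<ge> 2 \<and> set bs \<subseteq> coefficients B"
      "set js2 \<subseteq> set is2" "distinct_adj js2" "js2 = [] \<longleftrightarrow> is2 = []" "js2 \<noteq> [] \<longrightarrow> hd js2 = hd is2"
      "prod_list (map2 (\<lambda>bs j. bmono_eval (x j) bs) bss2 js2) = word_eval x (1 # cs2) is2"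
  proof -
    have "length (1 # cs2) = Suc (length is2)" "set (1 # cs2) \<subseteq> coefficients B" "is2 = [] \<Longrightarrow> 1 # cs2 = [1]"
      using len cs by auto
    from grp[OF this] that show ?thesis by blast
  qed
  define ps where "ps = map ?m (bss1 @ [seg] @ bss2)"
  define js where "js = js1 @ [i] @ js2"
  define ys where "ys = map2 (\<lambda>p j. bpoly_eval p (x j)) ps js"
  define k where "k = length js1"
  have ys_part: "map2 (\<lambda>p j. bpoly_eval p (x j)) (map ?m bss) js' = map2 (\<lambda>bs j. bmono_eval (x j) bs) bss js'"
    for bss js' by (simp add: zip_map1 case_prod_unfold bpoly_eval_single)
  have ys: "ys = map2 (\<lambda>bs j. bmono_eval (x j) bs) bss1 js1 @ [bmono_eval (x i) seg] @
      map2 (\<lambda>bs j. bmono_eval (x j) bs) bss2 js2"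
    unfolding ys_def ps_def js_def ys_part using 1(1) by simp
  have "set ps \<subseteq> bpolys0 B"
    using 1(2) 2(2) cs(2) len(2) by (auto simp: ps_def intro!: single_bpolys0)
  moreover have "set js \<subseteq> I" using 1(3) 2(3) I by (auto simp: js_def)
  moreover have "length ps = length js" using 1(1) 2(1) by (simp add: ps_def js_def)
  moreover have "distinct_adj js"
    using 1 2 peak by (auto simp: js_def distinct_adj_append_iff distinct_adj_Cons)
  moreover have "k < length js" by (simp add: k_def js_def)
  moreover have "0 < k \<longrightarrow> js ! (k - 1) < js ! k"
    using 1(5,6) peak(1) by (auto simp: k_def js_def nth_append last_conv_nth)
  moreover have "Suc k < length js \<longrightarrow> js ! Suc k < js ! k"
    using 2(5,6) peak(2) by (auto simp: k_def js_def nth_append hd_conv_nth)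
  ultimately have "E (prod_list ys) = E (prod_list (take k ys) * E (ys ! k) * prod_list (drop (Suc k) ys))"
    using mi unfolding monotonically_independent_def Let_def ys_def by blast
  then show ?thesis
    using 1(1,7) 2(7) by (simp add: ys k_def nth_append mult.assoc)
qed

lemma linear_on_sum:
  assumes A: "csubspace A" and \<phi>: "linear_on A \<phi>" and f: "\<And>i. i \<in> S \<Longrightarrow> f i \<in> A"
  shows "\<phi> (\<Sum>i\<in>S. c i *\<^sub>C f i) = (\<Sum>i\<in>S. c i *\<^sub>C \<phi> (f i))"
proof -
  have 0: "\<phi> 0 = 0"
    using \<phi> csubspaceD(1)[OF A] scaleC_zero_left unfolding linear_on_def by metis
  show ?thesis
    using f
  proof (induction S rule: infinite_finite_induct)
    case (insert i S)
    have "(\<Sum>i\<in>S. c i *\<^sub>C f i) \<in> A" by (intro csubspace_sum[OF A] csubspaceD[OF A] insert.prems) simp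
    then show ?case
      using insert \<phi> csubspaceD(3)[OF A] by (simp add: linear_on_def)
  qed (simp_all add: 0)
qed

text \<open>Two reductions at once: from polynomials to words by linearity of \<open>\<phi>\<close>,
  and from the universal algebra to one seminorm at a time.\<close>

lemma Mi_invariantI:
  assumes A: "csubspace A" and \<phi>: "linear_on A \<phi>" and y: "\<And>js. prod_list (map y js) \<in> A"
    and words: "\<And>\<nu> js. Mi_seminorm \<nu> n k \<Longrightarrow> set js \<subseteq> {1..k} \<Longrightarrow> cstar.sim \<nu>
      (\<Sum>is\<in>index_lists n (length js). \<phi> (prod_list (map y is)) *\<^sub>C (Mi_P n 1 * word_product is js * Mi_P n 1))
      (\<phi> (prod_list (map y js)) *\<^sub>C Mi_P n 1)"
  shows "Mi_invariant \<phi> y n k"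
  unfolding Mi_invariant_def
proof (intro ballI universal_class_eqI)
  fix p \<nu> assume p: "p \<in> nc_polys k" and \<nu>: "\<nu> \<in> cstar_seminorms_on (Mi_relators n k)"
  interpret Mi_seminorm \<nu> n k using \<nu> by (rule Mi_seminormI)
  let ?\<mu> = "joint_distribution \<phi> y" and ?P = "Mi_P n 1"
  have \<mu>_word: "?\<mu> (Poly_Mapping.single (Word js) 1) = \<phi> (prod_list (map y js))" for js
    by (simp add: joint_distribution_def nc_eval_single scaleC_one)
  have lhs: "?\<mu> p *\<^sub>C ?P = (\<Sum>w\<in>Poly_Mapping.keys p. Poly_Mapping.lookup p w *\<^sub>C \<phi> (prod_list (map y (letters w))) *\<^sub>C ?P)"
  proof -
    have "?\<mu> p = (\<Sum>w\<in>Poly_Mapping.keys p. Poly_Mapping.lookup p w *\<^sub>C \<phi> (prod_list (map y (letters w))))"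
      unfolding joint_distribution_def nc_eval_def by (rule linear_on_sum[OF A \<phi> y])
    moreover have "(\<Sum>i\<in>S. f i) *\<^sub>C ?P = (\<Sum>i\<in>S. f i *\<^sub>C ?P)" for S and f :: "nat free_monoid \<Rightarrow> complex"
      by (induction S rule: infinite_finite_induct) (simp_all add: scaleC_add_left)
    ultimately show ?thesis by (simp add: scaleC_scaleC scaleC_complex_def)
  qed
  have "?P * slice_map ?\<mu> (Mi_\<alpha> n p) * ?P = (\<Sum>w\<in>Poly_Mapping.keys p. Poly_Mapping.lookup p w *\<^sub>C
      (?P * slice_map ?\<mu> (Mi_\<alpha> n (Poly_Mapping.single w 1)) * ?P))"
    by (subst slice_map_Mi_\<alpha>) (simp add: sum_distrib_left sum_distrib_right mult_scaleC_left mult_scaleC_right)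
  also have "sim \<dots> (\<Sum>w\<in>Poly_Mapping.keys p. Poly_Mapping.lookup p w *\<^sub>C \<phi> (prod_list (map y (letters w))) *\<^sub>C ?P)"
  proof (intro sim_sum sim_scale)
    fix w assume "w \<in> Poly_Mapping.keys p"
    then have w: "set (letters w) \<subseteq> {1..k}" using p by (auto simp: nc_polys_def)
    have "?P * slice_map ?\<mu> (Mi_\<alpha> n (Poly_Mapping.single w 1)) * ?P =
        ?P * slice_map ?\<mu> (Mi_\<alpha> n (Poly_Mapping.single (Word (letters w)) 1)) * ?P" by simp
    also have "\<dots> = (\<Sum>is\<in>index_lists n (length (letters w)). \<phi> (prod_list (map y is)) *\<^sub>C (?P * word_product is (letters w) * ?P))"
      unfolding slice_map_Mi_\<alpha>_word \<mu>_word
      by (simp add: sum_distrib_left sum_distrib_right mult_scaleC_left mult_scaleC_right)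
    also have "sim \<dots> (\<phi> (prod_list (map y (letters w))) *\<^sub>C ?P)"
      by (rule words[OF Mi_seminorm_axioms w])
    finally show "sim (?P * slice_map ?\<mu> (Mi_\<alpha> n (Poly_Mapping.single w 1)) * ?P)
        (\<phi> (prod_list (map y (letters w))) *\<^sub>C ?P)" .
  qed
  finally show "\<nu> (?\<mu> p *\<^sub>C ?P - ?P * slice_map ?\<mu> (Mi_\<alpha> n p) * ?P) = 0"
    unfolding lhs using sim_sym sim_def by blast
qed

lemma independent_imp_invariant:
  fixes x :: "'i::linorder \<Rightarrow> 'a::complex_algebra_1"
  assumes ce: "conditional_expectation C B E" and pres: "\<And>a. a \<in> C \<Longrightarrow> \<phi> (E a) = \<phi> a"
    and id: "identically_distributed B E I x" and mi: "monotonically_independent B E I x"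
    and xC: "\<And>i. i \<in> I \<Longrightarrow> x i \<in> C"
    and A: "csubspace A" "linear_on A \<phi>" "\<And>js. prod_list (map x js) \<in> A"
    and s: "strict_mono_on {1..n} s" "s ` {1..n} \<subseteq> I" and k: "1 \<le> k" "k \<le> n"
  shows "Mi_invariant \<phi> (x \<circ> s) n k"
proof (rule Mi_invariantI[OF A(1,2)])
  have C: "subalgebra C" and BC: "B \<subseteq> C" and EB: "E ` C = B"
    using ce by (auto simp: conditional_expectation_def)
  show "prod_list (map (x \<circ> s) js) \<in> A" for js using A(3)[of "map s js"] by simp
  define W where "W cs is = \<phi> (word_eval x cs (map s is))" for cs "is"
  \<comment> \<open>By identical distribution the letter \<open>x (s 1)\<close> represents all of
    them, so the coefficient created by a collapse does not depend on the row index.\<close>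
  define \<beta> where "\<beta> seg = E (bmono_eval (x (s 1)) seg)" for seg
  \<comment> \<open>Removing \<open>r\<close> letters merges the \<open>r + 1\<close> coefficients
    around them, starting at position \<open>a\<close>, into one.\<close>
  define clps where "clps a r cs = take a cs @ [\<beta> (take (r + 1) (drop a cs))] @ drop (a + r + 1) cs" for a r cs
  have sI: "s i \<in> I" if "i \<in> {1..n}" for i using s(2) that by blast
  have mono_C: "bmono_eval (x i) seg \<in> C" if "length seg \<ge> 2" "set seg \<subseteq> coefficients B" "i \<in> I" for seg i
  proof -
    define r where "r = length seg - 2"
    then have r: "length seg = Suc (Suc r)" using that(1) by simp
    have "word_eval x seg (replicate (Suc r) i) \<in> C"
      by (rule word_eval_in_subalgebra[OF C BC]) (use that r xC in \<open>auto simp del: replicate_Suc\<close>)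
    then show ?thesis using word_eval_bmono_eval[OF r, of x i] by simp
  qed
  have \<beta>_B: "\<beta> seg \<in> B" if "length seg \<ge> 2" "set seg \<subseteq> coefficients B" for seg
    using mono_C[OF that sI[of 1]] k EB by (auto simp: \<beta>_def)
  have \<beta>_eq: "E (bmono_eval (x i) seg) = \<beta> seg" if "length seg \<ge> 2" "set seg \<subseteq> coefficients B" "i \<in> I" for seg i
  proof -
    have "s 1 \<in> I" using sI[of 1] k by simp
    then show ?thesis
      using id single_bpolys0[OF that(1,2)] that(3)
      unfolding identically_distributed_def \<beta>_def bpoly_eval_single[symmetric] by blast
  qed
  have clps_set: "set (clps a r cs) \<subseteq> coefficients B"
    if "set cs \<subseteq> coefficients B" "a + r < length cs" "r \<ge> 1" for a r cs
  proof -
    have "\<beta> (take (r + 1) (drop a cs)) \<in> B"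
      using that by (intro \<beta>_B) (auto dest!: in_set_takeD in_set_dropD)
    then show ?thesis using that(1)
      by (auto simp: clps_def coefficients_def dest!: in_set_takeD in_set_dropD)
  qed
  have collapse: "W cs (is1 @ replicate r i @ is2) = W (clps (length is1) r cs) (is1 @ is2)"
    if cs: "set cs \<subseteq> coefficients B" "length cs = Suc (length is1 + r + length is2)" and r: "r \<ge> 1"
      and idx: "set is1 \<subseteq> {1..n}" "set is2 \<subseteq> {1..n}" "i \<in> {1..n}"
      and peak: "is1 \<noteq> [] \<Longrightarrow> last is1 < i" "is2 \<noteq> [] \<Longrightarrow> hd is2 < i" for cs is1 r i is2
  proof -
    define cs1 where "cs1 = take (length is1) cs"
    define seg where "seg = take (r + 1) (drop (length is1) cs)"
    define cs2 where "cs2 = drop (length is1 + r + 1) cs"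
    have split: "cs = cs1 @ seg @ cs2"
      unfolding cs1_def seg_def cs2_def by (metis append_take_drop_id drop_drop add.assoc add.commute)
    have len: "length cs1 = length is1" "length seg = Suc r" "length cs2 = length is2"
      using cs(2) by (simp_all add: cs1_def seg_def cs2_def)
    have seg2: "length seg \<ge> 2" using len(2) r by simp
    have co: "set cs1 \<subseteq> coefficients B" "set seg \<subseteq> coefficients B" "set cs2 \<subseteq> coefficients B"
      using cs(1) split by auto
    have sI': "set (map s is1) \<subseteq> I" "s i \<in> I" "set (map s is2) \<subseteq> I" using idx sI by auto
    let ?pre = "word_eval x (cs1 @ [1]) (map s is1)" and ?post = "word_eval x (1 # cs2) (map s is2)"
    have seg_ne: "seg \<noteq> []" using seg2 by auto
    have w: "word_eval x cs (map s (is1 @ replicate r i @ is2)) = ?pre * bmono_eval (x (s i)) seg * ?post"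
      using len seg_ne word_eval_segment[of seg r cs2 "map s is2" x "s i"]
      by (simp add: split word_eval_append map_replicate mult.assoc)
    have w': "word_eval x (cs1 @ [\<beta> seg] @ cs2) (map s (is1 @ is2)) = ?pre * \<beta> seg * ?post"
      using len word_eval_segment[of "[\<beta> seg]" 0 cs2 "map s is2" x "s i"]
      by (simp add: word_eval_append mult.assoc)
    have wC: "?pre * bmono_eval (x (s i)) seg * ?post \<in> C"
      unfolding w[symmetric]
      by (rule word_eval_in_subalgebra[OF C BC]) (use idx sI xC cs r in auto)
    \<comment> \<open>If the run is the whole word, nothing but the new coefficient remains; it lies
      in \<open>B\<close> and hence in \<open>C\<close>.\<close>
    have w'C: "?pre * \<beta> seg * ?post \<in> C"
    proof (cases "is1 @ is2 = []")
      case True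
      then show ?thesis using len \<beta>_B[OF seg2 co(2)] BC by auto
    next
      case False
      have "set (cs1 @ [\<beta> seg] @ cs2) \<subseteq> coefficients B"
        using co \<beta>_B[OF seg2 co(2)] by (auto simp: coefficients_def)
      then show ?thesis
        unfolding w'[symmetric] using False
        by (intro word_eval_in_subalgebra[OF C BC]) (use idx sI xC len in auto)
    qed
    have "E (?pre * bmono_eval (x (s i)) seg * ?post) = E (?pre * E (bmono_eval (x (s i)) seg) * ?post)"
    proof (rule monotone_peak[OF mi co _ seg2 _ sI'])
      show "last (map s is1) < s i" if "map s is1 \<noteq> []"
      proof -
        have ne: "is1 \<noteq> []" using that by simp
        then have "last is1 \<in> {1..n}" using idx(1) last_in_set by blast
        then have "s (last is1) < s i" using strict_mono_onD[OF s(1) _ idx(3) peak(1)[OF ne]] by blast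
        then show ?thesis using ne by (simp add: last_map)
      qed
      show "hd (map s is2) < s i" if "map s is2 \<noteq> []"
      proof -
        have ne: "is2 \<noteq> []" using that by simp
        then have "hd is2 \<in> {1..n}" using idx(2) hd_in_set by blast
        then have "s (hd is2) < s i" using strict_mono_onD[OF s(1) _ idx(3) peak(2)[OF ne]] by blast
        then show ?thesis using ne by (simp add: hd_map)
      qed
    qed (use len in auto)
    then have "\<phi> (?pre * bmono_eval (x (s i)) seg * ?post) = \<phi> (?pre * \<beta> seg * ?post)"
      using pres[OF wC] pres[OF w'C] \<beta>_eq[OF seg2 co(2) sI'(2)] by simp
    then show ?thesis
      unfolding W_def w clps_def cs1_def[symmetric] cs2_def[symmetric] seg_def[symmetric] w' .
  qed
  fix \<nu> js assume \<nu>: "Mi_seminorm \<nu> n k" and js: "set js \<subseteq> {1..k}"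
  interpret Mi_seminorm \<nu> n k by (rule \<nu>)
  have ones: "W (replicate (Suc (length js)) 1) is = \<phi> (prod_list (map (x \<circ> s) is))"
    if "length is = length js" for "is"
    using word_eval_ones[of x "map s is"] that by (simp add: W_def del: replicate_Suc)
  have "sim (\<Sum>is\<in>index_lists n (length js). W (replicate (Suc (length js)) 1) is *\<^sub>C
      (Mi_P n 1 * word_product is js * Mi_P n 1)) (W (replicate (Suc (length js)) 1) js *\<^sub>C Mi_P n 1)"
    by (rule invariance_from_collapse[where C = "coefficients B" and clps = clps, OF k collapse clps_set])
      (use js in \<open>auto simp: clps_def\<close>)
  also have "(\<Sum>is\<in>index_lists n (length js). W (replicate (Suc (length js)) 1) is *\<^sub>C
      (Mi_P n 1 * word_product is js * Mi_P n 1)) = (\<Sum>is\<in>index_lists n (length js).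
      \<phi> (prod_list (map (x \<circ> s) is)) *\<^sub>C (Mi_P n 1 * word_product is js * Mi_P n 1))"
    by (intro sum.cong refl) (simp add: ones index_lists_def del: replicate_Suc)
  finally show "sim (\<Sum>is\<in>index_lists n (length js). \<phi> (prod_list (map (x \<circ> s) is)) *\<^sub>C
      (Mi_P n 1 * word_product is js * Mi_P n 1)) (\<phi> (prod_list (map (x \<circ> s) js)) *\<^sub>C Mi_P n 1)"
    using ones[of js] by (simp del: replicate_Suc)
qed

section \<open>Two-by-two matrices\<close>

text \<open>The same type is used with complex entries for representations and with operator entries
  for matrix-valued letters, whence the noncommutative coefficient algebra.\<close>

datatype 'a m2 = M2 (m11: 'a) (m12: 'a) (m21: 'a) (m22: 'a)

instantiation m2 :: (complex_algebra_1) complex_algebra_1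
begin

definition zero_m2 where "zero_m2 = M2 0 0 0 (0 :: 'a)"

definition one_m2 where "one_m2 = M2 1 0 0 (1 :: 'a)"

definition plus_m2 where
  "plus_m2 a b = M2 (m11 a + m11 b) (m12 a + m12 b) (m21 a + m21 b) (m22 a + (m22 b :: 'a))"

definition minus_m2 where
  "minus_m2 a b = M2 (m11 a - m11 b) (m12 a - m12 b) (m21 a - m21 b) (m22 a - (m22 b :: 'a))"

definition uminus_m2 where
  "uminus_m2 a = M2 (- m11 a) (- m12 a) (- m21 a) (- (m22 a :: 'a))"

definition times_m2 where
  "times_m2 a b = M2 (m11 a * m11 b + m12 a * m21 b) (m11 a * m12 b + m12 a * m22 b)
    (m21 a * m11 b + m22 a * m21 b) (m21 a * m12 b + m22 a * (m22 b :: 'a))"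

definition scaleC_m2 where
  "scaleC_m2 c a = M2 (c *\<^sub>C m11 a) (c *\<^sub>C m12 a) (c *\<^sub>C m21 a) (c *\<^sub>C (m22 a :: 'a))"

instance
  by standard
    (simp_all add: zero_m2_def one_m2_def plus_m2_def minus_m2_def uminus_m2_def times_m2_def
      scaleC_m2_def algebra_simps scaleC_add_right scaleC_add_left scaleC_scaleC scaleC_one
      mult_scaleC_left mult_scaleC_right)

end

lemma m2_sel [simp]:
  "m11 0 = 0" "m12 0 = 0" "m21 0 = 0" "m22 0 = 0"
  "m11 1 = 1" "m12 1 = 0" "m21 1 = 0" "m22 1 = 1"
  "m11 (a + b) = m11 a + m11 b" "m12 (a + b) = m12 a + m12 b"
  "m21 (a + b) = m21 a + m21 b" "m22 (a + b) = m22 a + m22 b"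
  "m11 (a * b) = m11 a * m11 b + m12 a * m21 b" "m12 (a * b) = m11 a * m12 b + m12 a * m22 b"
  "m21 (a * b) = m21 a * m11 b + m22 a * m21 b" "m22 (a * b) = m21 a * m12 b + m22 a * m22 b"
  "m11 (c *\<^sub>C a) = c *\<^sub>C m11 a" "m12 (c *\<^sub>C a) = c *\<^sub>C m12 a"
  "m21 (c *\<^sub>C a) = c *\<^sub>C m21 a" "m22 (c *\<^sub>C a) = c *\<^sub>C m22 a"
  by (simp_all add: zero_m2_def one_m2_def plus_m2_def times_m2_def scaleC_m2_def)

lemma m2_eqI: "m11 a = m11 b \<Longrightarrow> m12 a = m12 b \<Longrightarrow> m21 a = m21 b \<Longrightarrow> m22 a = m22 b \<Longrightarrow> a = b"
  by (cases a; cases b) simp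

definition mstar :: "complex m2 \<Rightarrow> complex m2"
  where "mstar a = M2 (cnj (m11 a)) (cnj (m21 a)) (cnj (m12 a)) (cnj (m22 a))"

lemma mstar_simps [simp]:
  "mstar (a * b) = mstar b * mstar a" "mstar (a + b) = mstar a + mstar b"
  "mstar (c *\<^sub>C a) = cnj c *\<^sub>C mstar a" "mstar 1 = 1" "mstar 0 = 0" "mstar (mstar a) = a"
  by (rule m2_eqI; simp add: mstar_def scaleC_complex_def mult.commute)+

text \<open>The product norm on pairs is the Hilbert space norm, so the operator norm of this action
  is the C*-norm of the matrix.\<close>

definition matrix_apply :: "complex m2 \<Rightarrow> complex \<times> complex \<Rightarrow> complex \<times> complex"
  where "matrix_apply a v = (m11 a * fst v + m12 a * snd v, m21 a * fst v + m22 a * snd v)"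

lemma bounded_linear_matrix_apply: "bounded_linear (matrix_apply a)"
proof -
  have "bounded_linear (\<lambda>v :: complex \<times> complex. c * fst v + d * snd v)" for c d :: complex
    by (intro bounded_linear_add bounded_linear_compose[OF bounded_linear_mult_right]
        bounded_linear_fst bounded_linear_snd)
  then show ?thesis
    unfolding matrix_apply_def by (intro bounded_linear_Pair)
qed

lemma matrix_apply_simps [simp]:
  "matrix_apply (a + b) v = matrix_apply a v + matrix_apply b v"
  "matrix_apply (a * b) v = matrix_apply a (matrix_apply b v)"
  by (simp_all add: matrix_apply_def algebra_simps)

text \<open>\<open>\<bullet>\<close> is the real part of the Hermitian inner product. The adjoint
  relation for it already yields the C*-identity, where only squares of norms are compared.\<close>

lemma matrix_apply_adjoint: "matrix_apply a v \<bullet> w = v \<bullet> matrix_apply (mstar a) w"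
  by (simp add: matrix_apply_def mstar_def inner_prod_def inner_complex_def algebra_simps)

definition matrix_norm :: "complex m2 \<Rightarrow> real"
  where "matrix_norm a = onorm (matrix_apply a)"

lemma matrix_norm_apply: "norm (matrix_apply a v) \<le> matrix_norm a * norm v"
  unfolding matrix_norm_def by (rule onorm[OF bounded_linear_matrix_apply])

lemma matrix_norm_nonneg: "0 \<le> matrix_norm a"
  unfolding matrix_norm_def by (rule onorm_pos_le[OF bounded_linear_matrix_apply])

lemma matrix_norm_leI: "0 \<le> K \<Longrightarrow> (\<And>v. norm (matrix_apply a v) \<le> K * norm v) \<Longrightarrow> matrix_norm a \<le> K"
  unfolding matrix_norm_def by (rule onorm_bound)

lemma matrix_norm_triangle: "matrix_norm (a + b) \<le> matrix_norm a + matrix_norm b"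
proof (rule matrix_norm_leI)
  fix v
  show "norm (matrix_apply (a + b) v) \<le> (matrix_norm a + matrix_norm b) * norm v"
    using norm_triangle_ineq[of "matrix_apply a v" "matrix_apply b v"]
      matrix_norm_apply[of a v] matrix_norm_apply[of b v] by (simp add: algebra_simps)
qed (simp add: matrix_norm_nonneg)

lemma matrix_norm_mult: "matrix_norm (a * b) \<le> matrix_norm a * matrix_norm b"
proof (rule matrix_norm_leI)
  fix v
  have "norm (matrix_apply a (matrix_apply b v)) \<le> matrix_norm a * norm (matrix_apply b v)"
    by (rule matrix_norm_apply)
  also have "\<dots> \<le> matrix_norm a * (matrix_norm b * norm v)"
    by (intro mult_left_mono matrix_norm_apply matrix_norm_nonneg)
  finally show "norm (matrix_apply (a * b) v) \<le> matrix_norm a * matrix_norm b * norm v"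
    by (simp add: mult.assoc)
qed (simp add: matrix_norm_nonneg)

lemma matrix_norm_scale: "matrix_norm (c *\<^sub>C a) = cmod c * matrix_norm a"
proof -
  have norm: "norm (matrix_apply (c *\<^sub>C a) v) = cmod c * norm (matrix_apply a v)" for c a v
  proof -
    have "matrix_apply (c *\<^sub>C a) v = (c * fst (matrix_apply a v), c * snd (matrix_apply a v))"
      by (simp add: matrix_apply_def scaleC_complex_def algebra_simps)
    also have "norm \<dots> = sqrt ((cmod c)\<^sup>2 * ((cmod (fst (matrix_apply a v)))\<^sup>2 + (cmod (snd (matrix_apply a v)))\<^sup>2))"
      by (simp add: norm_Pair norm_mult power_mult_distrib distrib_left)
    also have "\<dots> = cmod c * norm (matrix_apply a v)"
      by (simp add: real_sqrt_mult norm_prod_def)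
    finally show ?thesis .
  qed
  have le: "matrix_norm (c *\<^sub>C a) \<le> cmod c * matrix_norm a" for c a
  proof (rule matrix_norm_leI)
    fix v show "norm (matrix_apply (c *\<^sub>C a) v) \<le> cmod c * matrix_norm a * norm v"
      unfolding norm by (simp add: mult.assoc mult_left_mono matrix_norm_apply)
  qed (simp add: matrix_norm_nonneg)
  show ?thesis
  proof (cases "c = 0")
    case False
    have "a = inverse c *\<^sub>C c *\<^sub>C a" using False by (simp add: scaleC_scaleC scaleC_one)
    then have "matrix_norm a \<le> cmod (inverse c) * matrix_norm (c *\<^sub>C a)"
      using le[of "inverse c" "c *\<^sub>C a"] by metis
    then have "cmod c * matrix_norm a \<le> matrix_norm (c *\<^sub>C a)"
      using False by (simp add: norm_inverse norm_divide field_simps)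
    with le[of c a] show ?thesis by simp
  next
    case True
    then show ?thesis using le[of 0 a] matrix_norm_nonneg[of "0 *\<^sub>C a"] by simp
  qed
qed

lemma matrix_norm_cstar: "matrix_norm (mstar a * a) = (matrix_norm a)\<^sup>2"
proof -
  have ge: "(matrix_norm a)\<^sup>2 \<le> matrix_norm (mstar a * a)" for a
  proof -
    have "norm (matrix_apply a v) \<le> sqrt (matrix_norm (mstar a * a)) * norm v" for v
    proof -
      have "(norm (matrix_apply a v))\<^sup>2 = v \<bullet> matrix_apply (mstar a * a) v"
        by (simp add: power2_norm_eq_inner matrix_apply_adjoint)
      also have "\<dots> \<le> norm v * norm (matrix_apply (mstar a * a) v)"
        by (rule norm_cauchy_schwarz)
      also have "\<dots> \<le> norm v * (matrix_norm (mstar a * a) * norm v)"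
        by (intro mult_left_mono matrix_norm_apply) simp
      also have "\<dots> = (sqrt (matrix_norm (mstar a * a)) * norm v)\<^sup>2"
        by (simp add: power_mult_distrib matrix_norm_nonneg power2_eq_square)
      finally show ?thesis
        by (rule power2_le_imp_le) (simp add: matrix_norm_nonneg)
    qed
    then have "matrix_norm a \<le> sqrt (matrix_norm (mstar a * a))"
      by (intro matrix_norm_leI) (simp_all add: matrix_norm_nonneg)
    then show ?thesis
      using matrix_norm_nonneg power_mono real_sqrt_pow2 by metis
  qed
  have le: "matrix_norm a \<le> matrix_norm (mstar a)" for a
  proof (cases "matrix_norm a = 0")
    case False
    have "(matrix_norm a)\<^sup>2 \<le> matrix_norm (mstar a) * matrix_norm a"
      by (rule order_trans[OF ge matrix_norm_mult])
    then show ?thesis using False matrix_norm_nonneg[of a] by (simp add: power2_eq_square)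
  qed (simp add: matrix_norm_nonneg)
  have "matrix_norm (mstar a) = matrix_norm a" using le[of a] le[of "mstar a"] by simp
  then show ?thesis using ge[of a] matrix_norm_mult[of "mstar a" a] by (simp add: power2_eq_square)
qed

lemma matrix_norm_eq_0: "matrix_norm a = 0 \<longleftrightarrow> a = 0"
proof
  assume "matrix_norm a = 0"
  then have "matrix_apply a v = 0" for v using matrix_norm_apply[of a v] by simp
  from this[of "(1, 0)"] this[of "(0, 1)"] show "a = 0"
    by (intro m2_eqI) (auto simp: matrix_apply_def zero_prod_def)
next
  assume "a = 0"
  then show "matrix_norm a = 0" using matrix_norm_scale[of 0 a] by simp
qed

lemma nc_eval_1: "nc_eval f 1 = 1"
  using nc_eval_single[of f "[]" 1] by (simp add: zero_free_monoid_def[symmetric] scaleC_one)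

text \<open>A generator and its formal adjoint have the same image; this respects the involution
  when the matrices are selfadjoint, as they are for generators that represent projections.\<close>

definition matrix_rep :: "('g \<Rightarrow> complex m2) \<Rightarrow> 'g free_star_algebra \<Rightarrow> complex m2"
  where "matrix_rep \<rho> = nc_eval (\<lambda>(g, b). \<rho> g)"

lemma matrix_rep_simps [simp]:
  "matrix_rep \<rho> (p + q) = matrix_rep \<rho> p + matrix_rep \<rho> q"
  "matrix_rep \<rho> (p - q) = matrix_rep \<rho> p - matrix_rep \<rho> q"
  "matrix_rep \<rho> (p * q) = matrix_rep \<rho> p * matrix_rep \<rho> q"
  "matrix_rep \<rho> (c *\<^sub>C p) = c *\<^sub>C matrix_rep \<rho> p"
  "matrix_rep \<rho> (sum f I) = (\<Sum>i\<in>I. matrix_rep \<rho> (f i))"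
  "matrix_rep \<rho> (free_gen g) = \<rho> g"
  by (simp_all add: matrix_rep_def nc_eval_add nc_eval_diff nc_eval_mult nc_eval_scaleC nc_eval_sum
      nc_eval_free_gen)

lemma matrix_rep_star:
  assumes "\<And>g. mstar (\<rho> g) = \<rho> g"
  shows "matrix_rep \<rho> (free_star p) = mstar (matrix_rep \<rho> p)"
proof (induction p rule: ncpoly_induct)
  case (1 w c)
  have "mstar (prod_list (map (\<lambda>(g, b). \<rho> g) l)) =
      prod_list (map (\<lambda>(g, b). \<rho> g) (rev (map (\<lambda>(g, b). (g, \<not> b)) l)))" for l
    by (induction l) (auto simp: assms)
  then show ?case
    by (cases w) (simp add: matrix_rep_def free_star_single word_star_def nc_eval_single)
qed (simp add: free_star_add)

text \<open>The source of admissible seminorms. Since the matrix norm is definite, an identity in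
  the universal algebra becomes an identity of matrices.\<close>

lemma matrix_rep_seminorm:
  assumes sa: "\<And>g. mstar (\<rho> g) = \<rho> g" and R: "\<And>r. r \<in> R \<Longrightarrow> matrix_rep \<rho> r = 0"
  shows "(\<lambda>p. matrix_norm (matrix_rep \<rho> p)) \<in> cstar_seminorms_on R"
  by (auto simp: cstar_seminorms_on_def cstar_seminorm_def matrix_norm_triangle matrix_norm_scale
      matrix_norm_mult matrix_rep_star[OF sa] matrix_norm_cstar R matrix_norm_eq_0)

definition tens :: "'a::complex_algebra_1 \<Rightarrow> complex m2 \<Rightarrow> 'a m2"
  where "tens a M = M2 (m11 M *\<^sub>C a) (m12 M *\<^sub>C a) (m21 M *\<^sub>C a) (m22 M *\<^sub>C a)"

lemma tens_sel [simp]: "m11 (tens a M) = m11 M *\<^sub>C a" "m12 (tens a M) = m12 M *\<^sub>C a"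
  "m21 (tens a M) = m21 M *\<^sub>C a" "m22 (tens a M) = m22 M *\<^sub>C a"
  by (simp_all add: tens_def)

lemma tens_simps [simp]: "tens a 0 = 0" "tens 1 1 = 1" "tens (a * b) (M * N) = tens a M * tens b N"
  by (rule m2_eqI; simp add: scaleC_one scaleC_add_left mult_scaleC_left mult_scaleC_right
      scaleC_scaleC scaleC_complex_def mult.commute)+

lemma prod_list_tens:
  "length is = length js \<Longrightarrow> prod_list (map2 (\<lambda>i j. tens (y i) (u i j)) is js) =
    tens (prod_list (map y is)) (prod_list (map2 u is js))"
  by (induction "is" js rule: list_induct2) simp_all

lemma m2_sum [simp]: "m11 (sum f I) = (\<Sum>i\<in>I. m11 (f i))" "m12 (sum f I) = (\<Sum>i\<in>I. m12 (f i))"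
  "m21 (sum f I) = (\<Sum>i\<in>I. m21 (f i))" "m22 (sum f I) = (\<Sum>i\<in>I. m22 (f i))"
  by (induction I rule: infinite_finite_induct) auto

text \<open>In a representation the sum over row indices factorises again: it is a product of
  matrix-valued letters, one for each column, to which \<open>\<phi>\<close> is applied
  entrywise.\<close>

lemma Mi_invariant_matrix_identity:
  assumes inv: "Mi_invariant \<phi> y n k" and sa: "\<And>g. mstar (\<rho> g) = \<rho> g"
    and R: "\<And>r. r \<in> Mi_relators n k \<Longrightarrow> matrix_rep \<rho> r = 0"
    and A: "csubspace A" "linear_on A \<phi>" "\<And>js. prod_list (map y js) \<in> A"
    and js: "set js \<subseteq> {1..k}"
  defines "P \<equiv> (\<Sum>i=1..n. \<rho> (i, 1))"
  shows "\<phi> (prod_list (map y js)) *\<^sub>C P =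
    P * map_m2 \<phi> (prod_list (map (\<lambda>j. \<Sum>i=1..n. tens (y i) (\<rho> (i, j))) js)) * P"
proof -
  let ?\<mu> = "joint_distribution \<phi> y"
  have \<mu>_word: "?\<mu> (Poly_Mapping.single (Word js) 1) = \<phi> (prod_list (map y js))" for js
    by (simp add: joint_distribution_def nc_eval_single scaleC_one)
  have p: "Poly_Mapping.single (Word js) 1 \<in> nc_polys k" using js by (simp add: nc_polys_def)
  have P: "matrix_rep \<rho> (Mi_P n 1) = P" by (simp add: Mi_P_def P_def)
  have word: "matrix_rep \<rho> (word_product is js) = prod_list (map2 (\<lambda>i j. \<rho> (i, j)) is js)"
    if "length is = length js" for "is"
    using that
  proof (induction "is" js rule: list_induct2)
    case Nil
    then show ?case by (simp add: matrix_rep_def nc_eval_1)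
  qed simp
  have "Mi_class n k (?\<mu> (Poly_Mapping.single (Word js) 1) *\<^sub>C Mi_P n 1) =
    Mi_class n k (Mi_P n 1 * slice_map ?\<mu> (Mi_\<alpha> n (Poly_Mapping.single (Word js) 1)) * Mi_P n 1)"
    using inv p unfolding Mi_invariant_def by blast
  from Mi_class_eqD[OF this matrix_rep_seminorm[OF sa R]]
  have "\<phi> (prod_list (map y js)) *\<^sub>C P = P * matrix_rep \<rho> (slice_map ?\<mu> (Mi_\<alpha> n (Poly_Mapping.single (Word js) 1))) * P"
    by (simp only: matrix_norm_eq_0 matrix_rep_simps P \<mu>_word right_minus_eq)
  also have "matrix_rep \<rho> (slice_map ?\<mu> (Mi_\<alpha> n (Poly_Mapping.single (Word js) 1))) =
      (\<Sum>is\<in>index_lists n (length js). \<phi> (prod_list (map y is)) *\<^sub>C prod_list (map2 (\<lambda>i j. \<rho> (i, j)) is js))"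
    unfolding slice_map_Mi_\<alpha>_word \<mu>_word matrix_rep_simps
    by (intro sum.cong refl) (simp add: word index_lists_def)
  also have "\<dots> = map_m2 \<phi> (\<Sum>is\<in>index_lists n (length js). tens (prod_list (map y is)) (prod_list (map2 (\<lambda>i j. \<rho> (i, j)) is js)))"
    by (rule m2_eqI) (simp_all add: m2.map_sel linear_on_sum[OF A] scaleC_complex_def mult.commute)
  also have "(\<Sum>is\<in>index_lists n (length js). tens (prod_list (map y is)) (prod_list (map2 (\<lambda>i j. \<rho> (i, j)) is js))) =
      prod_list (map (\<lambda>j. \<Sum>i=1..n. tens (y i) (\<rho> (i, j))) js)"
    unfolding prod_list_sum_expand
    by (intro sum.cong refl) (simp add: index_lists_def prod_list_tens[of _ js y "\<lambda>i j. \<rho> (i, j)"])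
  finally show ?thesis .
qed

text \<open>
  The only representations of the universal algebra that are needed. With \<open>P = Q2 = 1\<close> they give
  ordinary spreadability; with \<open>P\<close> of rank one, in general position to \<open>Q1\<close> and \<open>Q2\<close>, they turn a
  moment into an average in which each block of the letter \<open>j0\<close> independently stays or moves to \<open>j0 + 1\<close>.
\<close>

definition split_rep :: "complex m2 \<Rightarrow> complex m2 \<Rightarrow> complex m2 \<Rightarrow> nat \<Rightarrow> nat \<Rightarrow> nat \<times> nat \<Rightarrow> complex m2"
  where "split_rep P Q1 Q2 k j0 = (\<lambda>(i, j). if j \<notin> {1..k} then 0
    else if j < j0 then (if i = j then P else 0)
    else if j = j0 then (if i = j then Q1 else if i = Suc j then Q2 else 0)
    else (if i = Suc j then 1 else 0))"

text \<open>The matrix-valued letter produced by a column of \<open>split_rep\<close>, written in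
  terms of the original integer indices, with \<open>m\<close> the letter in position
  \<open>j0\<close>.\<close>

definition split_letter 
    :: "complex m2 \<Rightarrow> complex m2 \<Rightarrow> complex m2 \<Rightarrow> (int \<Rightarrow> 'a::complex_algebra_1) \<Rightarrow> int \<Rightarrow> int \<Rightarrow> 'a m2"
  where "split_letter P Q1 Q2 x m i = (if i < m then tens (x i) P
    else if i = m then tens (x m) Q1 + tens (x (m + 1)) Q2 else tens (x (i + 1)) 1)"

context
  fixes P Q1 Q2 :: "complex m2"
  assumes P: "mstar P = P" "P * P = P" and Q1: "mstar Q1 = Q1" "Q1 * Q1 = Q1"
    and Q2: "mstar Q2 = Q2" "Q2 * Q2 = Q2" and Q: "Q1 + Q2 = 1"
begin

lemma split_rep_selfadjoint: "mstar (split_rep P Q1 Q2 k j0 g) = split_rep P Q1 Q2 k j0 g"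
  using P Q1 Q2 by (auto simp: split_rep_def split: prod.splits)

lemma split_rep_idem: "split_rep P Q1 Q2 k j0 g * split_rep P Q1 Q2 k j0 g = split_rep P Q1 Q2 k j0 g"
  using P Q1 Q2 by (auto simp: split_rep_def split: prod.splits)

lemma sum_split_rep:
  fixes f :: "nat \<Rightarrow> complex m2 \<Rightarrow> 'b::comm_monoid_add"
  assumes f0: "\<And>i. f i 0 = 0" and j: "j \<in> {1..k}" and j0: "1 \<le> j0"
  shows "(\<Sum>i=1..Suc k. f i (split_rep P Q1 Q2 k j0 (i, j))) =
    (if j < j0 then f j P else if j = j0 then f j Q1 + f (Suc j) Q2 else f (Suc j) 1)"
proof -
  have "(\<Sum>i=1..Suc k. f i (split_rep P Q1 Q2 k j0 (i, j))) = (\<Sum>i\<in>{j, Suc j}. f i (split_rep P Q1 Q2 k j0 (i, j)))"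
    using j by (intro sum.mono_neutral_right) (auto simp: split_rep_def f0)
  also have "\<dots> = f j (split_rep P Q1 Q2 k j0 (j, j)) + f (Suc j) (split_rep P Q1 Q2 k j0 (Suc j, j))" by simp
  finally show ?thesis using j by (auto simp: split_rep_def f0)
qed

lemma split_rep_P:
  assumes "j \<in> {1..k}" "1 \<le> j0"
  shows "matrix_rep (split_rep P Q1 Q2 k j0) (Mi_P (Suc k) j) = (if j < j0 then P else 1)"
  using sum_split_rep[of "\<lambda>i M. M" j k j0] assms Q by (simp add: Mi_P_def del: sum.cl_ivl_Suc)

text \<open>Nonzero entries have \<open>i = j\<close>, which needs \<open>j \<le> j0\<close>, or
  \<open>i = Suc j\<close>, which needs \<open>j0 \<le> j\<close>. Hence rows of nonzero entries
  increase strictly with the column.\<close>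

lemma split_rep_increasing:
  assumes "j < j'" "i' \<le> i"
  shows "split_rep P Q1 Q2 k j0 (i, j) = 0 \<or> split_rep P Q1 Q2 k j0 (i', j') = 0"
  using assms by (auto simp: split_rep_def)

text \<open>Either the column sum is \<open>1\<close>, or \<open>j\<close> and with it
  \<open>j'\<close> lie below \<open>j0\<close>, where the only entries are \<open>0\<close> and the
  projection \<open>P\<close> itself.\<close>

lemma split_rep_absorb:
  assumes "j \<in> {1..k}" "1 \<le> j0" "j' \<le> j"
  shows "matrix_rep (split_rep P Q1 Q2 k j0) (Mi_P (Suc k) j) * split_rep P Q1 Q2 k j0 (i', j') = split_rep P Q1 Q2 k j0 (i', j')"
  unfolding split_rep_P[OF assms(1,2)] using assms P(2) by (auto simp: split_rep_def)

lemma split_rep_relators: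
  assumes j0: "1 \<le> j0" and k: "1 \<le> k" and r: "r \<in> Mi_relators (Suc k) k"
  shows "matrix_rep (split_rep P Q1 Q2 k j0) r = 0"
proof -
  let ?\<rho> = "split_rep P Q1 Q2 k j0" and ?n = "Suc k"
  have out: "?\<rho> (i, j) = 0" if "i \<notin> {1..Suc k} \<or> j \<notin> {1..k}" for i j
  proof (cases "j \<in> {1..k}")
    case True
    then have "i \<noteq> j" "i \<noteq> Suc j" using that by auto
    then show ?thesis by (simp add: split_rep_def)
  qed (simp add: split_rep_def)
  have PP: "matrix_rep ?\<rho> (Mi_P ?n j) * matrix_rep ?\<rho> (Mi_P ?n 1) = matrix_rep ?\<rho> (Mi_P ?n 1)"
    if "j \<in> {1..k}" for j
    using split_rep_P[OF that j0] split_rep_P[of 1 k j0] j0 k that P(2) by auto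
  have outside: "matrix_rep ?\<rho> (Mi_u i j) = 0" if "i \<notin> {1..?n} \<or> j \<notin> {1..k}" for i j
    using out[OF that] by simp
  have star: "matrix_rep ?\<rho> (free_star (Mi_u i j) - Mi_u i j) = 0" for i j
    by (simp only: matrix_rep_simps matrix_rep_star[of ?\<rho>, OF split_rep_selfadjoint]
        split_rep_selfadjoint diff_self)
  have idem: "matrix_rep ?\<rho> (Mi_u i j * Mi_u i j - Mi_u i j) = 0" for i j
    by (simp add: split_rep_idem)
  have absorb: "matrix_rep ?\<rho> (Mi_P ?n j * Mi_u i' j' - Mi_u i' j') = 0" if "j \<in> {1..k}" "j' \<le> j" for j i' j'
    by (simp only: matrix_rep_simps split_rep_absorb[OF that(1) j0 that(2)] diff_self)
  have absorb_P: "matrix_rep ?\<rho> (Mi_P ?n j * Mi_P ?n 1 - Mi_P ?n 1) = 0" if "j \<in> {1..k}" for j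
    by (simp only: matrix_rep_simps PP[OF that] diff_self)
  have incr: "matrix_rep ?\<rho> (Mi_u i j * Mi_u i' j') = 0" if "j < j'" "i' \<le> i" for i j i' j'
    using split_rep_increasing[OF that, of k j0] by auto
  show ?thesis
    using r unfolding Mi_relators_def
    by (elim UnE CollectE exE conjE)
      (erule ssubst, (rule star | rule idem | rule outside, assumption | rule absorb_P, assumption
        | rule absorb, assumption, assumption | rule incr, assumption, assumption))+
qed

text \<open>The word is placed in a finite interval of integers, numbered from \<open>1\<close>, and
  invariance is used with \<open>k + 1\<close> rows: the additional row makes room for the letters
  that move up.\<close>

lemma spreadable_split_identity:
  fixes x :: "int \<Rightarrow> 'a::complex_algebra_1"
  assumes sp: "monotonically_spreadable \<phi> x UNIV"
    and A: "csubspace A" "linear_on A \<phi>" "\<And>ws. prod_list (map x ws) \<in> A"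
  shows "\<phi> (prod_list (map x ws)) *\<^sub>C P = P * map_m2 \<phi> (prod_list (map (split_letter P Q1 Q2 x m) ws)) * P"
proof -
  let ?W = "insert m (set ws)"
  \<comment> \<open>The offset \<open>2\<close> puts \<open>m\<close> at position at least
    \<open>2\<close>. Then column \<open>1\<close> lies below \<open>j0\<close> and
    \<open>Mi_P n 1\<close> is represented by \<open>P\<close>; at position \<open>1\<close> it
    would be represented by \<open>Q1 + Q2 = 1\<close>.\<close>
  define o' where "o' = Min ?W - 2"
  have o': "o' + 2 \<le> i" if "i \<in> ?W" for i
    unfolding o'_def using Min_le[of ?W i] that by simp
  define k where "k = nat (Max ?W - o')"
  have k: "i - o' \<le> int k" if "i \<in> ?W" for i
  proof -
    have "i \<le> Max ?W" using that by (intro Max_ge) auto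
    then show ?thesis using o'[OF that] by (simp add: k_def)
  qed
  define s where "s j = o' + int j" for j
  define y where "y = x \<circ> s"
  define j0 where "j0 = nat (m - o')"
  have j0: "2 \<le> j0" "j0 \<le> k" "m = s j0"
    using o'[of m] k[of m] by (auto simp: j0_def s_def)
  define js where "js = map (\<lambda>i. nat (i - o')) ws"
  have js: "set js \<subseteq> {1..k}"
    using o' k by (force simp: js_def)
  have sjs: "map s js = ws"
  proof -
    have "o' \<le> i" if "i \<in> set ws" for i using o'[of i] that by simp
    then show ?thesis by (auto simp: js_def s_def intro!: map_idI)
  qed
  have sp': "monotonically_spreadable_fin \<phi> y (Suc k)"
    using sp unfolding monotonically_spreadable_def y_def
    by (auto simp: s_def strict_mono_on_def)
  then have inv: "Mi_invariant \<phi> y (Suc k) k"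
    using j0 unfolding monotonically_spreadable_fin_def by auto
  have P1: "(\<Sum>i=1..Suc k. split_rep P Q1 Q2 k j0 (i, 1)) = P"
    using sum_split_rep[of "\<lambda>i M. M" 1 k j0] j0 by simp
  have letter: "(\<Sum>i=1..Suc k. tens (y i) (split_rep P Q1 Q2 k j0 (i, j))) = split_letter P Q1 Q2 x m (s j)" if "j \<in> set js" for j
    using sum_split_rep[of "\<lambda>i M. tens (y i) M" j k j0] js that j0
    by (auto simp: split_letter_def y_def s_def algebra_simps simp del: sum.cl_ivl_Suc)
  have "\<phi> (prod_list (map y js)) *\<^sub>C (\<Sum>i=1..Suc k. split_rep P Q1 Q2 k j0 (i, 1)) = (\<Sum>i=1..Suc k. split_rep P Q1 Q2 k j0 (i, 1)) *
      map_m2 \<phi> (prod_list (map (\<lambda>j. \<Sum>i=1..Suc k. tens (y i) (split_rep P Q1 Q2 k j0 (i, j))) js)) *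
      (\<Sum>i=1..Suc k. split_rep P Q1 Q2 k j0 (i, 1))"
  proof (rule Mi_invariant_matrix_identity[OF inv split_rep_selfadjoint _ A(1,2) _ js])
    show "matrix_rep (split_rep P Q1 Q2 k j0) r = 0" if "r \<in> Mi_relators (Suc k) k" for r
      using split_rep_relators[OF _ _ that] j0 by simp
    show "prod_list (map y js) \<in> A" for js using A(3)[of "map s js"] by (simp add: y_def)
  qed
  moreover have "map (\<lambda>j. \<Sum>i=1..Suc k. tens (y i) (split_rep P Q1 Q2 k j0 (i, j))) js = map (split_letter P Q1 Q2 x m) ws"
    unfolding sjs[symmetric] map_map o_def by (intro map_cong refl letter)
  moreover have "map y js = map x ws" by (simp add: y_def sjs[symmetric])
  ultimately show ?thesis unfolding P1 by simp
qed

end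

definition shift_above :: "int \<Rightarrow> int \<Rightarrow> int"
  where "shift_above m i = (if i < m then i else i + 1)"

lemma spreadable_shift:
  fixes x :: "int \<Rightarrow> 'a::complex_algebra_1"
  assumes sp: "monotonically_spreadable \<phi> x UNIV"
    and A: "csubspace A" "linear_on A \<phi>" "\<And>ws. prod_list (map x ws) \<in> A"
  shows "\<phi> (prod_list (map x ws)) = \<phi> (prod_list (map (x \<circ> shift_above m) ws))"
proof -
  have "\<phi> (prod_list (map x ws)) *\<^sub>C 1 = 1 * map_m2 \<phi> (prod_list (map (split_letter 1 0 1 x m) ws)) * 1"
    by (rule spreadable_split_identity[OF _ _ _ _ _ _ _ sp A]) simp_all
  moreover have "prod_list (map (split_letter 1 0 1 x m) ws) = tens (prod_list (map (x \<circ> shift_above m) ws)) 1"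
    by (induction ws) (simp_all add: split_letter_def shift_above_def flip: tens_simps(3))
  ultimately have "m11 (\<phi> (prod_list (map x ws)) *\<^sub>C (1 :: complex m2)) =
      m11 (map_m2 \<phi> (tens (prod_list (map (x \<circ> shift_above m) ws)) 1))"
    by simp
  then show ?thesis by (simp add: m2.map_sel scaleC_complex_def scaleC_one)
qed

text \<open>The projection onto the line spanned by \<open>(1, 1)\<close>. Its constant entries
  connect all pairs of diagonal positions with the same weight.\<close>

definition half_matrix :: "complex m2"
  where "half_matrix = M2 (1/2) (1/2) (1/2) (1/2)"

text \<open>The value of the form of \<open>M\<close> at the vector \<open>(1, 1)\<close>: for
  complex \<open>M\<close>, compression by \<open>half_matrix\<close> gives
  \<open>entry_sum M / 2\<close> times \<open>half_matrix\<close>.\<close>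

definition entry_sum :: "'a::complex_algebra_1 m2 \<Rightarrow> 'a"
  where "entry_sum M = m11 M + m12 M + m21 M + m22 M"

abbreviation spread_letter :: "(int \<Rightarrow> 'a::complex_algebra_1) \<Rightarrow> int \<Rightarrow> int \<Rightarrow> 'a m2"
  where "spread_letter \<equiv> split_letter half_matrix (M2 1 0 0 0) (M2 0 0 0 1)"

lemma spreadable_split:
  fixes x :: "int \<Rightarrow> 'a::complex_algebra_1"
  assumes sp: "monotonically_spreadable \<phi> x UNIV"
    and A: "csubspace A" "linear_on A \<phi>" "\<And>ws. prod_list (map x ws) \<in> A"
  shows "\<phi> (prod_list (map x ws)) = entry_sum (map_m2 \<phi> (prod_list (map (spread_letter x m) ws))) / 2"
proof -
  let ?N = "map_m2 \<phi> (prod_list (map (spread_letter x m) ws))"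
  have *: "m11 (half_matrix * N * half_matrix) = entry_sum N / 4" for N
    by (simp add: half_matrix_def entry_sum_def field_simps)
  have "\<phi> (prod_list (map x ws)) *\<^sub>C half_matrix = half_matrix * ?N * half_matrix"
    by (rule spreadable_split_identity[OF _ _ _ _ _ _ _ sp A])
      (rule m2_eqI; simp add: half_matrix_def mstar_def)+
  then have "m11 (\<phi> (prod_list (map x ws)) *\<^sub>C half_matrix) = m11 (half_matrix * ?N * half_matrix)"
    by (rule arg_cong)
  also have "\<dots> = entry_sum ?N / 4"
    by (rule *)
  finally show ?thesis by (simp add: half_matrix_def scaleC_complex_def mult.commute)
qed

section \<open>Spreadability implies independence\<close>

text \<open>A vector state on all operators together with totality of the word vectors. Nonempty
  words are demanded because the generated algebra has no unit; a nonempty test word also supplies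
  the lower neighbour that a peak at the end of a product lacks.\<close>

locale spreadable_sequence =
  fixes \<Omega> :: "'h::chilbert_space" and x :: "int \<Rightarrow> 'h cop"
  assumes spreadable: "monotonically_spreadable (\<lambda>a. cinner \<Omega> (cop_apply a \<Omega>)) x UNIV"
    and adj_x [simp]: "adj (x i) = x i"
    and total_words: "total {cop_apply (prod_list (map x ws)) \<Omega> | ws. ws \<noteq> []}"
begin

definition ev :: "'h cop \<Rightarrow> complex"
  where "ev a = cinner \<Omega> (cop_apply a \<Omega>)"

lemma ev_linear [simp]: "ev (a + b) = ev a + ev b" "ev (a - b) = ev a - ev b"
  "ev (c *\<^sub>C a) = c * ev a" "ev 0 = 0"
  by (simp_all add: ev_def cinner_simps)

definition word :: "int list \<Rightarrow> 'h cop"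
  where "word ws = prod_list (map x ws)"

lemma word_simps [simp]: "word [] = 1" "word (i # ws) = x i * word ws" "word (v @ w) = word v * word w"
  by (simp_all add: word_def)

lemma adj_word [simp]: "adj (word ws) = word (rev ws)"
  by (induction ws) simp_all

definition word_vector :: "int list \<Rightarrow> 'h"
  where "word_vector ws = cop_apply (word ws) \<Omega>"

lemma cinner_word_vector: "cinner (word_vector v) (cop_apply a (word_vector w)) = ev (word (rev v) * a * word w)"
proof -
  have "cinner (word_vector v) (cop_apply a (word_vector w)) =
      cinner \<Omega> (cop_apply (adj (word v)) (cop_apply a (word_vector w)))"
    unfolding cinner_adj_right by (simp add: word_vector_def)
  then show ?thesis by (simp add: ev_def word_vector_def)
qed

lemma total_word_vector: "total (range word_vector)"
  by (rule total_mono[OF total_words]) (auto simp: word_vector_def word_def)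

lemma total_nonempty: "total (word_vector ` {ws. ws \<noteq> []})"
  by (rule total_mono[OF total_words]) (auto simp: word_vector_def word_def)

lemma csubspace_UNIV: "csubspace UNIV" and linear_ev: "linear_on UNIV ev"
  by (auto simp: csubspace_def linear_on_def scaleC_complex_def)

lemma spreadable': "monotonically_spreadable ev x UNIV"
  using spreadable by (simp add: ev_def[abs_def])

lemma ev_shift_above: "ev (word ws) = ev (word (map (shift_above m) ws))"
  using spreadable_shift[OF spreadable' csubspace_UNIV linear_ev, of ws m] by (simp add: word_def)

lemma ev_shift: "ev (word ws) = ev (word (map (\<lambda>i. i + 1) ws))"
proof -
  have "map (shift_above (Min (set (0 # ws)))) ws = map (\<lambda>i. i + 1) ws"
    by (auto simp: shift_above_def)
  then show ?thesis using ev_shift_above[of ws "Min (set (0 # ws))"] by metis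
qed

text \<open>Inner products of word vectors are moments, so invariance of moments under the shift
  equates two Gram matrices. Since the sequence is bilateral, every word is a shifted word, which
  makes the images total.\<close>

lemma shift_unitary_exists:
  "\<exists>U. U * adj U = 1 \<and> adj U * U = 1 \<and> (\<forall>ws. cop_apply U (word_vector ws) = word_vector (map (\<lambda>i. i + 1) ws))"
proof -
  let ?g = "\<lambda>ws. word_vector (map (\<lambda>i. i + 1) ws)"
  have "cinner (word_vector v) (word_vector w) = cinner (?g v) (?g w)" for v w
    using cinner_word_vector[of v 1 w] cinner_word_vector[of "map (\<lambda>i. i + 1) v" 1 "map (\<lambda>i. i + 1) w"]
      ev_shift[of "rev v @ w"] by (simp add: rev_map)
  moreover have "total (range ?g)"
  proof (rule total_mono[OF total_word_vector])
    have "word_vector ws = ?g (map (\<lambda>i. i - 1) ws)" for ws by (simp add: o_def)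
    then show "range word_vector \<subseteq> range ?g" by blast
  qed
  ultimately show ?thesis
    using unitary_from_gram[OF _ total_word_vector, of ?g] by metis
qed

definition shift_unitary :: "'h cop"
  where "shift_unitary = (SOME U. U * adj U = 1 \<and> adj U * U = 1 \<and>
    (\<forall>ws. cop_apply U (word_vector ws) = word_vector (map (\<lambda>i. i + 1) ws)))"

lemma shift_unitary: "shift_unitary * adj shift_unitary = 1" "adj shift_unitary * shift_unitary = 1"
  "cop_apply shift_unitary (word_vector ws) = word_vector (map (\<lambda>i. i + 1) ws)"
  using someI_ex[OF shift_unitary_exists] unfolding shift_unitary_def by auto

lemma adj_shift_unitary_word: "cop_apply (adj shift_unitary) (word_vector (map (\<lambda>i. i + 1) ws)) = word_vector ws"
  using shift_unitary(2) shift_unitary(3)[of ws] by (metis cop_apply_simps(2,6))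

definition \<alpha> :: "'h cop \<Rightarrow> 'h cop"
  where "\<alpha> a = shift_unitary * a * adj shift_unitary"

lemma \<alpha>_simps [simp]: "\<alpha> (a + b) = \<alpha> a + \<alpha> b" "\<alpha> (a - b) = \<alpha> a - \<alpha> b" "\<alpha> (c *\<^sub>C a) = c *\<^sub>C \<alpha> a"
  "\<alpha> 1 = 1" "\<alpha> 0 = 0" "\<alpha> (adj a) = adj (\<alpha> a)"
  by (simp_all add: \<alpha>_def algebra_simps mult_scaleC_left mult_scaleC_right shift_unitary(1))

lemma \<alpha>_mult [simp]: "\<alpha> (a * b) = \<alpha> a * \<alpha> b"
proof -
  have "\<alpha> a * \<alpha> b = shift_unitary * a * (adj shift_unitary * shift_unitary) * b * adj shift_unitary"
    by (simp only: \<alpha>_def mult.assoc)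
  then show ?thesis by (simp add: shift_unitary(2) \<alpha>_def mult.assoc)
qed

lemma \<alpha>_x [simp]: "\<alpha> (x i) = x (i + 1)"
proof (rule cop_eqI_total[OF total_word_vector])
  fix v w assume "w \<in> range word_vector"
  then obtain ws where ws: "w = word_vector (map (\<lambda>i. i + 1) (map (\<lambda>i. i - 1) ws))"
    by (auto simp: o_def)
  have "x i * word vs = word (i # vs)" for i vs by simp
  then have "cop_apply (x i) (word_vector vs) = word_vector (i # vs)" for i vs
    unfolding word_vector_def by (metis cop_apply_simps(6))
  then show "cinner v (cop_apply (\<alpha> (x i)) w) = cinner v (cop_apply (x (i + 1)) w)"
    unfolding ws by (simp add: \<alpha>_def adj_shift_unitary_word shift_unitary(3) del: map_map)
qed

lemma ev_\<alpha> [simp]: "ev (\<alpha> a) = ev a"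
proof -
  have "cop_apply (adj shift_unitary) \<Omega> = \<Omega>"
    using adj_shift_unitary_word[of "[]"] by (simp add: word_vector_def)
  moreover have "ev (\<alpha> a) = cinner (cop_apply (adj shift_unitary) \<Omega>) (cop_apply a (cop_apply (adj shift_unitary) \<Omega>))"
    by (simp add: ev_def \<alpha>_def)
  ultimately show ?thesis by (simp add: ev_def)
qed

lemma continuous_map_\<alpha>: "continuous_map wot wot \<alpha>"
  unfolding \<alpha>_def
  using continuous_map_compose[OF continuous_map_wot_mult_left continuous_map_wot_mult_right]
  by (simp add: o_def)

lemma norm_unitary:
  assumes "adj V * V = 1" shows "norm (cop_apply V v) = norm v"
proof -
  have "cinner (cop_apply V v) (cop_apply V v) = cinner (cop_apply (adj V * V) v) v"
    by simp
  then have "(norm (cop_apply V v))\<^sup>2 = (norm v)\<^sup>2"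
    unfolding assms norm_squared_cinner by simp
  then show ?thesis by simp
qed

text \<open>Conjugation by a unitary preserves operator bounds. This uniform bound is what the
  existence of the weak limit requires.\<close>

lemma \<alpha>_power_bound:
  assumes "\<And>v. norm (cop_apply a v) \<le> K * norm v"
  shows "norm (cop_apply ((\<alpha> ^^ n) a) v) \<le> K * norm v"
proof (induction n arbitrary: v)
  case (Suc n)
  have "norm (cop_apply (\<alpha> ((\<alpha> ^^ n) a)) v) = norm (cop_apply ((\<alpha> ^^ n) a) (cop_apply (adj shift_unitary) v))"
    by (simp add: \<alpha>_def norm_unitary shift_unitary(2))
  also have "\<dots> \<le> K * norm (cop_apply (adj shift_unitary) v)" by (rule Suc)
  also have "\<dots> = K * norm v" using norm_unitary[of "adj shift_unitary"] by (simp add: shift_unitary(1))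
  finally show ?case by simp
qed (simp add: assms)

lemma \<alpha>_power_simps [simp]:
  "(\<alpha> ^^ n) (a + b) = (\<alpha> ^^ n) a + (\<alpha> ^^ n) b" "(\<alpha> ^^ n) (a - b) = (\<alpha> ^^ n) a - (\<alpha> ^^ n) b"
  "(\<alpha> ^^ n) (c *\<^sub>C a) = c *\<^sub>C (\<alpha> ^^ n) a" "(\<alpha> ^^ n) (a * b) = (\<alpha> ^^ n) a * (\<alpha> ^^ n) b"
  "(\<alpha> ^^ n) 1 = 1" "(\<alpha> ^^ n) (adj a) = adj ((\<alpha> ^^ n) a)" "(\<alpha> ^^ n) 0 = 0"
  "(\<alpha> ^^ n) (x i) = x (i + int n)" "ev ((\<alpha> ^^ n) a) = ev a"
  by (induction n) (simp_all add: add_ac)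

section \<open>The shift on the future algebras and on the tail\<close>

lemma future_subalgebra: "subalgebra (future_algebra x k)"
  unfolding future_algebra_def by (rule subalgebra_wot_closure[OF subalgebra_hull])

lemma future_closed: "closedin wot (future_algebra x k)"
  unfolding future_algebra_def by (rule closedin_closure_of)

lemma future_antimono: "k \<le> k' \<Longrightarrow> future_algebra x k' \<subseteq> future_algebra x k"
  unfolding future_algebra_def by (intro closure_of_mono hull_mono image_mono) auto

lemma x_future: "k \<le> i \<Longrightarrow> x i \<in> future_algebra x k"
  unfolding future_algebra_def by (intro wot_closure_incr hull_inc) auto

text \<open>Linear and weakly closed properties need to be checked on nonempty words only, because
  those span a weakly dense subspace of the future algebra.\<close>

lemma future_word_induct:
  assumes a: "a \<in> future_algebra x k" and Z: "csubspace Z"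
    and words: "\<And>ws. ws \<noteq> [] \<Longrightarrow> set ws \<subseteq> {k..} \<Longrightarrow> word ws \<in> Z"
    and cl: "wot closure_of Z \<subseteq> Z"
  shows "a \<in> Z"
proof -
  have "subalgebra hull (x ` {k..}) \<subseteq> Z"
  proof (rule subalgebra_hull_subset_csubspace[OF Z])
    fix ws assume ws: "ws \<noteq> []" "set ws \<subseteq> x ` {k..}"
    then have "ws \<in> map x ` lists {k..}"
      unfolding lists_image[symmetric] by (simp add: lists_eq_set)
    then obtain vs where "ws = map x vs" "set vs \<subseteq> {k..}"
      by (auto simp: lists_eq_set)
    then show "prod_list ws \<in> Z" using words[of vs] ws by (simp add: word_def)
  qed
  then have "future_algebra x k \<subseteq> wot closure_of Z"
    unfolding future_algebra_def by (rule closure_of_mono)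
  then show ?thesis using a cl by blast
qed

lemma future_\<alpha>: "a \<in> future_algebra x k \<Longrightarrow> \<alpha> a \<in> future_algebra x (k + 1)"
  unfolding future_algebra_def
proof (rule wot_closure_image[OF continuous_map_\<alpha>])
  have "subalgebra {a. \<alpha> a \<in> subalgebra hull (x ` {k + 1..})}"
    using subalgebra_hull[of "x ` {k + 1..}"] by (auto simp: subalgebra_def)
  then have "subalgebra hull (x ` {k..}) \<subseteq> {a. \<alpha> a \<in> subalgebra hull (x ` {k + 1..})}"
    by (intro hull_minimal) (auto intro: hull_inc)
  then show "\<alpha> a \<in> wot closure_of (subalgebra hull (x ` {k + 1..}))" if "a \<in> subalgebra hull (x ` {k..})" for a
    using that by (blast intro: wot_closure_incr)
qed

lemma future_\<alpha>_power: "a \<in> future_algebra x k \<Longrightarrow> (\<alpha> ^^ n) a \<in> future_algebra x (k + int n)"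
proof (induction n)
  case (Suc n)
  then show ?case using future_\<alpha>[of "(\<alpha> ^^ n) a" "k + int n"] by (simp add: algebra_simps)
qed simp

lemma future_adj: "a \<in> future_algebra x k \<Longrightarrow> adj a \<in> future_algebra x k"
  unfolding future_algebra_def
proof (rule wot_closure_image[OF continuous_map_wot_adj])
  have "subalgebra {a. adj a \<in> subalgebra hull (x ` {k..})}"
    using subalgebra_hull[of "x ` {k..}"] by (auto simp: subalgebra_def)
  then have "subalgebra hull (x ` {k..}) \<subseteq> {a. adj a \<in> subalgebra hull (x ` {k..})}"
    by (intro hull_minimal) (auto intro: hull_inc)
  then show "adj a \<in> wot closure_of (subalgebra hull (x ` {k..}))" if "a \<in> subalgebra hull (x ` {k..})" for a
    using that by (blast intro: wot_closure_incr)
qed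

abbreviation tail :: "'h cop set" where "tail \<equiv> tail_algebra x"

lemma tail_subset: "tail \<subseteq> future_algebra x k"
proof -
  have "tail \<subseteq> future_algebra x (max k 1)" by (auto simp: tail_algebra_def)
  also have "\<dots> \<subseteq> future_algebra x k" by (rule future_antimono) simp
  finally show ?thesis .
qed

lemma tailI: "(\<And>k. a \<in> future_algebra x k) \<Longrightarrow> a \<in> tail"
  by (auto simp: tail_algebra_def)

lemma tail_subalgebra: "subalgebra tail"
  unfolding tail_algebra_def using future_subalgebra by (intro subalgebra_Inter) auto

lemma tail_adj: "a \<in> tail \<Longrightarrow> adj a \<in> tail"
  by (auto simp: tail_algebra_def intro: future_adj)

text \<open>Polynomial coefficients may be scalars, and the tail algebra may lack the unit of the
  operator algebra.\<close>

definition unital :: "'h cop set \<Rightarrow> 'h cop set"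
  where "unital B = {b + c *\<^sub>C 1 | b c. b \<in> B}"

lemma unital_mono: "B \<subseteq> C \<Longrightarrow> unital B \<subseteq> unital C"
  by (auto simp: unital_def)

lemma unitalI: "b \<in> B \<Longrightarrow> b \<in> unital B" and unital_scalar: "0 \<in> B \<Longrightarrow> c *\<^sub>C 1 \<in> unital B"
proof -
  show "b \<in> B \<Longrightarrow> b \<in> unital B"
    unfolding unital_def by (intro CollectI exI[of _ b] exI[of _ 0]) simp
  show "0 \<in> B \<Longrightarrow> c *\<^sub>C 1 \<in> unital B"
    unfolding unital_def by (intro CollectI exI[of _ 0] exI[of _ c]) simp
qed

text \<open>A pair consists of a factor of a moment and the matrix that replaces it; products are
  formed in parallel. In this form one substitution rule applies to letters, tail elements and weak
  limits alike.\<close>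

definition pairs :: "('h cop \<times> 'h cop m2) set \<Rightarrow> ('h cop \<times> 'h cop m2) set"
  where "pairs R = {(prod_list (map fst l), prod_list (map snd l)) | l. set l \<subseteq> R}"

text \<open>\<open>ev (entry_sum M) / 2\<close> is the value of \<open>M\<close> in the vector state of \<open>(\<Omega>, \<Omega>) / sqrt 2\<close>.\<close>

definition matched :: "('h cop \<times> 'h cop m2) set \<Rightarrow> bool"
  where "matched R \<longleftrightarrow> (\<forall>(a, M)\<in>pairs R. ev (2 *\<^sub>C a) = ev (entry_sum M))"

lemma pairs_base: "p \<in> R \<Longrightarrow> p \<in> pairs R"
  unfolding pairs_def by (intro CollectI exI[of _ "[p]"]) auto

lemma pairs_one: "(1, 1) \<in> pairs R"
  unfolding pairs_def by (intro CollectI exI[of _ "[]"]) auto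

lemma pairs_mult: "(a, M) \<in> pairs R \<Longrightarrow> (b, N) \<in> pairs R \<Longrightarrow> (a * b, M * N) \<in> pairs R"
proof -
  assume "(a, M) \<in> pairs R" "(b, N) \<in> pairs R"
  then obtain l l' where "a = prod_list (map fst l)" "M = prod_list (map snd l)" "set l \<subseteq> R"
      "b = prod_list (map fst l')" "N = prod_list (map snd l')" "set l' \<subseteq> R"
    unfolding pairs_def by auto
  then show ?thesis unfolding pairs_def by (intro CollectI exI[of _ "l @ l'"]) auto
qed

lemma matchedD: "matched R \<Longrightarrow> (a, M) \<in> pairs R \<Longrightarrow> 2 * ev a = ev (entry_sum M)"
  unfolding matched_def by force

lemma entry_sum_tens_1:
  "entry_sum (N * tens a 1 * N') = (m11 N + m21 N) * a * (m11 N' + m12 N') + (m12 N + m22 N) * a * (m21 N' + m22 N')"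
  by (simp add: entry_sum_def algebra_simps scaleC_one)

lemma continuous_map_ev: "continuous_map wot euclidean (\<lambda>a. ev (b * \<alpha> a * c))"
proof -
  have "continuous_map wot wot (\<lambda>a. b * \<alpha> a * c)"
    using continuous_map_compose[OF continuous_map_compose[OF continuous_map_\<alpha> continuous_map_wot_mult_left]
        continuous_map_wot_mult_right] by (simp add: o_def)
  from continuous_map_compose[OF this continuous_map_wot_coeff]
  show ?thesis by (simp add: ev_def o_def)
qed

lemma continuous_map_ev': "continuous_map wot euclidean (\<lambda>a. ev (b * a * c))"
proof -
  have "continuous_map wot wot (\<lambda>a. b * a * c)"
    using continuous_map_compose[OF continuous_map_wot_mult_left continuous_map_wot_mult_right]
    by (simp add: o_def)
  from continuous_map_compose[OF this continuous_map_wot_coeff]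
  show ?thesis by (simp add: ev_def o_def)
qed

abbreviation lift_\<alpha> :: "'h cop \<Rightarrow> 'h cop m2" where "lift_\<alpha> a \<equiv> tens (\<alpha> a) 1"

text \<open>The slots of a moment identity are extended to the weak closure one at a time.\<close>

lemma matched_extend:
  assumes R: "matched (R \<union> (\<lambda>i. (x i, lift_\<alpha> (x i))) ` {k..})"
  shows "matched (R \<union> (\<lambda>a. (a, lift_\<alpha> a)) ` unital (future_algebra x k))"
proof -
  let ?R0 = "R \<union> (\<lambda>i. (x i, lift_\<alpha> (x i))) ` {k..}"
  let ?R1 = "R \<union> (\<lambda>a. (a, lift_\<alpha> a)) ` unital (future_algebra x k)"
  let ?f = "\<lambda>l :: ('h cop \<times> 'h cop m2) list. prod_list (map fst l)"
  let ?s = "\<lambda>l :: ('h cop \<times> 'h cop m2) list. prod_list (map snd l)"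
  let ?id = "\<lambda>l. ev (2 *\<^sub>C ?f l) = ev (entry_sum (?s l))"
  \<comment> \<open>Slots in \<open>l1\<close> are already extended, those in \<open>l2\<close> are
    still original ones. With the other slots fixed, the identity is linear and weakly continuous in
    the slot at hand and passes from words to their closure.\<close>
  have claim: "?id (l1 @ l2)" if "set l1 \<subseteq> ?R1" "set l2 \<subseteq> ?R0" for l1 l2
    using that
  proof (induction l1 arbitrary: l2 rule: rev_induct)
    case Nil
    then have "(?f l2, ?s l2) \<in> pairs ?R0" unfolding pairs_def by blast
    then show ?case using R unfolding matched_def by auto
  next
    case (snoc p l1)
    show ?case
    proof (cases "p \<in> R")
      case True
      then show ?thesis using snoc.IH[of "p # l2"] snoc.prems by simp
    next
      case False
      then obtain a where a: "p = (a, lift_\<alpha> a)" "a \<in> unital (future_algebra x k)"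
        using snoc.prems by auto
      \<comment> \<open>As \<open>lift_\<alpha> a\<close> is diagonal, only the column sums of the
        left factor and the row sums of the right factor enter.\<close>
      define r1 r2 where "r1 = m11 (?s l1) + m21 (?s l1)" and "r2 = m12 (?s l1) + m22 (?s l1)"
      define c1 c2 where "c1 = m11 (?s l2) + m12 (?s l2)" and "c2 = m21 (?s l2) + m22 (?s l2)"
      have expand: "entry_sum (?s l1 * lift_\<alpha> a * ?s l2) = r1 * \<alpha> a * c1 + r2 * \<alpha> a * c2" for a
        unfolding entry_sum_tens_1 r1_def r2_def c1_def c2_def ..
      define Z where "Z = {a. ev (2 *\<^sub>C (?f l1 * a * ?f l2)) = ev (entry_sum (?s l1 * lift_\<alpha> a * ?s l2))}"
      have Z: "csubspace Z"
      proof (rule csubspaceI)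
        fix c a assume "a \<in> Z"
        then show "c *\<^sub>C a \<in> Z"
          by (simp add: Z_def expand mult_scaleC_left mult_scaleC_right mult.left_commute[of 2] flip: distrib_left)
      qed (auto simp: Z_def expand distrib_left distrib_right)
      have words: "word ws \<in> Z" if "set ws \<subseteq> {k..}" for ws
      proof -
        let ?l = "map (\<lambda>i. (x i, lift_\<alpha> (x i))) ws"
        have "?id (l1 @ (?l @ l2))" using that snoc.prems by (intro snoc.IH) auto
        moreover have "?f ?l = word ws" by (simp add: word_def o_def)
        moreover have "?s ?l = lift_\<alpha> (word ws)"
          by (induction ws) (simp_all flip: tens_simps(3))
        ultimately show ?thesis by (simp add: Z_def mult.assoc)
      qed
      have cl: "wot closure_of Z \<subseteq> Z"
      proof
        fix a assume a: "a \<in> wot closure_of Z"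
        have "ev (?f l1 * a * (2 *\<^sub>C ?f l2)) = ev (r1 * \<alpha> a * c1) + ev (r2 * \<alpha> a * c2)"
        proof (rule wot_closure_eq[OF _ a])
          show "continuous_map wot euclidean (\<lambda>a. ev (r1 * \<alpha> a * c1) + ev (r2 * \<alpha> a * c2))"
            by (intro continuous_map_add continuous_map_ev)
        qed (rule_tac [2] continuous_map_ev', simp add: Z_def expand mult_scaleC_right)
        then show "a \<in> Z" by (simp add: Z_def expand mult_scaleC_right)
      qed
      obtain b c where bc: "a = b + c *\<^sub>C 1" "b \<in> future_algebra x k"
        using a(2) by (auto simp: unital_def)
      have "b \<in> Z" using bc(2) Z words cl by (rule future_word_induct)
      moreover have "1 \<in> Z" using words[of "[]"] by simp
      ultimately have "a \<in> Z" unfolding bc by (intro csubspaceD[OF Z])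
      then show ?thesis by (simp add: a Z_def mult.assoc)
    qed
  qed
  show ?thesis
    unfolding matched_def pairs_def using claim[of _ "[]"] by auto
qed


lemma matched_range:
  assumes "\<And>ws. ev (2 *\<^sub>C word ws) = ev (entry_sum (prod_list (map f ws)))"
  shows "matched (range (\<lambda>i. (x i, f i)))"
  unfolding matched_def
proof clarify
  fix a M assume "(a, M) \<in> pairs (range (\<lambda>i. (x i, f i)))"
  then obtain l where l: "a = prod_list (map fst l)" "M = prod_list (map snd l)" "l \<in> lists (range (\<lambda>i. (x i, f i)))"
    unfolding pairs_def by (auto simp: lists_eq_set)
  then obtain ws where ws: "l = map (\<lambda>i. (x i, f i)) ws"
    unfolding lists_image by auto
  show "ev (2 *\<^sub>C a) = ev (entry_sum M)"
    using assms[of ws] unfolding l(1,2) ws by (simp add: o_def word_def)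
qed

definition fixed_below :: "int \<Rightarrow> ('h cop \<times> 'h cop m2) set"
  where "fixed_below m = (\<lambda>i. (x i, tens (x i) 1)) ` {..<m}"

text \<open>Ordinary invariance under the shift of all letters from \<open>m\<close> on, put into
  the language of pairs: the matrices are multiples of the identity.\<close>

definition shift_pairs :: "int \<Rightarrow> ('h cop \<times> 'h cop m2) set"
  where "shift_pairs m = fixed_below m \<union> (\<lambda>a. (a, lift_\<alpha> a)) ` unital (future_algebra x m)"

lemma tens_mult_one: "tens (a * b) 1 = tens a 1 * tens b 1"
  using tens_simps(3)[of a b 1 1] by simp

lemma tens_word_1: "tens (prod_list (map f ws)) 1 = prod_list (map (\<lambda>i. tens (f i) 1) ws)"
  by (induction ws) (simp_all add: tens_mult_one)

lemma entry_sum_tens_one: "ev (entry_sum (tens a 1)) = 2 * ev a"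
  by (simp add: entry_sum_def scaleC_one)

lemma matched_shift: "matched (shift_pairs m)"
  unfolding shift_pairs_def
proof (rule matched_extend)
  have "fixed_below m \<union> (\<lambda>i. (x i, lift_\<alpha> (x i))) ` {m..} = range (\<lambda>i. (x i, tens (x (shift_above m i)) 1))"
    by (auto simp: fixed_below_def shift_above_def image_iff not_less split: if_splits)
  moreover have "matched (range (\<lambda>i. (x i, tens (x (shift_above m i)) 1)))"
  proof (rule matched_range)
    fix ws
    have "ev (word ws) = ev (prod_list (map (\<lambda>i. x (shift_above m i)) ws))"
      using ev_shift_above[of ws m] by (simp add: word_def o_def)
    then show "ev (2 *\<^sub>C word ws) = ev (entry_sum (prod_list (map (\<lambda>i. tens (x (shift_above m i)) 1) ws)))"
      unfolding tens_word_1[symmetric] entry_sum_tens_one by simp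
  qed
  ultimately show "matched (fixed_below m \<union> (\<lambda>i. (x i, lift_\<alpha> (x i))) ` {m..})" by simp
qed

lemma shift_pairs_future: "a \<in> future_algebra x m \<Longrightarrow> (a, lift_\<alpha> a) \<in> pairs (shift_pairs m)"
  by (rule pairs_base) (auto simp: shift_pairs_def intro: unitalI)

lemma shift_pairs_word: "set ws \<subseteq> {..<m} \<Longrightarrow> (word ws, tens (word ws) 1) \<in> pairs (shift_pairs m)"
proof (induction ws)
  case (Cons i ws)
  have "(x i, tens (x i) 1) \<in> pairs (shift_pairs m)"
    using Cons.prems by (intro pairs_base) (auto simp: shift_pairs_def fixed_below_def)
  from pairs_mult[OF this Cons.IH] Cons.prems show ?case by (simp add: tens_mult_one)
qed (simp add: pairs_one)

lemma shift_pairs_ev: "(a, tens b 1) \<in> pairs (shift_pairs m) \<Longrightarrow> ev a = ev b"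
  using matchedD[OF matched_shift] by (fastforce simp: entry_sum_tens_one)

lemma ev_word_shift:
  assumes "set v \<subseteq> {..<m}" "set w \<subseteq> {..<m}" "a \<in> future_algebra x m"
  shows "ev (word v * a * word w) = ev (word v * \<alpha> a * word w)"
  using pairs_mult[OF pairs_mult[OF shift_pairs_word[OF assms(1)] shift_pairs_future[OF assms(3)]]
      shift_pairs_word[OF assms(2)]]
  by (intro shift_pairs_ev) (simp add: tens_mult_one)

lemma letters_below:
  fixes k :: int
  obtains m where "k \<le> m" "set ws \<subseteq> {..<m}"
proof
  have "k \<le> Max (set (k # ws))" by (rule Max_ge) auto
  then show "k \<le> Max (set (k # ws)) + 1" by linarith
  show "set ws \<subseteq> {..<Max (set (k # ws)) + 1}" using Max_ge[of "set (k # ws)"] by force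
qed

text \<open>The letters of two test words lie below some \<open>m\<close>, while a tail element
  belongs to the future from \<open>m\<close> on; shifting that future does not change the
  coefficient between the two word vectors.\<close>

lemma \<alpha>_tail [simp]: "b \<in> tail \<Longrightarrow> \<alpha> b = b"
proof (rule cop_eqI_total[OF total_word_vector])
  fix \<eta> \<zeta> assume b: "b \<in> tail" and "\<eta> \<in> range word_vector" "\<zeta> \<in> range word_vector"
  then obtain v w where vw: "\<eta> = word_vector v" "\<zeta> = word_vector w" by blast
  obtain m where "set (rev v @ w) \<subseteq> {..<m}" using letters_below[of 0] by blast
  then show "cinner \<eta> (cop_apply (\<alpha> b) \<zeta>) = cinner \<eta> (cop_apply b \<zeta>)"
    unfolding vw cinner_word_vector
    using ev_word_shift[of "rev v" m w b] b tail_subset[of m] by auto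
qed

abbreviation utail :: "'h cop set" where "utail \<equiv> unital tail"

lemma \<alpha>_utail [simp]: "b \<in> utail \<Longrightarrow> \<alpha> b = b"
  by (auto simp: unital_def)

lemma \<alpha>_power_utail [simp]: "b \<in> utail \<Longrightarrow> (\<alpha> ^^ n) b = b"
  by (induction n) simp_all

lemma utail_one [simp]: "1 \<in> utail"
  using unital_scalar[OF subalgebraD(1)[OF tail_subalgebra], of 1] by (simp add: scaleC_one)

lemma utail_mult: "a \<in> utail \<Longrightarrow> b \<in> utail \<Longrightarrow> a * b \<in> utail"
proof -
  assume "a \<in> utail" "b \<in> utail"
  then obtain a' c b' d where *: "a = a' + c *\<^sub>C 1" "a' \<in> tail" "b = b' + d *\<^sub>C 1" "b' \<in> tail"
    by (auto simp: unital_def)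
  then have "a * b = (a' * b' + d *\<^sub>C a' + c *\<^sub>C b') + (c * d) *\<^sub>C 1"
    by (simp add: algebra_simps mult_scaleC_left mult_scaleC_right scaleC_scaleC scaleC_add_right)
  moreover have "a' * b' + d *\<^sub>C a' + c *\<^sub>C b' \<in> tail"
    using * by (intro subalgebraD[OF tail_subalgebra])
  ultimately show ?thesis unfolding unital_def by blast
qed

lemma utail_adj: "a \<in> utail \<Longrightarrow> adj a \<in> utail"
  by (auto simp: unital_def) (metis tail_adj)

lemma utail_future: "b \<in> utail \<Longrightarrow> a \<in> future_algebra x k \<Longrightarrow> b * a \<in> future_algebra x k \<and> a * b \<in> future_algebra x k"
  using tail_subset[of k] subalgebraD[OF future_subalgebra[of k]]
  by (auto simp: unital_def distrib_left distrib_right mult_scaleC_left mult_scaleC_right subset_iff)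

lemma coefficients_utail: "coefficients tail \<subseteq> utail"
  using unital_scalar[OF subalgebraD(1)[OF tail_subalgebra]] by (auto simp: coefficients_def intro: unitalI)

section \<open>The conditional expectation as a weak limit of shifts\<close>

definition E :: "'h cop \<Rightarrow> 'h cop"
  where "E a = (SOME T. wot_tendsto (\<lambda>n. (\<alpha> ^^ n) a) T)"

text \<open>The coefficients between two word vectors are eventually constant: as soon as
  \<open>(\<alpha> ^^ n) a\<close> has passed all letters of both words, a further shift changes
  nothing. Here this happens at \<open>n0\<close>.\<close>

lemma E_tendsto:
  assumes a: "a \<in> future_algebra x k" shows "wot_tendsto (\<lambda>n. (\<alpha> ^^ n) a) (E a)"
proof -
  obtain K where K: "\<And>v. norm (cop_apply a v) \<le> K * norm v" using cop_bound[of a] by blast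
  have "convergent (\<lambda>n. cinner \<eta> (cop_apply ((\<alpha> ^^ n) a) \<zeta>))"
    if "\<eta> \<in> range word_vector" "\<zeta> \<in> range word_vector" for \<eta> \<zeta>
  proof -
    from that obtain v w where vw: "\<eta> = word_vector v" "\<zeta> = word_vector w" by (elim rangeE)
    obtain m where m: "set (rev v @ w) \<subseteq> {..<m}" using letters_below[of 0] by blast
    let ?c = "\<lambda>n. cinner \<eta> (cop_apply ((\<alpha> ^^ n) a) \<zeta>)"
    define n0 where "n0 = nat (m - k)"
    have step: "?c (n0 + n) = ?c n0" for n
    proof (induction n)
      case (Suc n)
      have "(\<alpha> ^^ (n0 + n)) a \<in> future_algebra x (k + int (n0 + n))" by (rule future_\<alpha>_power[OF a])
      also have "\<dots> \<subseteq> future_algebra x m" by (rule future_antimono) (simp add: n0_def)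
      finally have "ev (word (rev v) * (\<alpha> ^^ (n0 + n)) a * word w) = ev (word (rev v) * \<alpha> ((\<alpha> ^^ (n0 + n)) a) * word w)"
        using m by (intro ev_word_shift[of _ m]) auto
      then show ?case using Suc by (simp add: vw cinner_word_vector)
    qed simp
    have "?c n = ?c n0" if "n \<ge> n0" for n using step[of "n - n0"] that by simp
    then have "eventually (\<lambda>n. ?c n = ?c n0) sequentially"
      unfolding eventually_sequentially by blast
    then show ?thesis by (intro convergentI[of _ "?c n0"] tendsto_eventually)
  qed
  then obtain T where "wot_tendsto (\<lambda>n. (\<alpha> ^^ n) a) T"
    using wot_convergent[of "\<lambda>n. (\<alpha> ^^ n) a", OF \<alpha>_power_bound[OF K] total_word_vector] by blast
  then show ?thesis unfolding E_def by (rule someI)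
qed

lemma E_eqI: "a \<in> future_algebra x k \<Longrightarrow> wot_tendsto (\<lambda>n. (\<alpha> ^^ n) a) T \<Longrightarrow> E a = T"
  using wot_tendsto_unique[OF E_tendsto] by blast

lemma E_add: "a \<in> future_algebra x k \<Longrightarrow> b \<in> future_algebra x k \<Longrightarrow> E (a + b) = E a + E b"
  by (rule E_eqI[of _ k]) (auto intro: subalgebraD[OF future_subalgebra] wot_tendsto_add E_tendsto)

lemma E_scaleC: "a \<in> future_algebra x k \<Longrightarrow> E (c *\<^sub>C a) = c *\<^sub>C E a"
  by (rule E_eqI[of _ k]) (auto intro: subalgebraD[OF future_subalgebra] wot_tendsto_scaleC E_tendsto)

lemma E_tail [simp]: "b \<in> tail \<Longrightarrow> E b = b"
  using tail_subset[of 0] by (intro E_eqI[of _ 0]) (auto simp: unitalI wot_tendsto_const)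

lemma E_utail_left: "b \<in> utail \<Longrightarrow> a \<in> future_algebra x k \<Longrightarrow> E (b * a) = b * E a"
  by (rule E_eqI[of _ k]) (auto simp: utail_future intro!: wot_tendsto_mult_left E_tendsto)

lemma E_utail_right: "b \<in> utail \<Longrightarrow> a \<in> future_algebra x k \<Longrightarrow> E (a * b) = E a * b"
  by (rule E_eqI[of _ k]) (auto simp: utail_future intro!: wot_tendsto_mult_right E_tendsto)

lemma E_adj: "a \<in> future_algebra x k \<Longrightarrow> E (adj a) = adj (E a)"
  by (rule E_eqI[of _ k]) (auto intro: future_adj wot_tendsto_adj E_tendsto)

lemma E_\<alpha>_power: "a \<in> future_algebra x k \<Longrightarrow> E ((\<alpha> ^^ n) a) = E a"
proof (rule E_eqI[OF future_\<alpha>_power])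
  assume a: "a \<in> future_algebra x k"
  have "(\<alpha> ^^ m) ((\<alpha> ^^ n) a) = (\<alpha> ^^ (m + n)) a" for m by (simp add: funpow_add)
  then show "wot_tendsto (\<lambda>m. (\<alpha> ^^ m) ((\<alpha> ^^ n) a)) (E a)"
    using wot_tendsto_shift[OF E_tendsto[OF a], of n] by simp
qed

text \<open>The iterates eventually enter every future algebra, and these are weakly closed.\<close>

lemma E_in_tail: "a \<in> future_algebra x k \<Longrightarrow> E a \<in> tail"
proof (rule tailI, rule wot_tendsto_closed[OF E_tendsto _ future_closed])
  fix k' assume a: "a \<in> future_algebra x k"
  have "(\<alpha> ^^ n) a \<in> future_algebra x k'" if "n \<ge> nat (k' - k)" for n
  proof -
    have "k' \<le> k + int n" using that by linarith
    then show ?thesis using future_\<alpha>_power[OF a, of n] future_antimono by blast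
  qed
  then show "eventually (\<lambda>n. (\<alpha> ^^ n) a \<in> future_algebra x k') sequentially"
    unfolding eventually_sequentially by blast
qed

lemma ev_E: "a \<in> future_algebra x k \<Longrightarrow> ev (E a) = ev a"
proof -
  assume "a \<in> future_algebra x k"
  then have "(\<lambda>n. ev ((\<alpha> ^^ n) a)) \<longlonglongrightarrow> ev (E a)"
    using E_tendsto unfolding wot_tendsto_def ev_def by blast
  then show ?thesis by (simp add: LIMSEQ_const_iff)
qed

definition past :: "int \<Rightarrow> 'h cop set"
  where "past m = {prod_list l | l. set l \<subseteq> x ` {..<m} \<union> utail}"

lemma past_induct [consumes 1, case_names one mult]:
  assumes "a \<in> past m" "P 1" "\<And>t a. t \<in> x ` {..<m} \<union> utail \<Longrightarrow> a \<in> past m \<Longrightarrow> P a \<Longrightarrow> P (t * a)"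
  shows "P a"
proof -
  obtain l where l: "a = prod_list l" "set l \<subseteq> x ` {..<m} \<union> utail"
    using assms(1) by (auto simp: past_def)
  have "P (prod_list l)" using l(2)
    by (induction l) (use assms(2,3) in \<open>auto simp: past_def\<close>)
  then show ?thesis using l by simp
qed

lemma past_mult: "a \<in> past m \<Longrightarrow> b \<in> past m \<Longrightarrow> a * b \<in> past m"
proof -
  assume "a \<in> past m" "b \<in> past m"
  then obtain l l' where "a = prod_list l" "set l \<subseteq> x ` {..<m} \<union> utail"
      "b = prod_list l'" "set l' \<subseteq> x ` {..<m} \<union> utail" unfolding past_def by auto
  then show ?thesis unfolding past_def by (intro CollectI exI[of _ "l @ l'"]) auto
qed

lemma past_base: "t \<in> x ` {..<m} \<union> utail \<Longrightarrow> t \<in> past m"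
  unfolding past_def by (intro CollectI exI[of _ "[t]"]) auto

lemma past_x: "i < m \<Longrightarrow> x i \<in> past m" and past_utail: "b \<in> utail \<Longrightarrow> b \<in> past m"
  by (auto intro: past_base)

lemma past_one: "1 \<in> past m"
  by (simp add: past_utail)

lemma past_mono: "m \<le> m' \<Longrightarrow> past m \<subseteq> past m'"
  unfolding past_def by fastforce

lemma past_adj: "a \<in> past m \<Longrightarrow> adj a \<in> past m"
proof (induction rule: past_induct)
  case (mult t a)
  then have "adj t \<in> past m" by (auto intro: past_x past_utail utail_adj)
  then show ?case using mult by (simp add: past_mult)
qed (simp add: past_one)

lemma past_word: "set ws \<subseteq> {..<m} \<Longrightarrow> word ws \<in> past m"
  by (induction ws) (auto intro: past_mult past_x past_one)

lemma shift_pairs_past: "a \<in> past m \<Longrightarrow> (a, tens a 1) \<in> pairs (shift_pairs m)"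
proof (induction rule: past_induct)
  case (mult t a)
  have "(t, tens t 1) \<in> shift_pairs m"
    using mult(1) unital_mono[OF tail_subset[of m]]
    by (auto simp: shift_pairs_def fixed_below_def image_iff)
  from pairs_mult[OF pairs_base[OF this] mult(3)] show ?case by (simp add: tens_mult_one)
qed (simp add: pairs_one)

lemma ev_shift_one:
  assumes "L \<in> past m" "a \<in> future_algebra x m" "R \<in> past m"
  shows "ev (L * a * R) = ev (L * \<alpha> a * R)"
  using pairs_mult[OF pairs_mult[OF shift_pairs_past[OF assms(1)] shift_pairs_future[OF assms(2)]]
      shift_pairs_past[OF assms(3)]]
  by (intro shift_pairs_ev) (simp add: tens_mult_one)

text \<open>Both slots move together here; moving one of them alone is what the matrix substitution
  below achieves.\<close>

lemma ev_shift_two: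
  assumes "L \<in> past m" "a \<in> future_algebra x m" "Y \<in> past m" "b \<in> future_algebra x m" "R \<in> past m"
  shows "ev (L * a * Y * b * R) = ev (L * \<alpha> a * Y * \<alpha> b * R)"
  using pairs_mult[OF pairs_mult[OF pairs_mult[OF pairs_mult[OF shift_pairs_past[OF assms(1)]
      shift_pairs_future[OF assms(2)]] shift_pairs_past[OF assms(3)]] shift_pairs_future[OF assms(4)]]
      shift_pairs_past[OF assms(5)]]
  by (intro shift_pairs_ev) (simp add: tens_mult_one)

text \<open>All iterates of \<open>a\<close> give the same moment, and the moment is weakly
  continuous in this slot. The condition that \<open>L\<close> and \<open>R\<close> belong to the
  past of \<open>m\<close> keeps them fixed during the shifts.\<close>

lemma ev_expectation:
  assumes L: "L \<in> past m" and a: "a \<in> future_algebra x m" and R: "R \<in> past m"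
  shows "ev (L * a * R) = ev (L * E a * R)"
proof -
  have "ev (L * (\<alpha> ^^ n) a * R) = ev (L * a * R)" for n
  proof (induction n)
    case (Suc n)
    have "(\<alpha> ^^ n) a \<in> future_algebra x m"
      using future_\<alpha>_power[OF a, of n] future_antimono[of m "m + int n"] by auto
    then show ?case using ev_shift_one[OF L _ R] Suc by simp
  qed simp
  moreover have "wot_tendsto (\<lambda>n. L * (\<alpha> ^^ n) a * R) (L * E a * R)"
    by (intro wot_tendsto_mult_left wot_tendsto_mult_right E_tendsto[OF a])
  then have "(\<lambda>n. ev (L * (\<alpha> ^^ n) a * R)) \<longlonglongrightarrow> ev (L * E a * R)"
    unfolding wot_tendsto_def ev_def by blast
  ultimately show ?thesis by (simp add: LIMSEQ_const_iff)
qed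

end

lemma adj_diff [simp]: "adj (a - b) = adj a - adj b"
  by (rule adj_unique) (simp add: cinner_simps cinner_adj_right)

lemma bmono_eval_snoc: "cs \<noteq> [] \<Longrightarrow> bmono_eval y (cs @ [c]) = bmono_eval y cs * y * c"
proof (induction cs rule: induct_list012)
  case (3 a b cs)
  then show ?case by (simp add: mult.assoc)
qed simp_all

lemma bmono_eval_Cons: "cs \<noteq> [] \<Longrightarrow> bmono_eval y (c # cs) = c * y * bmono_eval y cs"
  by (cases cs) simp_all

context spreadable_sequence
begin

section \<open>Separating two blocks of the same letter\<close>

definition monomial :: "int \<Rightarrow> 'h cop list \<Rightarrow> 'h cop"
  where "monomial m cs = bmono_eval (x m) cs"

definition coeff_list :: "'h cop list \<Rightarrow> bool"
  where "coeff_list cs \<longleftrightarrow> length cs \<ge> 2 \<and> set cs \<subseteq> utail"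

lemma adj_monomial:
  "cs \<noteq> [] \<Longrightarrow> adj (monomial m cs) = monomial m (rev (map adj cs))"
proof (induction cs)
  case (Cons c cs)
  show ?case
  proof (cases "cs = []")
    case False
    then show ?thesis
      using Cons.IH by (simp add: monomial_def bmono_eval_Cons bmono_eval_snoc mult.assoc)
  qed (simp add: monomial_def)
qed simp

lemma coeff_list_adj: "coeff_list cs \<Longrightarrow> coeff_list (rev (map adj cs))"
  by (auto simp: coeff_list_def intro: utail_adj)

lemma \<alpha>_monomial: "set cs \<subseteq> utail \<Longrightarrow> (\<alpha> ^^ n) (monomial m cs) = monomial (m + int n) cs"
  unfolding monomial_def
  by (induction cs rule: induct_list012) (simp_all add: add_ac)

lemma monomial_future:
  assumes "coeff_list cs" shows "monomial m cs \<in> future_algebra x m"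
proof -
  have "ds \<noteq> [] \<Longrightarrow> set ds \<subseteq> utail \<Longrightarrow> c \<in> utail \<Longrightarrow> bmono_eval (x m) (c # ds) \<in> future_algebra x m" for c ds
  proof (induction ds arbitrary: c)
    case (Cons d ds)
    have cx: "c * x m \<in> future_algebra x m"
      using utail_future[OF Cons.prems(3) x_future[of m m]] by simp
    show ?case
    proof (cases "ds = []")
      case True
      then show ?thesis using utail_future[OF _ cx, of d] Cons.prems by simp
    next
      case False
      then have "bmono_eval (x m) (d # ds) \<in> future_algebra x m" using Cons by simp
      then show ?thesis using subalgebraD(3)[OF future_subalgebra cx] by simp
    qed
  qed simp
  from this[of "tl cs" "hd cs"] show ?thesis
    using assms by (cases cs; cases "tl cs") (auto simp: coeff_list_def monomial_def)
qed

lemma monomial_past: "set cs \<subseteq> utail \<Longrightarrow> i < m \<Longrightarrow> monomial i cs \<in> past m"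
  unfolding monomial_def
  by (induction cs rule: induct_list012) (auto intro: past_mult past_x past_utail past_one)

text \<open>Lower letters carry the rank one projection, \<open>x m\<close> becomes the diagonal
  choice between \<open>x m\<close> and \<open>x (m + 1)\<close>, and everything above moves up by
  one to make room.\<close>

definition spread_pairs :: "int \<Rightarrow> ('h cop \<times> 'h cop m2) set"
  where "spread_pairs m = (\<lambda>i. (x i, tens (x i) half_matrix)) ` {..<m} \<union> {(x m, M2 (x m) 0 0 (x (m + 1)))}
    \<union> (\<lambda>a. (a, lift_\<alpha> a)) ` unital (future_algebra x (m + 1))"

lemma matched_spread: "matched (spread_pairs m)"
  unfolding spread_pairs_def
proof (rule matched_extend)
  have mid: "M2 (x m) 0 0 (x (m + 1)) = tens (x m) (M2 1 0 0 0) + tens (x (m + 1)) (M2 0 0 0 1)"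
    by (rule m2_eqI) (simp_all add: scaleC_one)
  have "(\<lambda>i. (x i, tens (x i) half_matrix)) ` {..<m} \<union> {(x m, M2 (x m) 0 0 (x (m + 1)))} \<union>
      (\<lambda>i. (x i, lift_\<alpha> (x i))) ` {m + 1..} = range (\<lambda>i. (x i, spread_letter x m i))" (is "?L = range ?f")
  proof (intro equalityI subsetI)
    fix p assume "p \<in> ?L"
    then show "p \<in> range ?f"
      by (elim UnE imageE) (auto simp: split_letter_def mid intro!: image_eqI[of _ ?f])
  next
    fix p assume "p \<in> range ?f"
    then obtain i where p: "p = ?f i" by blast
    consider "i < m" | "i = m" | "i \<ge> m + 1" by linarith
    then show "p \<in> ?L"
    proof cases
      case 1
      then have "p = (x i, tens (x i) half_matrix)" by (simp add: p split_letter_def)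
      then show ?thesis using 1 by blast
    next
      case 2
      then show ?thesis by (simp add: p split_letter_def mid)
    next
      case 3
      then have "p = (x i, lift_\<alpha> (x i))" by (simp add: p split_letter_def)
      then show ?thesis using 3 by blast
    qed
  qed
  moreover have "matched (range (\<lambda>i. (x i, spread_letter x m i)))"
  proof (rule matched_range)
    fix ws
    have "entry_sum (map_m2 ev M) = ev (entry_sum M)" for M
      by (cases M) (simp add: entry_sum_def)
    then show "ev (2 *\<^sub>C word ws) = ev (entry_sum (prod_list (map (spread_letter x m) ws)))"
      using spreadable_split[OF spreadable' csubspace_UNIV linear_ev, of ws m] by (simp add: word_def mult.commute)
  qed
  ultimately show "matched ((\<lambda>i. (x i, tens (x i) half_matrix)) ` {..<m} \<union> {(x m, M2 (x m) 0 0 (x (m + 1)))} \<union>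
      (\<lambda>i. (x i, lift_\<alpha> (x i))) ` {m + 1..})" by simp
qed

lemma spread_pairs_utail: "b \<in> utail \<Longrightarrow> (b, tens b 1) \<in> spread_pairs m"
  using unital_mono[OF tail_subset[of "m + 1"]] by (force simp: spread_pairs_def)

text \<open>On either side of the vector \<open>(1, 1)\<close> the matrix \<open>M\<close> acts like
  the scalar factor \<open>a\<close>. Row and column sums are all that \<open>entry_sum\<close> sees
  of the outermost factors, so balanced factors pass through unchanged.\<close>

definition balanced :: "'h cop \<Rightarrow> 'h cop m2 \<Rightarrow> bool"
  where "balanced a M \<longleftrightarrow> m11 M + m12 M = a \<and> m21 M + m22 M = a \<and> m11 M + m21 M = a \<and> m12 M + m22 M = a"

lemma balanced_mult:
  assumes "balanced a M" "balanced b N" shows "balanced (a * b) (M * N)"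
proof -
  have M: "m11 M = a - m12 M" "m22 M = a - m12 M" "m21 M = m12 M"
    using assms(1) unfolding balanced_def by (metis add_diff_cancel_right' add_diff_cancel_left')+
  have N: "m11 N = b - m12 N" "m22 N = b - m12 N" "m21 N = m12 N"
    using assms(2) unfolding balanced_def by (metis add_diff_cancel_right' add_diff_cancel_left')+
  show ?thesis unfolding balanced_def by (simp add: M N algebra_simps)
qed

lemma spread_pairs_past: "a \<in> past m \<Longrightarrow> \<exists>M. (a, M) \<in> pairs (spread_pairs m) \<and> balanced a M"
proof (induction rule: past_induct)
  case one
  then show ?case using pairs_one by (intro exI[of _ 1]) (simp add: balanced_def)
next
  case (mult t a)
  have half: "(1/2) *\<^sub>C a + (1/2) *\<^sub>C a = a" for a :: "'h cop"
    by (simp add: scaleC_one flip: scaleC_add_left)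
  have "\<exists>N. (t, N) \<in> spread_pairs m \<and> balanced t N"
    using mult(1)
  proof
    assume "t \<in> x ` {..<m}"
    then have "(t, tens t half_matrix) \<in> spread_pairs m" by (auto simp: spread_pairs_def)
    moreover have "balanced t (tens t half_matrix)" by (simp add: balanced_def half_matrix_def half)
    ultimately show ?thesis by blast
  next
    assume "t \<in> utail"
    moreover have "balanced t (tens t 1)" by (simp add: balanced_def scaleC_one)
    ultimately show ?thesis using spread_pairs_utail by blast
  qed
  then show ?case using mult(3) pairs_mult[OF pairs_base] balanced_mult by blast
qed

text \<open>Tail coefficients are matched with diagonal matrices, so the two positions do not mix
  inside a block: its letters all stay or all move.\<close>

lemma spread_pairs_monomial:
  "cs \<noteq> [] \<Longrightarrow> set cs \<subseteq> utail \<Longrightarrow>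
    (monomial m cs, M2 (monomial m cs) 0 0 (monomial (m + 1) cs)) \<in> pairs (spread_pairs m)"
proof (induction cs)
  case (Cons c cs)
  have c: "(c, tens c 1) \<in> pairs (spread_pairs m)"
    using Cons.prems by (intro pairs_base spread_pairs_utail) simp
  show ?case
  proof (cases "cs = []")
    case True
    then show ?thesis using c by (simp add: monomial_def tens_def scaleC_one)
  next
    case False
    have "(x m, M2 (x m) 0 0 (x (m + 1))) \<in> pairs (spread_pairs m)"
      by (intro pairs_base) (simp add: spread_pairs_def)
    from pairs_mult[OF pairs_mult[OF c this] Cons.IH] Cons.prems False
    show ?thesis
      by (simp add: monomial_def bmono_eval_Cons tens_def times_m2_def scaleC_one)
  qed
qed simp

text \<open>The two copies of \<open>x i\<close> give \<open>half_matrix\<close> once, by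
  idempotence, and its entries link every choice on the left with every choice on the right. The
  factor \<open>4\<close> is the \<open>2\<close> from the normalisation of \<open>entry_sum\<close>
  times the \<open>2\<close> from the entries \<open>1/2\<close>.\<close>

lemma ev_spread_two:
  assumes L: "L \<in> past m" and R: "R \<in> past m" and i: "i < m" and cs: "coeff_list cs" and ds: "coeff_list ds"
  defines "F \<equiv> \<lambda>j k. ev (L * monomial j cs * (x i * x i) * monomial k ds * R)"
  shows "4 * F m m = F m m + F m (m + 1) + F (m + 1) m + F (m + 1) (m + 1)"
proof -
  obtain M where M: "(L, M) \<in> pairs (spread_pairs m)" "balanced L M" using spread_pairs_past[OF L] by blast
  obtain N where N: "(R, N) \<in> pairs (spread_pairs m)" "balanced R N" using spread_pairs_past[OF R] by blast
  have xi: "(x i, tens (x i) half_matrix) \<in> pairs (spread_pairs m)"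
    using i by (intro pairs_base) (auto simp: spread_pairs_def)
  define C where "C = M2 (monomial m cs) 0 0 (monomial (m + 1) cs)"
  define D where "D = M2 (monomial m ds) 0 0 (monomial (m + 1) ds)"
  have C: "(monomial m cs, C) \<in> pairs (spread_pairs m)" and D: "(monomial m ds, D) \<in> pairs (spread_pairs m)"
    unfolding C_def D_def using cs ds by (auto intro!: spread_pairs_monomial simp: coeff_list_def)
  have "2 * F m m = ev (entry_sum (M * C * (tens (x i) half_matrix * tens (x i) half_matrix) * D * N))"
    unfolding F_def
    by (rule matchedD[OF matched_spread pairs_mult[OF pairs_mult[OF pairs_mult[OF pairs_mult[OF M(1) C]
      pairs_mult[OF xi xi]] D] N(1)]])
  also have "tens (x i) half_matrix * tens (x i) half_matrix = tens (x i * x i) half_matrix"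
  proof -
    have "half_matrix * half_matrix = half_matrix" by (rule m2_eqI) (simp_all add: half_matrix_def)
    then show ?thesis by (simp flip: tens_simps(3))
  qed
  also have "entry_sum (M * C * tens (x i * x i) half_matrix * D * N) =
      (1/2) *\<^sub>C ((m11 M + m21 M) * monomial m cs * (x i * x i) * monomial m ds * (m11 N + m12 N)
      + (m11 M + m21 M) * monomial m cs * (x i * x i) * monomial (m + 1) ds * (m21 N + m22 N)
      + (m12 M + m22 M) * monomial (m + 1) cs * (x i * x i) * monomial m ds * (m11 N + m12 N)
      + (m12 M + m22 M) * monomial (m + 1) cs * (x i * x i) * monomial (m + 1) ds * (m21 N + m22 N))"
    by (simp add: entry_sum_def C_def D_def half_matrix_def algebra_simps scaleC_add_right
        mult_scaleC_left mult_scaleC_right)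
  also have "ev \<dots> = (F m m + F m (m + 1) + F (m + 1) m + F (m + 1) (m + 1)) / 2"
    using M(2) N(2) by (simp add: balanced_def F_def)
  finally show ?thesis by simp
qed

text \<open>In a mixed term the block of \<open>x (m + 1)\<close> has only past elements of
  \<open>m + 1\<close> around it and can be averaged alone; what remains contains a single block of
  \<open>x m\<close>. With \<open>?e\<close> for the result, the four-term identity reads
  \<open>4 F = 2 F + 2 ?e\<close>.\<close>

lemma ev_two_expectations:
  assumes L: "L \<in> past m" and R: "R \<in> past m" and i: "i < m" and cs: "coeff_list cs" and ds: "coeff_list ds"
  shows "ev (L * monomial m cs * (x i * x i) * monomial m ds * R) =
    ev (L * E (monomial m cs) * (x i * x i) * E (monomial m ds) * R)"
proof -
  define F where "F j k = ev (L * monomial j cs * (x i * x i) * monomial k ds * R)" for j k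
  let ?e = "ev (L * E (monomial m cs) * (x i * x i) * E (monomial m ds) * R)"
  have Y: "x i * x i \<in> past m" using i by (intro past_mult past_x)
  have up: "past m \<subseteq> past (m + 1)" by (rule past_mono) simp
  have cs': "set cs \<subseteq> utail" "set ds \<subseteq> utail" using cs ds by (auto simp: coeff_list_def)
  have E1: "E (monomial (m + 1) es) = E (monomial m es)" "\<alpha> (monomial m es) = monomial (m + 1) es"
    if "coeff_list es" for es
    using E_\<alpha>_power[OF monomial_future[OF that], of 1 m] \<alpha>_monomial[of es 1 m] that
    by (auto simp: coeff_list_def)
  have E_past: "E (monomial m es) \<in> past k" if "coeff_list es" for es k
    using E_in_tail[OF monomial_future[OF that]] by (intro past_utail unitalI)
  have "F (m + 1) (m + 1) = F m m"
    unfolding F_def using ev_shift_two[OF L monomial_future[OF cs] Y monomial_future[OF ds] R] E1(2)[OF cs] E1(2)[OF ds]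
    by simp
  moreover have "F m (m + 1) = ?e"
  proof -
    have "F m (m + 1) = ev ((L * monomial m cs * (x i * x i)) * E (monomial (m + 1) ds) * R)"
      unfolding F_def
      by (rule ev_expectation[of _ "m + 1"])
        (use L R i up cs' in \<open>auto intro!: past_mult past_x monomial_past monomial_future ds\<close>)
    also have "\<dots> = ev (L * monomial m cs * (x i * x i * E (monomial m ds) * R))"
      by (simp add: E1(1)[OF ds] mult.assoc)
    also have "\<dots> = ev (L * E (monomial m cs) * (x i * x i * E (monomial m ds) * R))"
      by (rule ev_expectation[OF L monomial_future[OF cs]]) (intro past_mult Y E_past ds R)
    finally show ?thesis by (simp add: mult.assoc)
  qed
  moreover have "F (m + 1) m = ?e"
  proof -
    have "F (m + 1) m = ev (L * monomial (m + 1) cs * (x i * x i * monomial m ds * R))"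
      by (simp add: F_def mult.assoc)
    also have "\<dots> = ev (L * E (monomial (m + 1) cs) * (x i * x i * monomial m ds * R))"
      by (rule ev_expectation[of _ "m + 1"])
        (use L R i up cs' in \<open>auto intro!: past_mult past_x monomial_past monomial_future cs\<close>)
    also have "\<dots> = ev ((L * E (monomial m cs) * (x i * x i)) * monomial m ds * R)"
      by (simp add: E1(1)[OF cs] mult.assoc)
    also have "\<dots> = ev ((L * E (monomial m cs) * (x i * x i)) * E (monomial m ds) * R)"
      by (rule ev_expectation[OF _ monomial_future[OF ds] R]) (intro past_mult Y E_past cs L)
    finally show ?thesis .
  qed
  moreover have "4 * F m m = F m m + F m (m + 1) + F (m + 1) m + F (m + 1) (m + 1)"
    unfolding F_def by (rule ev_spread_two[OF L R i cs ds])
  ultimately have "F m m = ?e" by simp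
  then show ?thesis by (simp add: F_def)
qed

text \<open>The squared norm of the vector expands into four moments with signs \<open>+\<close>,
  \<open>-\<close>, \<open>-\<close>, \<open>+\<close>, and all four equal \<open>?q\<close>. Only
  the one with two blocks needs the preceding lemma; a single block is averaged directly.\<close>

lemma lower_letter_annihilates:
  assumes i: "i < m" and cs: "coeff_list cs" and c: "c \<in> past m"
  shows "cop_apply (x i * (monomial m cs - E (monomial m cs)) * c) \<Omega> = 0"
proof -
  let ?d = "monomial m cs"
  let ?e = "E ?d"
  let ?q = "ev (adj c * adj ?e * (x i * x i) * ?e * c)"
  have e: "?e \<in> utail" using E_in_tail[OF monomial_future[OF cs]] by (rule unitalI)
  have cs': "cs \<noteq> []" "coeff_list (rev (map adj cs))" using cs coeff_list_adj by (auto simp: coeff_list_def)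
  have d': "monomial m (rev (map adj cs)) = adj ?d" using adj_monomial[OF cs'(1)] by simp
  have Y: "x i * x i \<in> past m" using i by (intro past_mult past_x)
  have dF: "?d \<in> future_algebra x m" by (rule monomial_future[OF cs])
  have ped: "adj ?e \<in> past m" "?e \<in> past m" "adj c \<in> past m" using e c by (auto intro: past_utail past_adj utail_adj)
  have "ev (adj c * adj ?d * (x i * x i) * ?d * c) = ?q"
    using ev_two_expectations[OF ped(3) c i cs'(2) cs] by (simp add: d' E_adj[OF dF])
  moreover have "ev (adj c * adj ?d * (x i * x i * ?e * c)) = ev (adj c * E (adj ?d) * (x i * x i * ?e * c))"
    by (rule ev_expectation[OF ped(3) future_adj[OF dF]]) (intro past_mult Y ped c)
  then have "ev (adj c * adj ?d * (x i * x i) * ?e * c) = ?q"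
    by (simp add: mult.assoc E_adj[OF dF])
  moreover have "ev ((adj c * adj ?e * (x i * x i)) * ?d * c) = ?q"
    by (rule ev_expectation[OF _ dF c]) (intro past_mult Y ped)
  moreover have "adj (x i * (?d - ?e) * c) * (x i * (?d - ?e) * c) =
      (adj c * adj ?d * (x i * x i) * ?d * c - adj c * adj ?d * (x i * x i) * ?e * c) -
      (adj c * adj ?e * (x i * x i) * ?d * c - adj c * adj ?e * (x i * x i) * ?e * c)"
    by (simp add: algebra_simps)
  ultimately have "ev (adj (x i * (?d - ?e) * c) * (x i * (?d - ?e) * c)) = 0"
    by (simp only: ev_linear) simp
  moreover have "ev (adj a * a) = cinner (cop_apply a \<Omega>) (cop_apply a \<Omega>)" for a
    by (simp add: ev_def cinner_adj_right)
  ultimately show ?thesis using cinner_eq_zero_iff by metis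
qed


section \<open>Removing higher letters from a vector\<close>

lemma coeff_list_Cons:
  assumes "coeff_list cs"
  obtains c cs' where "cs = c # cs'" "cs' \<noteq> []" "c \<in> utail" "set cs' \<subseteq> utail"
  using assms by (cases cs) (auto simp: coeff_list_def Suc_le_eq)

lemma coeff_list_snoc:
  assumes "coeff_list cs"
  obtains cs' c where "cs = cs' @ [c]" "cs' \<noteq> []" "c \<in> utail" "set cs' \<subseteq> utail"
  using assms by (cases cs rule: rev_cases) (auto simp: coeff_list_def Suc_le_eq)

text \<open>An algebraic span without closure is enough, because it is applied to word vectors, and
  each of these lies in \<open>K m\<close> for large \<open>m\<close>.\<close>

definition K :: "int \<Rightarrow> 'h set"
  where "K m = csubspace hull {cop_apply c \<Omega> | c. c \<in> past m}"

lemma K_csubspace: "csubspace (K m)"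
  unfolding K_def by (rule csubspace_hull)

lemma past_K: "c \<in> past m \<Longrightarrow> cop_apply c \<Omega> \<in> K m"
  unfolding K_def by (rule hull_inc) blast

lemma K_induct:
  assumes "v \<in> K m" "csubspace Z" "\<And>c. c \<in> past m \<Longrightarrow> cop_apply c \<Omega> \<in> Z"
  shows "v \<in> Z"
proof -
  have "K m \<subseteq> Z" unfolding K_def by (rule hull_minimal) (use assms in auto)
  then show ?thesis using assms(1) by blast
qed

lemma csubspace_vimage: "csubspace Z \<Longrightarrow> csubspace {v. cop_apply a v \<in> Z}"
  by (auto simp: csubspace_def)

lemma K_mult: "c \<in> past m \<Longrightarrow> v \<in> K m \<Longrightarrow> cop_apply c v \<in> K m"
  using K_induct[of v m "{v. cop_apply c v \<in> K m}"] csubspace_vimage[OF K_csubspace]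
    past_K[OF past_mult] by fastforce

lemma lower_letter_annihilates_K:
  assumes "i < m" "coeff_list cs" "v \<in> K m"
  shows "cop_apply (x i) (cop_apply (monomial m cs) v) = cop_apply (x i) (cop_apply (E (monomial m cs)) v)"
proof -
  have "v \<in> {v. cop_apply (x i * (monomial m cs - E (monomial m cs))) v \<in> {0}}"
    by (rule K_induct[OF assms(3) csubspace_vimage])
      (use lower_letter_annihilates[OF assms(1,2)] in \<open>auto simp: csubspace_def simp flip: cop_apply_simps(6)\<close>)
  then show ?thesis by simp
qed

text \<open>Such a vector is a combination of vectors of \<open>K m\<close> and of monomials in
  \<open>x m\<close> applied to them. A letter below \<open>m\<close> does not distinguish the
  monomial from its expectation, and the expectation maps \<open>K m\<close> into itself.\<close>

lemma K_reduce_Suc: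
  assumes "v \<in> K (m + 1)"
  shows "\<exists>v'\<in>K m. \<forall>j<m. cop_apply (x j) v = cop_apply (x j) v'"
proof -
  \<comment> \<open>These are the normal forms. As their span contains \<open>\<Omega>\<close>, it
    only has to be shown stable under the letters up to \<open>m\<close> and under the tail.\<close>
  let ?G = "K m \<union> {cop_apply (monomial m cs) v | cs v. coeff_list cs \<and> v \<in> K m}"
  define V where "V = csubspace hull ?G"
  have V: "csubspace V" unfolding V_def by (rule csubspace_hull)
  have G: "u \<in> ?G \<Longrightarrow> u \<in> V" for u unfolding V_def by (rule hull_inc)
  have eT: "E (monomial m cs) \<in> past m" if "coeff_list cs" for cs
    using E_in_tail[OF monomial_future[OF that]] by (intro past_utail unitalI)
  have step: "cop_apply t u \<in> V" if t: "t \<in> x ` {..<m + 1} \<union> utail" and u: "u \<in> V" for t u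
  proof -
    have "?G \<subseteq> {u. cop_apply t u \<in> V}"
    proof
      fix u assume "u \<in> ?G"
      then consider (low) "u \<in> K m" | (mono) cs v where "u = cop_apply (monomial m cs) v" "coeff_list cs" "v \<in> K m"
        by blast
      then show "u \<in> {u. cop_apply t u \<in> V}"
      proof cases
        case low
        show ?thesis
        proof (cases "t = x m")
          case True
          have "cop_apply t u = cop_apply (monomial m [1, 1]) u" by (simp add: True monomial_def)
          moreover have "coeff_list [1, 1]" by (simp add: coeff_list_def)
          ultimately show ?thesis using low by (auto intro!: G)
        next
          case False
          have "t \<in> x ` {..<m} \<union> utail"
          proof (cases "t \<in> utail")
            case no: False
            then obtain j where j: "t = x j" "j < m + 1" using t by blast
            then have "j < m" using False by (cases "j = m") auto
            then show ?thesis using j by blast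
          qed simp
          then have "cop_apply t u \<in> K m" by (intro K_mult past_base low)
          then show ?thesis using G by blast
        qed
      next
        case mono
        obtain c cs' where cs: "cs = c # cs'" "cs' \<noteq> []" "c \<in> utail" "set cs' \<subseteq> utail"
          using mono(2) by (rule coeff_list_Cons)
        show ?thesis
        proof (cases "t \<in> utail")
          case True
          have "t * monomial m cs = monomial m ((t * c) # cs')"
            using cs(2) by (simp add: cs(1) monomial_def bmono_eval_Cons mult.assoc)
          then have "cop_apply t u = cop_apply (monomial m ((t * c) # cs')) v"
            unfolding mono(1) by (metis cop_apply_simps(6))
          moreover have "coeff_list ((t * c) # cs')"
            using mono(2) True cs by (auto simp: coeff_list_def intro: utail_mult)
          ultimately show ?thesis using mono(3) by (auto intro!: G)
        next
          case False
          then obtain j where j: "t = x j" "j < m + 1" using t by blast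
          show ?thesis
          proof (cases "j = m")
            case True
            have "t * monomial m cs = monomial m (1 # cs)"
              using mono(2) by (simp add: j True monomial_def bmono_eval_Cons coeff_list_def length_greater_0_conv[symmetric] del: length_greater_0_conv)
            then have "cop_apply t u = cop_apply (monomial m (1 # cs)) v"
              unfolding mono(1) by (metis cop_apply_simps(6))
            moreover have "coeff_list (1 # cs)" using mono(2) by (simp add: coeff_list_def)
            ultimately show ?thesis using mono(3) by (auto intro!: G)
          next
            case False
            \<comment> \<open>The decisive case: a letter below \<open>m\<close> in front of a block
              of \<open>x m\<close> turns the block into a tail element, so the vector falls back
              into \<open>K m\<close>.\<close>
            then have "j < m" using j by simp
            then have "cop_apply t u = cop_apply (x j) (cop_apply (E (monomial m cs)) v)"
              using lower_letter_annihilates_K mono j by simp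
            also have "\<dots> \<in> K m" by (intro K_mult past_x \<open>j < m\<close> eT mono)
            finally show ?thesis using G by blast
          qed
        qed
      qed
    qed
    then have "V \<subseteq> {u. cop_apply t u \<in> V}"
      unfolding V_def[of ] by (intro hull_minimal) (use csubspace_vimage[OF V] in \<open>simp_all add: V_def\<close>)
    then show ?thesis using u by blast
  qed
  have "cop_apply c \<Omega> \<in> V" if "c \<in> past (m + 1)" for c
    using that
  proof (induction rule: past_induct)
    case one
    then show ?case using past_K[OF past_one] by (intro G) simp
  next
    case (mult t a)
    then show ?case using step by simp
  qed
  then have "v \<in> V" by (rule K_induct[OF assms V])
  moreover have "V \<subseteq> {v. \<exists>v'\<in>K m. \<forall>j<m. cop_apply (x j) v = cop_apply (x j) v'}"
    unfolding V_def
  proof (rule hull_minimal)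
    show "csubspace {v. \<exists>v'\<in>K m. \<forall>j<m. cop_apply (x j) v = cop_apply (x j) v'}"
    proof (rule csubspaceI)
      show "0 \<in> {v. \<exists>v'\<in>K m. \<forall>j<m. cop_apply (x j) v = cop_apply (x j) v'}"
        using csubspaceD(1)[OF K_csubspace] by (intro CollectI bexI[of _ 0]) auto
    next
      fix v w assume "v \<in> {v. \<exists>v'\<in>K m. \<forall>j<m. cop_apply (x j) v = cop_apply (x j) v'}"
        "w \<in> {v. \<exists>v'\<in>K m. \<forall>j<m. cop_apply (x j) v = cop_apply (x j) v'}"
      then obtain v' w' where "v' \<in> K m" "\<forall>j<m. cop_apply (x j) v = cop_apply (x j) v'"
        "w' \<in> K m" "\<forall>j<m. cop_apply (x j) w = cop_apply (x j) w'" by blast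
      then show "v + w \<in> {v. \<exists>v'\<in>K m. \<forall>j<m. cop_apply (x j) v = cop_apply (x j) v'}"
        by (intro CollectI bexI[of _ "v' + w'"]) (auto intro: csubspaceD[OF K_csubspace])
    next
      fix c v assume "v \<in> {v. \<exists>v'\<in>K m. \<forall>j<m. cop_apply (x j) v = cop_apply (x j) v'}"
      then obtain v' where "v' \<in> K m" "\<forall>j<m. cop_apply (x j) v = cop_apply (x j) v'" by blast
      then show "c *\<^sub>C v \<in> {v. \<exists>v'\<in>K m. \<forall>j<m. cop_apply (x j) v = cop_apply (x j) v'}"
        by (intro CollectI bexI[of _ "c *\<^sub>C v'"]) (auto intro: csubspaceD[OF K_csubspace])
    qed
    show "?G \<subseteq> {v. \<exists>v'\<in>K m. \<forall>j<m. cop_apply (x j) v = cop_apply (x j) v'}"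
      using lower_letter_annihilates_K K_mult[OF eT] by blast
  qed
  ultimately show ?thesis by blast
qed

lemma K_reduce:
  assumes "v \<in> K (m + int n)"
  shows "\<exists>v'\<in>K m. \<forall>j<m. cop_apply (x j) v = cop_apply (x j) v'"
  using assms
proof (induction n arbitrary: v)
  case (Suc n)
  then have "v \<in> K ((m + int n) + 1)" by (simp add: algebra_simps)
  from K_reduce_Suc[OF this] obtain v1 where v1: "v1 \<in> K (m + int n)"
    "\<forall>j<m + int n. cop_apply (x j) v = cop_apply (x j) v1" by blast
  from Suc.IH[OF v1(1)] v1(2) show ?case by fastforce
qed auto

text \<open>The operator form of monotone independence.\<close>

lemma peak_identity:
  assumes ij: "i < m" "j < m" and cs: "coeff_list cs"
  shows "x i * (monomial m cs - E (monomial m cs)) * x j = 0"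
proof (rule cop_eqI_total[OF total_word_vector])
  fix \<eta> \<zeta> assume "\<zeta> \<in> range word_vector"
  then obtain ws where ws: "\<zeta> = word_vector ws" by blast
  obtain m' where m': "m \<le> m'" "set ws \<subseteq> {..<m'}" using letters_below by blast
  have "\<zeta> \<in> K (m + int (nat (m' - m)))"
    using past_K[OF past_word[OF m'(2)]] m'(1) by (simp add: ws word_vector_def)
  \<comment> \<open>This uses the letter \<open>x j\<close> on the right: it cannot distinguish the
    arbitrary word vector from some \<open>v\<close> in \<open>K m\<close>, where the annihilation
    is already known.\<close>
  then obtain v where v: "v \<in> K m" "cop_apply (x j) \<zeta> = cop_apply (x j) v"
    using K_reduce ij(2) by blast
  have "cop_apply (x j) v \<in> K m" by (intro K_mult past_x ij v)
  then have "cop_apply (x i * (monomial m cs - E (monomial m cs)) * x j) \<zeta> = 0"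
    using lower_letter_annihilates_K[OF ij(1) cs] by (simp add: v(2))
  then show "cinner \<eta> (cop_apply (x i * (monomial m cs - E (monomial m cs)) * x j) \<zeta>) =
      cinner \<eta> (cop_apply 0 \<zeta>)" by simp
qed

text \<open>Together with \<open>right_of\<close> a pair of annihilators for the differences
  \<open>monomial m cs - E (monomial m cs)\<close>. Being defined by the identity itself, they are
  linear subspaces, and they absorb arbitrary factors on the outer side.\<close>

definition left_of :: "int \<Rightarrow> 'h cop set"
  where "left_of m = {a. \<forall>cs j. coeff_list cs \<longrightarrow> j < m \<longrightarrow> a * (monomial m cs - E (monomial m cs)) * x j = 0}"

definition right_of :: "int \<Rightarrow> 'h cop set"
  where "right_of m = {b. \<forall>a\<in>left_of m. \<forall>cs. coeff_list cs \<longrightarrow> a * (monomial m cs - E (monomial m cs)) * b = 0}"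

text \<open>A tail coefficient next to a block merges with its outer coefficient, and the module
  property of \<open>E\<close> does the same for the expectation. Coefficients between a peak and
  its neighbours are thus harmless.\<close>

lemma monomial_mult_left:
  assumes "b \<in> utail" "coeff_list cs"
  obtains ds where "coeff_list ds" "b * monomial m cs = monomial m ds" "b * E (monomial m cs) = E (monomial m ds)"
proof -
  obtain c cs' where cs: "cs = c # cs'" "cs' \<noteq> []" using coeff_list_Cons[OF assms(2)] by blast
  have eq: "b * monomial m cs = monomial m ((b * c) # cs')"
    using cs(2) by (simp add: cs(1) monomial_def bmono_eval_Cons mult.assoc)
  have "coeff_list ((b * c) # cs')" using assms cs by (auto simp: coeff_list_def intro: utail_mult)
  then show ?thesis
    using that eq E_utail_left[OF assms(1) monomial_future[OF assms(2)]] by metis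
qed

lemma monomial_mult_right:
  assumes "b \<in> utail" "coeff_list cs"
  obtains ds where "coeff_list ds" "monomial m cs * b = monomial m ds" "E (monomial m cs) * b = E (monomial m ds)"
proof -
  obtain c cs' where cs: "cs = cs' @ [c]" "cs' \<noteq> []"
    using coeff_list_snoc[OF assms(2)] by blast
  have eq: "monomial m cs * b = monomial m (cs' @ [c * b])"
    using cs(2) by (simp add: cs(1) monomial_def bmono_eval_snoc mult.assoc)
  have "coeff_list (cs' @ [c * b])" using assms cs by (auto simp: coeff_list_def intro: utail_mult)
  then show ?thesis
    using that eq E_utail_right[OF assms(1) monomial_future[OF assms(2)]] by metis
qed

lemma left_of_x: "i < m \<Longrightarrow> x i \<in> left_of m"
  by (simp add: left_of_def peak_identity)

lemma left_of_mult: "a \<in> left_of m \<Longrightarrow> c * a \<in> left_of m"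
  by (simp add: left_of_def mult.assoc)

lemma left_of_utail: "a \<in> left_of m \<Longrightarrow> b \<in> utail \<Longrightarrow> a * b \<in> left_of m"
  unfolding left_of_def
proof clarify
  fix cs j assume a: "\<forall>cs j. coeff_list cs \<longrightarrow> j < m \<longrightarrow> a * (monomial m cs - E (monomial m cs)) * x j = 0"
    and b: "b \<in> utail" and cs: "coeff_list cs" and j: "j < m"
  obtain ds where ds: "coeff_list ds" "b * monomial m cs = monomial m ds" "b * E (monomial m cs) = E (monomial m ds)"
    using monomial_mult_left[OF b cs] by blast
  have "a * b * (monomial m cs - E (monomial m cs)) * x j = a * (b * monomial m cs - b * E (monomial m cs)) * x j"
    by (simp add: algebra_simps)
  then show "a * b * (monomial m cs - E (monomial m cs)) * x j = 0" using a ds j by simp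
qed

lemma left_of_csubspace: "csubspace (left_of m)"
  by (rule csubspaceI) (auto simp: left_of_def distrib_right mult_scaleC_left)

lemma right_of_x: "j < m \<Longrightarrow> x j \<in> right_of m"
  by (auto simp: right_of_def left_of_def)

lemma right_of_mult: "a \<in> right_of m \<Longrightarrow> a * c \<in> right_of m"
  by (auto simp: right_of_def simp flip: mult.assoc)

lemma right_of_utail: "a \<in> right_of m \<Longrightarrow> b \<in> utail \<Longrightarrow> b * a \<in> right_of m"
  unfolding right_of_def
proof clarify
  fix l cs assume a: "\<forall>l\<in>left_of m. \<forall>cs. coeff_list cs \<longrightarrow> l * (monomial m cs - E (monomial m cs)) * a = 0"
    and b: "b \<in> utail" and l: "l \<in> left_of m" and cs: "coeff_list cs"
  obtain ds where ds: "coeff_list ds" "monomial m cs * b = monomial m ds" "E (monomial m cs) * b = E (monomial m ds)"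
    using monomial_mult_right[OF b cs] by blast
  have "l * (monomial m cs - E (monomial m cs)) * (b * a) = l * (monomial m cs * b - E (monomial m cs) * b) * a"
    by (simp add: algebra_simps)
  then show "l * (monomial m cs - E (monomial m cs)) * (b * a) = 0" using a ds l by simp
qed

lemma right_of_csubspace: "csubspace (right_of m)"
  by (rule csubspaceI) (auto simp: right_of_def distrib_left mult_scaleC_right)

lemma bpolys0_coeff_list: "p \<in> bpolys0 tail \<Longrightarrow> bs \<in> Poly_Mapping.keys p \<Longrightarrow> coeff_list bs"
  using coefficients_utail unfolding bpolys0_def coeff_list_def coefficients_def by blast

lemma bpoly_eval_csubspace:
  assumes "p \<in> bpolys0 tail" "csubspace Z" "\<And>cs. coeff_list cs \<Longrightarrow> monomial m cs \<in> Z"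
  shows "bpoly_eval p (x m) \<in> Z"
  unfolding bpoly_eval_def monomial_def[symmetric]
  by (intro csubspace_sum[OF assms(2)] csubspaceD(3)[OF assms(2)] assms(3) bpolys0_coeff_list[OF assms(1)])

lemma bpoly_eval_future: "p \<in> bpolys0 tail \<Longrightarrow> bpoly_eval p (x m) \<in> future_algebra x m"
  by (rule bpoly_eval_csubspace[OF _ subalgebra_csubspace[OF future_subalgebra] monomial_future])

text \<open>Only the last letter matters: each monomial ends in \<open>x i\<close> and a tail
  coefficient, and whatever stands before them is an outer factor.\<close>

lemma bpoly_eval_left_of: "p \<in> bpolys0 tail \<Longrightarrow> i < m \<Longrightarrow> bpoly_eval p (x i) \<in> left_of m"
proof (rule bpoly_eval_csubspace[OF _ left_of_csubspace])
  fix cs assume i: "i < m" and cs: "coeff_list cs"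
  obtain cs' c where "cs = cs' @ [c]" "cs' \<noteq> []" "c \<in> utail"
    using coeff_list_snoc[OF cs] by blast
  then show "monomial i cs \<in> left_of m"
    using i by (simp add: monomial_def bmono_eval_snoc left_of_utail left_of_mult left_of_x)
qed

lemma bpoly_eval_right_of: "p \<in> bpolys0 tail \<Longrightarrow> i < m \<Longrightarrow> bpoly_eval p (x i) \<in> right_of m"
proof (rule bpoly_eval_csubspace[OF _ right_of_csubspace])
  fix cs assume i: "i < m" and cs: "coeff_list cs"
  obtain cs' c where "cs = c # cs'" "cs' \<noteq> []" "c \<in> utail"
    using coeff_list_Cons[OF cs] by blast
  then show "monomial i cs \<in> right_of m"
    using i by (simp add: monomial_def bmono_eval_Cons mult.assoc right_of_utail right_of_mult right_of_x)
qed

lemma bpoly_peak: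
  assumes a: "a \<in> left_of m" and b: "b \<in> right_of m" and p: "p \<in> bpolys0 tail"
  shows "a * bpoly_eval p (x m) * b = a * E (bpoly_eval p (x m)) * b"
proof -
  have "csubspace {d \<in> future_algebra x m. a * d * b = a * E d * b}"
    by (rule csubspaceI)
      (auto simp: distrib_left distrib_right mult_scaleC_left mult_scaleC_right E_add[of _ m] E_scaleC[of _ m]
        subalgebraD(1)[OF tail_subalgebra] intro: subalgebraD[OF future_subalgebra])
  moreover have "monomial m cs \<in> {d \<in> future_algebra x m. a * d * b = a * E d * b}" if "coeff_list cs" for cs
  proof -
    have "a * (monomial m cs - E (monomial m cs)) * b = 0" using b a that by (auto simp: right_of_def)
    then show ?thesis using monomial_future[OF that] by (simp add: algebra_simps)
  qed
  ultimately have "bpoly_eval p (x m) \<in> {d \<in> future_algebra x m. a * d * b = a * E d * b}"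
    by (rule bpoly_eval_csubspace[OF p])
  then show ?thesis by simp
qed

lemma \<alpha>_bpoly_eval: "p \<in> bpolys0 tail \<Longrightarrow> (\<alpha> ^^ n) (bpoly_eval p (x m)) = bpoly_eval p (x (m + int n))"
proof -
  assume p: "p \<in> bpolys0 tail"
  have "(\<alpha> ^^ n) (\<Sum>i\<in>I. f i) = (\<Sum>i\<in>I. (\<alpha> ^^ n) (f i))" for I and f :: "'h cop list \<Rightarrow> 'h cop"
    by (induction I rule: infinite_finite_induct) simp_all
  then show ?thesis
    unfolding bpoly_eval_def monomial_def[symmetric]
    using bpolys0_coeff_list[OF p] by (auto simp: \<alpha>_monomial coeff_list_def intro!: sum.cong)
qed

lemma identically_distributed_E: "identically_distributed tail E {k..} x"
  unfolding identically_distributed_def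
proof (intro ballI)
  fix i j p assume p: "p \<in> bpolys0 tail"
  have le: "E (bpoly_eval p (x i)) = E (bpoly_eval p (x j))" if "i \<le> j" for i j
    using E_\<alpha>_power[OF bpoly_eval_future[OF p], of "nat (j - i)" i] \<alpha>_bpoly_eval[OF p, of "nat (j - i)" i] that
    by simp
  show "E (bpoly_eval p (x i)) = E (bpoly_eval p (x j))"
  proof (cases "i \<le> j")
    case False
    then show ?thesis using le[of j i] by (intro sym[of "E (bpoly_eval p (x j))"]) simp
  qed (rule le)
qed

lemma conditional_expectation_E: "conditional_expectation (future_algebra x k) tail E"
proof -
  have "E ` future_algebra x k = tail"
    using E_in_tail tail_subset[of k] by (auto simp: image_iff) (metis E_tail subsetD)
  moreover have "E (b1 * a * b2) = b1 * E a * b2"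
    if "a \<in> future_algebra x k" "b1 \<in> tail" "b2 \<in> tail" for a b1 b2
    using E_utail_left[OF unitalI[OF that(2)] that(1)] E_utail_right[OF unitalI[OF that(3)], of "b1 * a" k]
      utail_future[OF unitalI[OF that(2)] that(1)] by simp
  ultimately show ?thesis
    unfolding conditional_expectation_def linear_on_def
    using future_subalgebra tail_subalgebra tail_subset E_add E_scaleC by auto
qed


text \<open>Both sides are weak limits of shifts and are compared between nonempty word vectors. At
  an end of the product, where the peak has no neighbour, the adjacent letter of the test word takes
  that role once the product has been shifted above it.\<close>

lemma monotonically_independent_E: "monotonically_independent tail E {k..} x"
  unfolding monotonically_independent_def
proof (intro allI impI)
  fix ps js l
  assume asm: "set ps \<subseteq> bpolys0 tail \<and> set js \<subseteq> {k..} \<and> length ps = length js \<and> distinct_adj js \<and> l < length js \<and>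
    (0 < l \<longrightarrow> js ! (l - 1) < js ! l) \<and> (Suc l < length js \<longrightarrow> js ! Suc l < js ! l)"
  define ys where "ys = map2 (\<lambda>p j. bpoly_eval p (x j)) ps js"
  define L R where "L = prod_list (take l ys)" and "R = prod_list (drop (Suc l) ys)"
  define m where "m = js ! l"
  define d where "d = ys ! l"
  have len: "length ys = length js" "l < length ys" using asm by (simp_all add: ys_def)
  have ps: "ps ! i \<in> bpolys0 tail" if "i < length ys" for i
    using asm that len by (auto simp: subset_iff)
  have ys: "ys ! i = bpoly_eval (ps ! i) (x (js ! i))" if "i < length ys" for i
    using that asm by (simp add: ys_def)
  have ysF: "set ys \<subseteq> future_algebra x k"
  proof
    fix y assume "y \<in> set ys"
    then obtain i where i: "i < length ys" "y = ys ! i" by (auto simp: in_set_conv_nth)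
    have "js ! i \<ge> k" using asm i(1) len by (metis atLeast_iff nth_mem subsetD)
    then show "y \<in> future_algebra x k"
      using bpoly_eval_future[OF ps[OF i(1)], of "js ! i"] future_antimono[of k "js ! i"] i ys by auto
  qed
  have d: "d = bpoly_eval (ps ! l) (x m)" using ys[OF len(2)] by (simp add: d_def m_def)
  have dm: "d \<in> future_algebra x m" unfolding d by (rule bpoly_eval_future[OF ps[OF len(2)]])
  have split: "prod_list ys = L * d * R"
    using arg_cong[OF id_take_nth_drop[OF len(2)], of prod_list] by (simp add: L_def R_def d_def mult.assoc)
  have F: "L * t * R \<in> future_algebra x k" if "t \<in> future_algebra x k" for t
  proof -
    have "prod_list (take l ys @ [t] @ drop (Suc l) ys) \<in> future_algebra x k"
      using ysF that set_take_subset[of l ys] set_drop_subset[of "Suc l" ys]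
      by (intro prod_list_in_subalgebra[OF future_subalgebra]) auto
    then show ?thesis by (simp add: L_def R_def mult.assoc)
  qed
  have dF: "d \<in> future_algebra x k" using ysF len(2) by (auto simp: d_def)
  have EF: "E d \<in> future_algebra x k" using E_in_tail[OF dm] tail_subset by blast
  have "E (L * d * R) = E (L * E d * R)"
  proof (rule cop_eqI_total[OF total_nonempty])
    fix \<eta> \<zeta> assume "\<eta> \<in> word_vector ` {ws. ws \<noteq> []}" "\<zeta> \<in> word_vector ` {ws. ws \<noteq> []}"
    then obtain v w where vw: "\<eta> = word_vector v" "v \<noteq> []" "\<zeta> = word_vector w" "w \<noteq> []" by blast
    obtain v1 v' where v: "v = v1 # v'" using vw(2) by (cases v) auto
    obtain w1 w' where w: "w = w1 # w'" using vw(4) by (cases w) auto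
    have eq: "cinner \<eta> (cop_apply ((\<alpha> ^^ n) (L * d * R)) \<zeta>) = cinner \<eta> (cop_apply ((\<alpha> ^^ n) (L * E d * R)) \<zeta>)"
      if n: "n \<ge> nat (max v1 w1 - m + 1)" for n
    proof -
      \<comment> \<open>The bound on \<open>n\<close> lifts the peak letter above \<open>v1\<close>
        and \<open>w1\<close>, the letters of the test words that touch the product.\<close>
      let ?m = "m + int n"
      have below: "v1 < ?m" "w1 < ?m" using n by linarith+
      have left: "word (rev v) * (\<alpha> ^^ n) L \<in> left_of ?m"
      proof (cases l)
        case 0
        then show ?thesis using below by (simp add: L_def v left_of_mult left_of_x)
      next
        case (Suc l')
        have "js ! l' < m" using asm Suc by (simp add: m_def)
        have l': "l' < length ys" using len(2) Suc by simp
        have "L = prod_list (take l' ys) * ys ! l'"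
          using l' by (simp add: L_def Suc take_Suc_conv_app_nth)
        then have "(\<alpha> ^^ n) L = (\<alpha> ^^ n) (prod_list (take l' ys)) * bpoly_eval (ps ! l') (x (js ! l' + int n))"
          by (simp add: ys[OF l'] \<alpha>_bpoly_eval[OF ps[OF l']])
        then show ?thesis
          using \<open>js ! l' < m\<close> by (simp add: left_of_mult bpoly_eval_left_of[OF ps[OF l']])
      qed
      have right: "(\<alpha> ^^ n) R * word w \<in> right_of ?m"
      proof (cases "Suc l < length ys")
        case False
        then show ?thesis using below by (simp add: R_def w right_of_mult right_of_x)
      next
        case True
        have "js ! Suc l < m" using asm True len by (simp add: m_def)
        have "R = ys ! Suc l * prod_list (drop (Suc (Suc l)) ys)"
          using Cons_nth_drop_Suc[OF True] by (metis R_def prod_list.Cons)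
        then have "(\<alpha> ^^ n) R = bpoly_eval (ps ! Suc l) (x (js ! Suc l + int n)) * (\<alpha> ^^ n) (prod_list (drop (Suc (Suc l)) ys))"
          by (simp add: ys[OF True] \<alpha>_bpoly_eval[OF ps[OF True]])
        then show ?thesis
          using \<open>js ! Suc l < m\<close> by (simp add: mult.assoc right_of_mult bpoly_eval_right_of[OF ps[OF True]])
      qed
      have "(\<alpha> ^^ n) d = bpoly_eval (ps ! l) (x ?m)" unfolding d by (rule \<alpha>_bpoly_eval[OF ps[OF len(2)]])
      moreover have "(\<alpha> ^^ n) (E d) = E d" using E_in_tail[OF dm] by (simp add: unitalI)
      moreover have "E d = E (bpoly_eval (ps ! l) (x ?m))"
        using E_\<alpha>_power[OF dm, of n] calculation(1) by simp
      ultimately show ?thesis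
        unfolding vw(1,3) cinner_word_vector
        using bpoly_peak[OF left right ps[OF len(2)]] by (simp add: mult.assoc)
    qed
    have lim1: "(\<lambda>n. cinner \<eta> (cop_apply ((\<alpha> ^^ n) (L * d * R)) \<zeta>)) \<longlonglongrightarrow> cinner \<eta> (cop_apply (E (L * d * R)) \<zeta>)"
      using E_tendsto[OF F[OF dF]] unfolding wot_tendsto_def by blast
    have lim2: "(\<lambda>n. cinner \<eta> (cop_apply ((\<alpha> ^^ n) (L * E d * R)) \<zeta>)) \<longlonglongrightarrow> cinner \<eta> (cop_apply (E (L * E d * R)) \<zeta>)"
      using E_tendsto[OF F[OF EF]] unfolding wot_tendsto_def by blast
    have "eventually (\<lambda>n. cinner \<eta> (cop_apply ((\<alpha> ^^ n) (L * d * R)) \<zeta>) =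
        cinner \<eta> (cop_apply ((\<alpha> ^^ n) (L * E d * R)) \<zeta>)) sequentially"
      using eq unfolding eventually_sequentially by blast
    from Lim_transform_eventually[OF lim1 this]
    show "cinner \<eta> (cop_apply (E (L * d * R)) \<zeta>) = cinner \<eta> (cop_apply (E (L * E d * R)) \<zeta>)"
      using lim2 LIMSEQ_unique by blast
  qed
  then show "let ys = map2 (\<lambda>p j. bpoly_eval p (x j)) ps js in
      E (prod_list ys) = E (prod_list (take l ys) * E (ys ! l) * prod_list (drop (Suc l) ys))"
    unfolding Let_def ys_def[symmetric] split by (simp add: L_def R_def d_def)
qed

end

text \<open>Joint distributions evaluate a functional on elements of \<open>A\<close> only, so the
  state may be exchanged for a vector functional defined on all operators.\<close>

lemma monotonically_spreadable_cong:
  assumes "monotonically_spreadable \<phi> x UNIV" and A: "csubspace A"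
    and x: "\<And>js. prod_list (map x js) \<in> A" and eq: "\<And>a. a \<in> A \<Longrightarrow> \<phi> a = \<psi> a"
  shows "monotonically_spreadable \<psi> x UNIV"
proof -
  have "joint_distribution \<phi> (x \<circ> s) = joint_distribution \<psi> (x \<circ> s)" for s :: "nat \<Rightarrow> 'b"
  proof
    fix p
    have "prod_list (map (x \<circ> s) js) \<in> A" for js using x[of "map s js"] by simp
    then have "nc_eval (x \<circ> s) p \<in> A"
      unfolding nc_eval_def by (intro csubspace_sum[OF A] csubspaceD[OF A])
    then show "joint_distribution \<phi> (x \<circ> s) p = joint_distribution \<psi> (x \<circ> s) p"
      by (simp add: joint_distribution_def eq)
  qed
  then show ?thesis
    using assms(1) unfolding monotonically_spreadable_def monotonically_spreadable_fin_def Mi_invariant_def by simp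
qed

text \<open>The generators are selfadjoint and the adjoint is weakly continuous, so the closure is
  stable under adjoints. This is what places the generated von Neumann algebra inside the weak
  closure of the algebra without unit.\<close>

lemma von_neumann_closure:
  assumes sa: "\<And>i. adj (x i) = x i" and one: "1 \<in> wot closure_of (subalgebra hull (range x))"
  shows "von_neumann_algebra (wot closure_of (subalgebra hull (range x)))"
proof -
  have "subalgebra {a. adj a \<in> subalgebra hull (range x)}"
    using subalgebra_hull[of "range x"] by (auto simp: subalgebra_def)
  then have "subalgebra hull (range x) \<subseteq> {a. adj a \<in> subalgebra hull (range x)}"
    by (intro hull_minimal) (auto intro: hull_inc simp: sa)
  then have "adj a \<in> wot closure_of (subalgebra hull (range x))" if "a \<in> wot closure_of (subalgebra hull (range x))" for a
    using wot_closure_image[OF continuous_map_wot_adj _ that] wot_closure_incr by blast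
  then show ?thesis
    using one subalgebra_wot_closure[OF subalgebra_hull] by (simp add: von_neumann_algebra_def)
qed

text \<open>A vector orthogonal to all nonempty word vectors is orthogonal to
  \<open>cop_apply a \<Omega>\<close> for each \<open>a\<close> in \<open>A\<close> by weak
  continuity, and these vectors are dense.\<close>

lemma total_word_vectors:
  assumes dense: "closure ((\<lambda>a. cop_apply a \<Omega>) ` A) = UNIV" and A: "A \<subseteq> wot closure_of (subalgebra hull (range x))"
  shows "total {cop_apply (prod_list (map x ws)) \<Omega> | ws. ws \<noteq> []}"
  unfolding total_def
proof (intro allI impI)
  fix \<eta> assume \<eta>: "\<forall>v\<in>{cop_apply (prod_list (map x ws)) \<Omega> | ws. ws \<noteq> []}. cinner v \<eta> = 0"
  have "subalgebra hull (range x) \<subseteq> {a. cinner \<eta> (cop_apply a \<Omega>) = 0}"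
  proof (rule subalgebra_hull_subset_csubspace)
    fix ws assume ws: "ws \<noteq> []" "set ws \<subseteq> range x"
    then have "ws \<in> lists (x ` UNIV)" by (simp add: lists_eq_set)
    then obtain vs where "ws = map x vs" unfolding lists_image by auto
    then have "cinner (cop_apply (prod_list ws) \<Omega>) \<eta> = 0" using \<eta> ws by blast
    then show "prod_list ws \<in> {a. cinner \<eta> (cop_apply a \<Omega>) = 0}"
      using cinner_commute[of \<eta>] by simp
  qed (auto intro!: csubspaceI simp: cinner_simps)
  then have zero: "cinner \<eta> (cop_apply a \<Omega>) = 0" if "a \<in> subalgebra hull (range x)" for a
    using that by blast
  have "cinner \<eta> (cop_apply a \<Omega>) = 0" if "a \<in> A" for a
    using that A by (intro wot_closure_eq[where g = "\<lambda>_. 0", OF zero _ continuous_map_wot_coeff]) auto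
  then have "(\<lambda>a. cop_apply a \<Omega>) ` A \<subseteq> {\<zeta>. cinner \<eta> \<zeta> = 0}" by blast
  moreover have "closed {\<zeta>. cinner \<eta> \<zeta> = 0}"
    by (intro closed_Collect_eq continuous_on_const
        bounded_linear.continuous_on[OF bounded_bilinear.bounded_linear_right[OF bounded_bilinear_cinner]] continuous_on_id)
  ultimately have "closure ((\<lambda>a. cop_apply a \<Omega>) ` A) \<subseteq> {\<zeta>. cinner \<eta> \<zeta> = 0}"
    by (rule closure_minimal)
  then have "cinner \<eta> \<eta> = 0" using dense by blast
  then show "\<eta> = 0" by simp
qed

theorem theorem1p1:
  fixes A :: "'h::chilbert_space cop set"
    and \<phi> :: "'h cop \<Rightarrow> complex"
    and \<Omega> :: 'h
    and x :: "int \<Rightarrow> 'h cop"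
  assumes "nondegenerated_wstar_probability_space A \<phi>"
    and "acts_on_gns_space A \<phi> \<Omega>"
    and "\<And>i. selfadjoint (x i)"
    and "von_neumann_algebra hull (range x) = A"
    and "1 \<in> wot closure_of (subalgebra hull (range x))"
  shows "monotonically_spreadable \<phi> x UNIV \<longleftrightarrow>
    (\<exists>E :: int \<Rightarrow> 'h cop \<Rightarrow> 'h cop.
      (\<forall>k. conditional_expectation (future_algebra x k) (tail_algebra x) (E k)
        \<and> (\<forall>a\<in>future_algebra x k. \<phi> (E k a) = \<phi> a)
        \<and> identically_distributed (tail_algebra x) (E k) {k..} x
        \<and> monotonically_independent (tail_algebra x) (E k) {k..} x)
      \<and> (\<forall>k k'. k \<le> k' \<longrightarrow> (\<forall>a\<in>future_algebra x k'. E k a = E k' a)))"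
    (is "?spreadable \<longleftrightarrow> (\<exists>E. ?independent E)")
proof -
  have A: "subalgebra A" "1 \<in> A" "closedin wot A" and lin: "linear_on A \<phi>"
    using assms(1) by (auto simp: nondegenerated_wstar_probability_space_def von_neumann_algebra_def state_on_def)
  note A_sub = subalgebra_csubspace[OF A(1)]
  have \<phi>: "\<phi> a = cinner \<Omega> (cop_apply a \<Omega>)" if "a \<in> A" for a
    using assms(2) that by (simp add: acts_on_gns_space_def)
  have sa: "adj (x i) = x i" for i using assms(3) by (simp add: selfadjoint_def)
  have xA: "range x \<subseteq> A" using hull_subset[of "range x" von_neumann_algebra] assms(4) by simp
  have words: "prod_list (map x js) \<in> A" for js
  proof (cases "js = []")
    case False
    then show ?thesis using xA by (intro prod_list_in_subalgebra[OF A(1)]) auto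
  qed (simp add: A(2))
  have future_A: "future_algebra x k \<subseteq> A" for k
    unfolding future_algebra_def
    by (intro closure_of_minimal A(3) hull_minimal A(1)) (use xA in blast)
  show ?thesis
  proof
    assume ?spreadable
    then have "monotonically_spreadable (\<lambda>a. cinner \<Omega> (cop_apply a \<Omega>)) x UNIV"
      by (rule monotonically_spreadable_cong[OF _ A_sub words \<phi>])
    moreover have "A \<subseteq> wot closure_of (subalgebra hull (range x))"
      unfolding assms(4)[symmetric]
      by (intro hull_minimal von_neumann_closure sa assms(5)) (auto intro: wot_closure_incr hull_inc)
    then have "total {cop_apply (prod_list (map x ws)) \<Omega> | ws. ws \<noteq> []}"
      using assms(2) by (intro total_word_vectors[of _ A]) (auto simp: acts_on_gns_space_def)
    ultimately interpret spreadable_sequence \<Omega> x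
      by unfold_locales (simp_all add: sa)
    have "\<phi> (E a) = \<phi> a" if "a \<in> future_algebra x k" for a k
    proof -
      have "E a \<in> A" "a \<in> A" using E_in_tail[OF that] tail_subset[of k] that future_A[of k] by auto
      then show ?thesis using ev_E[OF that] by (simp add: \<phi> ev_def)
    qed
    \<comment> \<open>The weak limit defining \<open>E\<close> involves no starting index, so one
      map serves for all \<open>k\<close> and the compatibility of the expectations is
      immediate.\<close>
    then show "\<exists>E. ?independent E"
      by (intro exI[of _ "\<lambda>_. E"] conjI allI impI ballI refl conditional_expectation_E
          identically_distributed_E monotonically_independent_E)
  next
    assume "\<exists>E. ?independent E"
    then obtain E where E: "?independent E" by blast
    show ?spreadable
      unfolding monotonically_spreadable_def monotonically_spreadable_fin_def
    proof (intro allI impI ballI)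
      fix l k and s :: "nat \<Rightarrow> int"
      assume s: "strict_mono_on {1..l} s \<and> s ` {1..l} \<subseteq> UNIV" and k: "k \<in> {1..<l}"
      \<comment> \<open>All letters of the finite subsequence lie in the future of its first index,
        so the single expectation \<open>E (s 1)\<close> suffices for it.\<close>
      have "s 1 \<le> s i" if "i \<in> {1..l}" for i
        using strict_mono_onD[of "{1..l}" s 1 i] s that by (cases "i = 1") auto
      then have "s ` {1..l} \<subseteq> {s 1..}" by auto
      moreover have "x i \<in> future_algebra x (s 1)" if "i \<in> {s 1..}" for i
        unfolding future_algebra_def using that by (intro wot_closure_incr hull_inc) auto
      ultimately show "Mi_invariant \<phi> (x \<circ> s) l k"
        using E s k words
        by (intro independent_imp_invariant[where C = "future_algebra x (s 1)" and B = "tail_algebra x"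
              and E = "E (s 1)" and I = "{s 1..}" and A = A, OF _ _ _ _ _ A_sub lin]) auto
    qed
  qed
qed

end
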